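(* Let $H\in C^1([0,T];\mathbb R^d)$ satisfy $H_0:=\min_{t\in[0,T]}|H(t)|>0$. Suppose that there exists a partition $\{t_j\}_0^m$ of $[0,T]$ such that $$\frac{H(t)}{|H(t)|}\cdot\eta_j\ge S_*\qquad\text{for all } t\in[t_j,t_{j+1}],\ j=0,\ldots,m-1,\qquad\text{where }\eta_j:=\frac{H(t_j)}{|H(t_j)|},$$ and such that $$\max_{0\le j\le m-1}\frac{(t_{j+1}-t_j)\,d_\Omega(x_j)}{M_\Omega^2(x_j)}>\frac{1}{H_0\,(2S_*^2-1)},$$ where the points $x_j$ and the quantities $d_\Omega(x_j)$, $M_\Omega(x_j)$ are defined in the context. Then there exists a constant $C>0$ such that, for every $g\in L^2(\partial\Omega\times(0,T))$ and every $u\in H^1(Q)$ satisfying $$\partial_tu+H(t)\cdot\nabla u=0\ \text{ in } Q=\Omega\times(0,T),\qquad u|_{\partial\Omega\times(0,T)}=g,$$ one has $$\|u(\cdot,t)\|_{L^2(\Omega)}\le C\,\|g\|_{L^2(\partial\Omega\times(0,T))},\qquad 0\le t\le T.$$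
   Context: Setting: $d\in\mathbb N$, $T>0$, $\Omega\subset\mathbb R^d$ is a bounded domain with smooth boundary $\partial\Omega$ and with $\mathbf 0\in\overline\Omega$. Functions are real-valued; $u(\cdot,t)$ and $u|_{\partial\Omega\times(0,T)}$ are understood as traces of $u\in H^1(Q)$. A partition $\{t_j\}_0^m$ of $[0,T]$ is a strictly increasing finite sequence $0=t_0<t_1<\cdots<t_m=T$ for some $m\in\mathbb N$. Fixed parameters: $S_*\in(1/\sqrt2,1)$ and $r>0$. Put $\delta_\Omega=\sup_{x,y\in\overline\Omega}|x-y|$ and, for $j=0,\ldots,m-1$, $$R_0=\frac{1+S_*}{1-S_*}\,\delta_\Omega,\qquad R_j=2^jR_0+(2^j-1)(\delta_\Omega+r),\qquad x_j:=-R_j\eta_j,$$ $$M_\Omega(x_j):=\max_{x\in\overline\Omega}|x-x_j|,\qquad d_\Omega(x_j):=\min_{x\in\overline\Omega}|x-x_j|.$$ *)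

theory Defs
  imports "HOL-Analysis.Analysis"
begin

primrec Ck :: "nat \<Rightarrow> ('a::euclidean_space \<Rightarrow> real) \<Rightarrow> bool" where
  "Ck 0 f \<longleftrightarrow> continuous_on UNIV f"
| "Ck (Suc k) f \<longleftrightarrow> (\<forall>x. f differentiable (at x)) \<and>
     (\<forall>b\<in>Basis. Ck k (\<lambda>x. frechet_derivative f (at x) b))"

definition smooth :: "('a::euclidean_space \<Rightarrow> real) \<Rightarrow> bool" where
  "smooth f \<longleftrightarrow> (\<forall>k. Ck k f)"

definition gradient :: "('a::euclidean_space \<Rightarrow> real) \<Rightarrow> 'a \<Rightarrow> 'a" where
  "gradient f x = (\<Sum>b\<in>Basis. frechet_derivative f (at x) b *\<^sub>R b)"

text \<open>Near each boundary point the domain is the strict epigraph, in some unit direction \<open>e\<close>,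
  of a smooth function on the hyperplane orthogonal to \<open>e\<close>. That function is represented
  by a smooth \<open>\<gamma>\<close> on the whole space, evaluated only on the hyperplane.\<close>

definition smooth_boundary :: "'a::euclidean_space set \<Rightarrow> bool" where
  "smooth_boundary \<Omega> \<longleftrightarrow> (\<forall>p\<in>frontier \<Omega>. \<exists>e \<gamma> \<rho>. norm e = 1 \<and> smooth \<gamma> \<and> \<rho> > 0 \<and>
     \<Omega> \<inter> ball p \<rho> = {x \<in> ball p \<rho>. x \<bullet> e > \<gamma> (x - (x \<bullet> e) *\<^sub>R e)})"

definition bounded_smooth_domain :: "'a::euclidean_space set \<Rightarrow> bool" where
  "bounded_smooth_domain \<Omega> \<longleftrightarrow>
     open \<Omega> \<and> connected \<Omega> \<and> \<Omega> \<noteq> {} \<and> bounded \<Omega> \<and> smooth_boundary \<Omega>"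

text \<open>The surface measure on \<open>\<partial>\<Omega>\<close> is the Hausdorff measure of dimension \<open>d - 1\<close>, normalised so
  that the \<open>n\<close>-dimensional one agrees with Lebesgue measure on an \<open>n\<close>-dimensional Euclidean space.
  The empty set is treated separately because \<open>0 ^ 0 = 1\<close>, which matters for \<open>n = 0\<close>
  (counting measure).\<close>

definition hausdorff_content :: "nat \<Rightarrow> real \<Rightarrow> 'a::metric_space set \<Rightarrow> ennreal" where
  "hausdorff_content n \<epsilon> A =
     (INF E \<in> {E :: nat \<Rightarrow> 'a set. A \<subseteq> (\<Union>i. E i) \<and> (\<forall>i. bounded (E i) \<and> diameter (E i) \<le> \<epsilon>)}.
        \<Sum>i. if E i = {} then 0
             else ennreal (unit_ball_vol (real n) * (diameter (E i) / 2) ^ n))"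

definition hausdorff_measure :: "nat \<Rightarrow> 'a::metric_space measure" where
  "hausdorff_measure n =
     measure_of UNIV (sets borel) (\<lambda>A. SUP \<epsilon>\<in>{0<..}. hausdorff_content n \<epsilon> A)"

definition surface_measure :: "'a::euclidean_space set \<Rightarrow> 'a measure" where
  "surface_measure \<Omega> = restrict_space (hausdorff_measure (DIM('a) - 1)) (frontier \<Omega>)"

definition L2 :: "'m measure \<Rightarrow> ('m \<Rightarrow> 'b::euclidean_space) \<Rightarrow> bool" where
  "L2 M f \<longleftrightarrow> f \<in> borel_measurable M \<and> integrable M (\<lambda>x. (norm (f x))\<^sup>2)"

definition L2_norm :: "'m measure \<Rightarrow> ('m \<Rightarrow> 'b::euclidean_space) \<Rightarrow> real" where
  "L2_norm M f = sqrt (\<integral>x. (norm (f x))\<^sup>2 \<partial>M)"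

definition L2_tendsto ::
  "'m measure \<Rightarrow> (nat \<Rightarrow> 'm \<Rightarrow> 'b::euclidean_space) \<Rightarrow> ('m \<Rightarrow> 'b) \<Rightarrow> bool" where
  "L2_tendsto M F f \<longleftrightarrow> (\<forall>n. L2 M (F n)) \<and> L2 M f \<and>
     (\<lambda>n. L2_norm M (\<lambda>x. F n x - f x)) \<longlonglongrightarrow> 0"

definition test_function :: "'a::euclidean_space set \<Rightarrow> ('a \<Rightarrow> real) \<Rightarrow> bool" where
  "test_function U \<phi> \<longleftrightarrow> smooth \<phi> \<and> (\<exists>K. compact K \<and> K \<subseteq> U \<and> (\<forall>x. x \<notin> K \<longrightarrow> \<phi> x = 0))"

definition weak_gradient ::
  "'a::euclidean_space set \<Rightarrow> ('a \<Rightarrow> real) \<Rightarrow> ('a \<Rightarrow> 'a) \<Rightarrow> bool" where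
  "weak_gradient U u G \<longleftrightarrow> (\<forall>\<phi>. test_function U \<phi> \<longrightarrow> (\<forall>b\<in>Basis.
     (\<integral>x. u x * frechet_derivative \<phi> (at x) b \<partial>lebesgue_on U) =
     - (\<integral>x. (G x \<bullet> b) * \<phi> x \<partial>lebesgue_on U)))"

definition has_H1_gradient ::
  "'a::euclidean_space set \<Rightarrow> ('a \<Rightarrow> real) \<Rightarrow> ('a \<Rightarrow> 'a) \<Rightarrow> bool" where
  "has_H1_gradient U u G \<longleftrightarrow>
     L2 (lebesgue_on U) u \<and> L2 (lebesgue_on U) G \<and> weak_gradient U u G"

definition H1 :: "'a::euclidean_space set \<Rightarrow> ('a \<Rightarrow> real) \<Rightarrow> bool" where
  "H1 U u \<longleftrightarrow> (\<exists>G. has_H1_gradient U u G)"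

definition smooth_H1_tendsto ::
  "'a::euclidean_space set \<Rightarrow> (nat \<Rightarrow> 'a \<Rightarrow> real) \<Rightarrow> ('a \<Rightarrow> real) \<Rightarrow> bool" where
  "smooth_H1_tendsto U \<Phi> u \<longleftrightarrow> (\<forall>n. smooth (\<Phi> n)) \<and>
     (\<exists>G. has_H1_gradient U u G \<and> L2_tendsto (lebesgue_on U) \<Phi> u \<and>
          L2_tendsto (lebesgue_on U) (\<lambda>n. gradient (\<Phi> n)) G)"

definition cylinder :: "'a set \<Rightarrow> real \<Rightarrow> ('a \<times> real) set" where
  "cylinder \<Omega> T = \<Omega> \<times> {0<..<T}"

definition lateral_measure :: "'a::euclidean_space set \<Rightarrow> real \<Rightarrow> ('a \<times> real) measure" where
  "lateral_measure \<Omega> T =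
     completion (surface_measure \<Omega> \<Otimes>\<^sub>M restrict_space lborel {0<..<T})"

text \<open>The trace operators are the continuous extensions to \<open>H\<^sup>1(Q)\<close> of the restriction of functions
  smooth up to the boundary of \<open>Q\<close>. They are given here by their graphs, so that \<open>g\<close> and \<open>w\<close>
  range over all representatives of the trace.\<close>

definition has_lateral_trace ::
  "'a::euclidean_space set \<Rightarrow> real \<Rightarrow> ('a \<times> real \<Rightarrow> real) \<Rightarrow> ('a \<times> real \<Rightarrow> real) \<Rightarrow> bool" where
  "has_lateral_trace \<Omega> T u g \<longleftrightarrow> (\<exists>\<Phi>. smooth_H1_tendsto (cylinder \<Omega> T) \<Phi> u \<and>
     L2_tendsto (lateral_measure \<Omega> T) \<Phi> g)"

definition has_time_trace ::
  "'a::euclidean_space set \<Rightarrow> real \<Rightarrow> ('a \<times> real \<Rightarrow> real) \<Rightarrow> real \<Rightarrow> ('a \<Rightarrow> real) \<Rightarrow> bool" where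
  "has_time_trace \<Omega> T u t w \<longleftrightarrow> (\<exists>\<Phi>. smooth_H1_tendsto (cylinder \<Omega> T) \<Phi> u \<and>
     L2_tendsto (lebesgue_on \<Omega>) (\<lambda>n x. \<Phi> n (x, t)) w)"

definition transport_solution ::
  "'a::euclidean_space set \<Rightarrow> real \<Rightarrow> (real \<Rightarrow> 'a) \<Rightarrow> ('a \<times> real \<Rightarrow> real) \<Rightarrow> bool" where
  "transport_solution \<Omega> T H u \<longleftrightarrow> (\<exists>G. has_H1_gradient (cylinder \<Omega> T) u G \<and>
     (AE z in lebesgue_on (cylinder \<Omega> T). snd (G z) + H (snd z) \<bullet> fst (G z) = 0))"

text \<open>The derivative is one-sided at the end points \<open>0\<close> and \<open>T\<close>.\<close>

definition C1_on_interval :: "real \<Rightarrow> (real \<Rightarrow> 'a::real_normed_vector) \<Rightarrow> bool" where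
  "C1_on_interval T H \<longleftrightarrow> (\<exists>H'. continuous_on {0..T} H' \<and>
     (\<forall>t\<in>{0..T}. (H has_vector_derivative H' t) (at t within {0..T})))"

definition min_speed :: "real \<Rightarrow> (real \<Rightarrow> 'a::real_normed_vector) \<Rightarrow> real" where
  "min_speed T H = (INF t\<in>{0..T}. norm (H t))"

definition is_partition :: "real \<Rightarrow> nat \<Rightarrow> (nat \<Rightarrow> real) \<Rightarrow> bool" where
  "is_partition T m \<tau> \<longleftrightarrow> 1 \<le> m \<and> \<tau> 0 = 0 \<and> \<tau> m = T \<and> (\<forall>j<m. \<tau> j < \<tau> (Suc j))"

definition eta :: "(real \<Rightarrow> 'a::real_normed_vector) \<Rightarrow> (nat \<Rightarrow> real) \<Rightarrow> nat \<Rightarrow> 'a" where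
  "eta H \<tau> j = H (\<tau> j) /\<^sub>R norm (H (\<tau> j))"

definition radius :: "real \<Rightarrow> real \<Rightarrow> 'a::metric_space set \<Rightarrow> nat \<Rightarrow> real" where
  "radius S r \<Omega> j =
     2 ^ j * ((1 + S) / (1 - S) * diameter (closure \<Omega>)) +
     (2 ^ j - 1) * (diameter (closure \<Omega>) + r)"

definition source_point ::
  "real \<Rightarrow> real \<Rightarrow> 'a::real_normed_vector set \<Rightarrow> (real \<Rightarrow> 'a) \<Rightarrow> (nat \<Rightarrow> real) \<Rightarrow> nat \<Rightarrow> 'a" where
  "source_point S r \<Omega> H \<tau> j = - (radius S r \<Omega> j *\<^sub>R eta H \<tau> j)"

definition max_dist :: "'a::real_normed_vector set \<Rightarrow> 'a \<Rightarrow> real" where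
  "max_dist \<Omega> p = (SUP x\<in>closure \<Omega>. norm (x - p))"

definition min_dist :: "'a::real_normed_vector set \<Rightarrow> 'a \<Rightarrow> real" where
  "min_dist \<Omega> p = (INF x\<in>closure \<Omega>. norm (x - p))"

end

theory Submission
  imports Defs
begin

text \<open>For smooth \<open>v\<close> put \<open>f = \<partial>\<^sub>t v + H \<bullet> \<nabla> v\<close> and integrate \<open>\<partial>\<^sub>t (\<phi> v\<^sup>2)\<close> over \<open>\<Omega> \<times> (a, b)\<close> for an affine
  multiplier \<open>\<phi> x = x \<bullet> p + c\<close>. Up to boundary terms and terms containing \<open>f\<close>, the choice \<open>\<phi> = 1\<close> shows
  that the energy \<open>\<integral> v\<^sup>2\<close> is the same at all times, and \<open>\<phi> x = (x - x\<^sub>0) \<bullet> \<eta>\<^sub>j\<close> bounds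
  \<open>S H\<^sub>0 (t\<^bsub>j+1\<^esub> - t\<^sub>j)\<close> times the energy by the diameter of \<open>\<Omega>\<close> times the energy. Since
  \<open>d \<le> R\<^sub>j \<le> M\<close>, the hypothesis on the partition makes the first factor larger than the diameter for some
  \<open>j\<close>, so that the energy is absorbed. The traces of \<open>u\<close> are limits of smooth \<open>v\<close> for which \<open>f \<rightarrow> 0\<close>.

  The boundary terms only require an upper bound of \<open>\<integral> \<partial>\<^sub>b F\<close> by the Hausdorff measure of the frontier.
  It follows by covering the frontier with small sets and estimating the volume that they sweep out
  under a small translation in the direction \<open>b\<close>; the smoothness of the boundary is irrelevant.\<close>

section \<open>Hausdorff measure\<close>

text \<open>Three obstacles shape the development. \<open>measure_of\<close> yields the zero measure
  unless the given set function is countably additive on the Borel sets, so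
  \<open>hausdorff_measure\<close> carries no information before the Caratheodory argument. The
  surface measure is not shown to be sigma-finite, while the lateral norm integrates over time
  inside and over the frontier outside; the boundary estimate at a fixed time needs the opposite
  order. Finally, traces and weak gradients are given by witnesses that are not unique: the lateral
  trace, the time trace and the equation each bring their own, and these must be reconciled. Since
  \<open>C\<close> may be any constant, the boundary flux is bounded in absolute value, coordinate
  by coordinate, instead of being expressed by the normal vector; this costs the factor
  \<open>DIM('a)\<close>. The form of the threshold enters only through
  \<open>2 * S\<^sup>2 - 1 < S\<close>, which converts it into the speed bound
  \<open>S * min_speed T H\<close> along \<open>eta H \<tau> j\<close>.\<close>

definition hausdorff_weight :: "nat \<Rightarrow> 'a::metric_space set \<Rightarrow> ennreal" where
  "hausdorff_weight n E =
     (if E = {} then 0 else ennreal (unit_ball_vol (real n) * (diameter E / 2) ^ n))"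

definition hausdorff_covers :: "real \<Rightarrow> 'a::metric_space set \<Rightarrow> (nat \<Rightarrow> 'a set) set" where
  "hausdorff_covers \<epsilon> A = {E. A \<subseteq> (\<Union>i. E i) \<and> (\<forall>i. bounded (E i) \<and> diameter (E i) \<le> \<epsilon>)}"

section \<open>Hausdorff contents at a fixed scale\<close>

lemma hausdorff_content_eq:
  "hausdorff_content n \<epsilon> A = (INF E\<in>hausdorff_covers \<epsilon> A. \<Sum>i. hausdorff_weight n (E i))"
  by (simp add: hausdorff_content_def hausdorff_covers_def hausdorff_weight_def)

lemma hausdorff_weight_empty [simp]: "hausdorff_weight n {} = 0"
  by (simp add: hausdorff_weight_def)

lemma hausdorff_content_le:
  "E \<in> hausdorff_covers \<epsilon> A \<Longrightarrow> hausdorff_content n \<epsilon> A \<le> (\<Sum>i. hausdorff_weight n (E i))"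
  unfolding hausdorff_content_eq by (rule INF_lower)

lemma hausdorff_content_empty:
  assumes "\<epsilon> \<ge> 0" shows "hausdorff_content n \<epsilon> ({}::'a::metric_space set) = 0"
proof -
  have "(\<lambda>i. {}) \<in> hausdorff_covers \<epsilon> ({}::'a set)"
    using assms by (simp add: hausdorff_covers_def)
  from hausdorff_content_le[OF this, of n] show ?thesis by simp
qed

lemma hausdorff_content_mono: "A \<subseteq> B \<Longrightarrow> hausdorff_content n \<epsilon> A \<le> hausdorff_content n \<epsilon> B"
  unfolding hausdorff_content_eq by (rule INF_superset_mono) (auto simp: hausdorff_covers_def)

lemma hausdorff_content_antimono: "\<epsilon> \<le> \<epsilon>' \<Longrightarrow> hausdorff_content n \<epsilon>' A \<le> hausdorff_content n \<epsilon> A"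
  unfolding hausdorff_content_eq
  by (rule INF_superset_mono) (auto simp: hausdorff_covers_def intro: order_trans)

text \<open>Covers of the sets \<open>A i\<close> that are optimal up to
  \<open>e * (1/2) ^ Suc i\<close> are merged into one sequence by \<open>prod_decode\<close>; the
  errors sum to \<open>e\<close>.\<close>

lemma hausdorff_content_countably_subadditive:
  fixes A :: "nat \<Rightarrow> 'a::metric_space set"
  shows "hausdorff_content n \<epsilon> (\<Union>i. A i) \<le> (\<Sum>i. hausdorff_content n \<epsilon> (A i))"
proof (rule ennreal_le_epsilon)
  fix e :: real
  assume fin: "(\<Sum>i. hausdorff_content n \<epsilon> (A i)) < top" and e: "0 < e"
  have "\<exists>E. E \<in> hausdorff_covers \<epsilon> (A i) \<and>
      (\<Sum>k. hausdorff_weight n (E k)) \<le> hausdorff_content n \<epsilon> (A i) + ennreal (e * (1/2) ^ Suc i)" for i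
  proof -
    have "hausdorff_content n \<epsilon> (A i) \<le> (\<Sum>i. hausdorff_content n \<epsilon> (A i))"
      using sum_le_suminf[of "\<lambda>i. hausdorff_content n \<epsilon> (A i)" "{i}"] by simp
    then have "hausdorff_content n \<epsilon> (A i) < top"
      using fin by (rule le_less_trans)
    \<comment> \<open>Adding a positive amount is strict only because the content is finite.\<close>
    then have "hausdorff_content n \<epsilon> (A i) < hausdorff_content n \<epsilon> (A i) + ennreal (e * (1/2) ^ Suc i)"
      using e ennreal_add_left_cancel_less[of "hausdorff_content n \<epsilon> (A i)" 0 "ennreal (e * (1/2) ^ Suc i)"]
      by (simp add: less_top)
    then show ?thesis
      unfolding hausdorff_content_eq INF_less_iff by (auto simp: less_imp_le)
  qed
  then obtain E where E: "\<And>i. E i \<in> hausdorff_covers \<epsilon> (A i)"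
    and Ele: "\<And>i. (\<Sum>k. hausdorff_weight n (E i k)) \<le> hausdorff_content n \<epsilon> (A i) + ennreal (e * (1/2) ^ Suc i)"
    by metis
  let ?f = "\<lambda>p. hausdorff_weight n (case_prod E p)"
  have "(\<lambda>j. case_prod E (prod_decode j)) \<in> hausdorff_covers \<epsilon> (\<Union>i. A i)"
  proof -
    have "x \<in> (\<Union>j. case_prod E (prod_decode j))" if "x \<in> A i" for x i
    proof -
      obtain k where "x \<in> E i k"
        using E[of i] \<open>x \<in> A i\<close> by (auto simp: hausdorff_covers_def)
      then show ?thesis by (auto intro!: exI[of _ "prod_encode (i, k)"])
    qed
    moreover have "bounded (case_prod E p) \<and> diameter (case_prod E p) \<le> \<epsilon>" for p
      using E[of "fst p"] by (auto simp: hausdorff_covers_def split_beta)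
    ultimately show ?thesis by (auto simp: hausdorff_covers_def)
  qed
  from hausdorff_content_le[OF this, of n]
  have "hausdorff_content n \<epsilon> (\<Union>i. A i) \<le> (\<Sum>j. ?f (prod_decode j))" by simp
  also have "\<dots> = (\<Sum>i. \<Sum>k. hausdorff_weight n (E i k))"
    by (subst suminf_ennreal_2dimen) auto
  also have "\<dots> \<le> (\<Sum>i. hausdorff_content n \<epsilon> (A i) + ennreal (e * (1/2) ^ Suc i))"
    by (intro suminf_le Ele) auto
  also have "\<dots> = (\<Sum>i. hausdorff_content n \<epsilon> (A i)) + (\<Sum>i. ennreal (e * (1/2) ^ Suc i))"
    by (rule suminf_add[symmetric]) auto
  also have "(\<Sum>i. ennreal (e * (1/2) ^ Suc i)) = ennreal e"
  proof -
    have "(\<lambda>i. e * (1/2) ^ Suc i) sums (e * 1)"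
      by (intro sums_mult power_half_series)
    then show ?thesis
      using e by (intro suminf_ennreal_eq) auto
  qed
  finally show "hausdorff_content n \<epsilon> (\<Union>i. A i) \<le> (\<Sum>i. hausdorff_content n \<epsilon> (A i)) + ennreal e" .
qed

text \<open>A set of diameter at most \<open>\<epsilon>\<close> cannot meet both \<open>A\<close>
  and \<open>B\<close>, so a cover of the union splits into a cover of each without using any set
  twice.\<close>

lemma hausdorff_content_separated:
  assumes sep: "\<And>a b. a \<in> A \<Longrightarrow> b \<in> B \<Longrightarrow> \<epsilon> < dist a b"
  shows "hausdorff_content n \<epsilon> A + hausdorff_content n \<epsilon> B \<le> hausdorff_content n \<epsilon> (A \<union> B)"
  unfolding hausdorff_content_eq[of n \<epsilon> "A \<union> B"]
proof (rule INF_greatest)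
  fix E assume E: "E \<in> hausdorff_covers \<epsilon> (A \<union> B)"
  \<comment> \<open>Sets meeting neither \<open>A\<close> nor \<open>B\<close> go to
    \<open>EB\<close>, so the two weight sums add up to exactly the weight of
    \<open>E\<close>.\<close>
  define EA EB where "EA i = (if E i \<inter> A = {} then {} else E i)"
    and "EB i = (if E i \<inter> A = {} then E i else {})" for i
  \<comment> \<open>The padding by \<open>{}\<close> has diameter 0 and is admissible only for
    \<open>0 \<le> \<epsilon>\<close>; the given cover guarantees this.\<close>
  have eps: "0 \<le> \<epsilon>"
    using E diameter_ge_0[of "E 0"] order_trans unfolding hausdorff_covers_def by blast
  have sepE: "E i \<inter> B = {}" if "E i \<inter> A \<noteq> {}" for i
  proof (rule ccontr)
    assume "E i \<inter> B \<noteq> {}"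
    with that obtain a b where ab: "a \<in> A" "b \<in> B" "a \<in> E i" "b \<in> E i" by auto
    have "dist a b \<le> diameter (E i)"
      using E ab by (intro diameter_bounded_bound) (auto simp: hausdorff_covers_def)
    also have "\<dots> \<le> \<epsilon>" using E by (simp add: hausdorff_covers_def)
    finally show False using sep[OF ab(1,2)] by simp
  qed
  have "A \<subseteq> (\<Union>i. EA i)"
    using E by (fastforce simp: hausdorff_covers_def EA_def)
  moreover have "B \<subseteq> (\<Union>i. EB i)"
  proof
    fix x assume "x \<in> B"
    then obtain i where "x \<in> E i" using E by (auto simp: hausdorff_covers_def)
    with \<open>x \<in> B\<close> sepE[of i] show "x \<in> (\<Union>i. EB i)" by (auto simp: EB_def)
  qed
  ultimately have "EA \<in> hausdorff_covers \<epsilon> A" "EB \<in> hausdorff_covers \<epsilon> B"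
    using E eps by (auto simp: hausdorff_covers_def EA_def EB_def)
  then have "hausdorff_content n \<epsilon> A + hausdorff_content n \<epsilon> B
      \<le> (\<Sum>i. hausdorff_weight n (EA i)) + (\<Sum>i. hausdorff_weight n (EB i))"
    by (intro add_mono hausdorff_content_le)
  also have "\<dots> = (\<Sum>i. hausdorff_weight n (EA i) + hausdorff_weight n (EB i))"
    by (rule suminf_add) auto
  also have "(\<lambda>i. hausdorff_weight n (EA i) + hausdorff_weight n (EB i)) = (\<lambda>i. hausdorff_weight n (E i))"
    by (auto simp: EA_def EB_def)
  finally show "hausdorff_content n \<epsilon> A + hausdorff_content n \<epsilon> B \<le> (\<Sum>i. hausdorff_weight n (E i))" .
qed

text \<open>The set function passed to \<open>measure_of\<close> in
  \<open>hausdorff_measure\<close>. It gets its own name because the Caratheodory construction uses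
  it on arbitrary sets.\<close>

definition hausdorff_outer :: "nat \<Rightarrow> 'a::metric_space set \<Rightarrow> ennreal" where
  "hausdorff_outer n A = (SUP \<epsilon>\<in>{0<..}. hausdorff_content n \<epsilon> A)"

lemma hausdorff_content_le_outer: "0 < \<epsilon> \<Longrightarrow> hausdorff_content n \<epsilon> A \<le> hausdorff_outer n A"
  unfolding hausdorff_outer_def by (rule SUP_upper) auto

lemma outer_measure_space_hausdorff: "outer_measure_space UNIV (hausdorff_outer n)"
proof -
  have "hausdorff_outer n (\<Union>i. A i) \<le> (\<Sum>i. hausdorff_outer n (A i))" for A :: "nat \<Rightarrow> 'a set"
    unfolding hausdorff_outer_def[of n "\<Union>i. A i"]
  proof (rule SUP_least)
    fix \<epsilon> :: real assume "\<epsilon> \<in> {0<..}"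
    then have "(\<Sum>i. hausdorff_content n \<epsilon> (A i)) \<le> (\<Sum>i. hausdorff_outer n (A i))"
      by (intro suminf_le hausdorff_content_le_outer) auto
    with hausdorff_content_countably_subadditive
    show "hausdorff_content n \<epsilon> (\<Union>i. A i) \<le> (\<Sum>i. hausdorff_outer n (A i))"
      by (rule order_trans)
  qed
  moreover have "hausdorff_outer n ({}::'a set) = 0"
    by (auto simp: hausdorff_outer_def hausdorff_content_empty intro!: antisym SUP_least)
  moreover have "hausdorff_outer n A \<le> hausdorff_outer n B" if "A \<subseteq> B" for A B :: "'a set"
    unfolding hausdorff_outer_def using that by (intro SUP_mono) (auto intro: hausdorff_content_mono)
  ultimately show ?thesis
    by (auto simp: outer_measure_space_def positive_def increasing_def countably_subadditive_def)
qed

text \<open>Contents grow as the scale shrinks, so any scale may be replaced by one below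
  \<open>\<eta>\<close>, where \<open>hausdorff_content_separated\<close> applies. This is the
  defining property of a metric outer measure.\<close>

lemma hausdorff_outer_separated:
  assumes sep: "\<And>a b. a \<in> A \<Longrightarrow> b \<in> B \<Longrightarrow> \<eta> \<le> dist a b" and "0 < \<eta>"
  shows "hausdorff_outer n A + hausdorff_outer n B \<le> hausdorff_outer n (A \<union> B)"
proof -
  have "hausdorff_outer n A + hausdorff_outer n B
      = (SUP \<epsilon>\<in>{0<..}. hausdorff_content n \<epsilon> A + hausdorff_content n \<epsilon> B)"
    unfolding hausdorff_outer_def
  proof (rule SUP_add_directed_ennreal[symmetric])
    fix i j :: real assume "i \<in> {0<..}" "j \<in> {0<..}"
    then show "\<exists>k\<in>{0<..}. hausdorff_content n i A + hausdorff_content n j B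
        \<le> hausdorff_content n k A + hausdorff_content n k B"
      by (intro bexI[of _ "min i j"] add_mono hausdorff_content_antimono) auto
  qed
  also have "\<dots> \<le> hausdorff_outer n (A \<union> B)"
  proof (rule SUP_least)
    fix \<epsilon> :: real assume "\<epsilon> \<in> {0<..}"
    let ?k = "min \<epsilon> (\<eta> / 2)"
    have k: "0 < ?k" "?k < \<eta>" using \<open>\<epsilon> \<in> _\<close> \<open>0 < \<eta>\<close> by auto
    have "hausdorff_content n \<epsilon> A + hausdorff_content n \<epsilon> B
        \<le> hausdorff_content n ?k A + hausdorff_content n ?k B"
      by (intro add_mono hausdorff_content_antimono) auto
    also have "\<dots> \<le> hausdorff_content n ?k (A \<union> B)"
    proof (rule hausdorff_content_separated)
      fix a b assume "a \<in> A" "b \<in> B"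
      with sep[of a b] k(2) show "?k < dist a b" by linarith
    qed
    also have "\<dots> \<le> hausdorff_outer n (A \<union> B)"
      using k(1) by (rule hausdorff_content_le_outer)
    finally show "hausdorff_content n \<epsilon> A + hausdorff_content n \<epsilon> B \<le> hausdorff_outer n (A \<union> B)" .
  qed
  finally show ?thesis .
qed

text \<open>Caratheodory's criterion: the rings on which the distance to \<open>C\<close> lies between consecutive
  values of \<open>1 / (k + 1)\<close> have summable measure, since rings of equal parity are separated.\<close>

lemma metric_outer_measure_closed_in_lambda_system:
  fixes f :: "'a::metric_space set \<Rightarrow> ennreal"
  assumes f: "outer_measure_space UNIV f"
    and sep: "\<And>A B \<eta>. 0 < \<eta> \<Longrightarrow> (\<And>a b. a \<in> A \<Longrightarrow> b \<in> B \<Longrightarrow> \<eta> \<le> dist a b) \<Longrightarrow> f A + f B \<le> f (A \<union> B)"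
    and C: "closed C"
  shows "C \<in> lambda_system UNIV UNIV f"
proof -
  have f0: "f {} = 0" and mono: "A \<subseteq> B \<Longrightarrow> f A \<le> f B"
    and csub0: "\<And>A. disjoint_family A \<Longrightarrow> f (\<Union>i. A i) \<le> (\<Sum>i. f (A i))" for A B
    using f by (auto simp: outer_measure_space_def positive_def increasing_def countably_subadditive_def)
  have csub: "f (\<Union>i. A i) \<le> (\<Sum>i. f (A i))" for A :: "nat \<Rightarrow> 'a set"
  proof -
    have "f (\<Union>i. A i) = f (\<Union>i. disjointed A i)" by (simp add: UN_disjointed_eq)
    also have "\<dots> \<le> (\<Sum>i. f (disjointed A i))" by (rule csub0[OF disjoint_family_disjointed])
    also have "\<dots> \<le> (\<Sum>i. f (A i))" by (intro suminf_le mono disjointed_subset) auto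
    finally show ?thesis .
  qed
  have sub: "f (A \<union> B) \<le> f A + f B" for A B
  proof -
    have "f (A \<union> B) = f (\<Union>i. binaryset A B i)" by (simp add: UN_binaryset_eq)
    also have "\<dots> \<le> (\<Sum>i. f (binaryset A B i))" by (rule csub)
    also have "\<dots> = f A + f B" using binaryset_sums[of f, OF f0, of A B] by (simp add: sums_iff)
    finally show ?thesis .
  qed
  have key: "f (A \<inter> C) + f (A - C) \<le> f A" for A
  \<comment> \<open>The empty set is split off because \<open>infdist x {} = 0\<close> would spoil
    the rings; finiteness of \<open>f A\<close> permits the cancellation at the end.\<close>
  proof (cases "C = {} \<or> f A = top")
    case True
    then show ?thesis using f0 by (cases "C = {}") auto
  next
    case False
    then have ne: "C \<noteq> {}" and fin: "f A \<noteq> top" by auto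
    define a :: "nat \<Rightarrow> real" where "a k = 1 / real (Suc k)" for k
    have a_dec: "a (Suc k) < a k" for k by (simp add: a_def field_simps)
    have a_anti: "a l \<le> a k" if "k \<le> l" for k l using that by (simp add: a_def field_simps)
    define D where "D k = {x \<in> A. a k < infdist x C}" for k
    define R where "R k = {x \<in> A. a (Suc k) < infdist x C \<and> infdist x C \<le> a k}" for k
    have inf_le: "infdist x C \<le> dist x y + infdist y C" for x y
      by (metis infdist_triangle add.commute)
    have DR: "A - C \<subseteq> D k \<union> (\<Union>i. R (i + k))" for k
    proof
      fix x assume x: "x \<in> A - C"
      then have "0 < infdist x C"
        using C ne in_closed_iff_infdist_zero[of C x] infdist_nonneg[of x C] by fastforce
      then obtain m where m: "a m < infdist x C"
        using nat_approx_posE unfolding a_def by blast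
      show "x \<in> D k \<union> (\<Union>i. R (i + k))"
      proof (cases "a k < infdist x C")
        case True then show ?thesis using x by (auto simp: D_def)
      next
        case False
        define l where "l = (LEAST m. a m < infdist x C)"
        have l: "a l < infdist x C" unfolding l_def by (rule LeastI[of _ m]) (rule m)
        have "k < l" using False l a_anti[of l k] by linarith
        then obtain i where i: "l = Suc (i + k)" by (metis add.commute less_iff_Suc_add)
        have "\<not> a (i + k) < infdist x C"
          using not_less_Least[of "i + k" "\<lambda>m. a m < infdist x C"] i unfolding l_def[symmetric] by simp
        then have "x \<in> R (i + k)" using x l i by (auto simp: R_def)
        then show ?thesis by blast
      qed
    qed
    have parity: "(\<Sum>i<m. f (R (2 * i + p))) \<le> f (A \<inter> (\<Union>i<m. R (2 * i + p)))" for m p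
    proof (induction m)
      case 0 then show ?case by simp
    next
      case (Suc m)
      have "f (A \<inter> (\<Union>i<m. R (2 * i + p))) + f (R (2 * m + p))
          \<le> f (A \<inter> (\<Union>i<m. R (2 * i + p)) \<union> R (2 * m + p))"
      \<comment> \<open>The gap is the width of the skipped ring \<open>R (2 * m + p - 1)\<close>.
        For \<open>m = 0\<close> the union is empty and 1 is a dummy value.\<close>
      proof (rule sep[of "if m > 0 then a (2 * m + p - 1) - a (2 * m + p) else 1"])
        show "0 < (if m > 0 then a (2 * m + p - 1) - a (2 * m + p) else 1)"
          using a_dec[of "2 * m + p - 1"] by (cases m) auto
        fix x y assume "x \<in> A \<inter> (\<Union>i<m. R (2 * i + p))" "y \<in> R (2 * m + p)"
        then obtain i where i: "i < m" "x \<in> R (2 * i + p)" by auto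
        have "a (2 * m + p - 1) \<le> a (Suc (2 * i + p))" using i by (intro a_anti) auto
        with i have "a (2 * m + p - 1) < infdist x C" by (auto simp: R_def)
        moreover have "infdist y C \<le> a (2 * m + p)" using \<open>y \<in> _\<close> by (auto simp: R_def)
        ultimately have "a (2 * m + p - 1) - a (2 * m + p) \<le> dist x y"
          using inf_le[of x y] by linarith
        then show "(if m > 0 then a (2 * m + p - 1) - a (2 * m + p) else 1) \<le> dist x y"
          using i by auto
      qed
      moreover have "A \<inter> (\<Union>i<m. R (2 * i + p)) \<union> R (2 * m + p) = A \<inter> (\<Union>i<Suc m. R (2 * i + p))"
        by (auto simp: R_def lessThan_Suc)
      ultimately show ?case
        using Suc.IH by (auto intro: order_trans[OF add_right_mono])
    qed
    have parity': "(\<Sum>i. f (R (2 * i + p))) \<le> f A" for p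
      by (intro suminf_le_const) (auto intro!: order_trans[OF parity] mono)
    have "(\<Sum>k. f (R k)) \<le> f A + f A"
    proof (intro suminf_le_const)
      fix N
      have "(\<Sum>k<N. f (R k)) \<le> (\<Sum>k<2*N. f (R k))" by (intro sum_mono2) auto
      also have "\<dots> = (\<Sum>i<N. f (R (2 * i + 0))) + (\<Sum>i<N. f (R (2 * i + 1)))"
        by (induction N) (auto simp: algebra_simps)
      also have "\<dots> \<le> f A + f A"
        by (intro add_mono order_trans[OF sum_le_suminf parity']) auto
      finally show "(\<Sum>k<N. f (R k)) \<le> f A + f A" .
    qed auto
    then have Rfin: "(\<Sum>k. f (R k)) \<noteq> top"
      using fin by (auto simp: top_unique)
    \<comment> \<open>The first \<open>k\<close> ring terms are added on both sides, which completes
      the tail to the full sum. That finite sum is cancelled in \<open>AC\<close>, so nothing has to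
      be subtracted in \<open>ennreal\<close>.\<close>
    have "f (A - C) + (\<Sum>i<k. f (R i)) \<le> (SUP k. f (D k)) + (\<Sum>k. f (R k))" for k
    proof -
      have "f (A - C) \<le> f (D k) + (\<Sum>i. f (R (i + k)))"
        by (rule order_trans[OF mono[OF DR] order_trans[OF sub add_left_mono[OF csub]]])
      then have "f (A - C) + (\<Sum>i<k. f (R i)) \<le> f (D k) + ((\<Sum>i. f (R (i + k))) + (\<Sum>i<k. f (R i)))"
        by (metis add.assoc add_right_mono)
      also have "(\<Sum>i. f (R (i + k))) + (\<Sum>i<k. f (R i)) = (\<Sum>i. f (R i))"
        by (rule suminf_offset[symmetric]) auto
      also have "f (D k) + (\<Sum>i. f (R i)) \<le> (SUP k. f (D k)) + (\<Sum>k. f (R k))"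
        by (intro add_right_mono SUP_upper) auto
      finally show ?thesis .
    qed
    then have "(\<Sum>i<k. f (R i)) + f (A - C) \<le> (SUP k. f (D k)) + (\<Sum>k. f (R k))" for k
      by (simp add: add.commute)
    then have "(\<Sum>k. f (R k)) + f (A - C) \<le> (SUP k. f (D k)) + (\<Sum>k. f (R k))"
      by (rule ennreal_suminf_bound_add)
    then have AC: "f (A - C) \<le> (SUP k. f (D k))"
      using Rfin ennreal_add_left_cancel_le[of "\<Sum>k. f (R k)" "f (A - C)" "SUP k. f (D k)"]
      by (simp add: add.commute)
    have "f (A \<inter> C) + (SUP k. f (D k)) = (SUP k. f (A \<inter> C) + f (D k))"
      by (simp add: ennreal_SUP_add_right)
    also have "\<dots> \<le> f A"
    proof (rule SUP_least)
      fix k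
      have "f (A \<inter> C) + f (D k) \<le> f (A \<inter> C \<union> D k)"
      proof (rule sep[of "a k"])
        fix x y assume "x \<in> A \<inter> C" "y \<in> D k"
        then show "a k \<le> dist x y"
          using inf_le[of y x] by (auto simp: D_def dist_commute)
      qed (simp add: a_def)
      also have "\<dots> \<le> f A" by (rule mono) (auto simp: D_def)
      finally show "f (A \<inter> C) + f (D k) \<le> f A" .
    qed
    finally show ?thesis using AC by (meson add_left_mono order_trans)
  qed
  have "f (A \<inter> C) + f (A - C) = f A" for A
    using key[of A] sub[of "A \<inter> C" "A - C"] by (simp add: Int_Diff_Un antisym)
  then show ?thesis
    by (auto simp: lambda_system_def Int_commute Diff_eq)
qed

section \<open>The Hausdorff measure on Borel sets\<close>

lemma sets_hausdorff_measure [simp, measurable_cong]: "sets (hausdorff_measure n) = sets borel"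
  and space_hausdorff_measure [simp]: "space (hausdorff_measure n) = UNIV"
  unfolding hausdorff_measure_def
  by (simp_all add: sets_measure_of_conv space_measure_of_conv
      sets.sigma_sets_eq[of borel, simplified])

text \<open>Closed sets are Caratheodory measurable, hence so are all Borel sets, and there the
  outer measure is countably additive. Under this condition \<open>measure_of\<close> keeps the
  values it is given.\<close>

lemma emeasure_hausdorff_measure:
  fixes A :: "'a::metric_space set"
  assumes "A \<in> sets borel"
  shows "emeasure (hausdorff_measure n) A = hausdorff_outer n A"
proof -
  interpret sigma_algebra "UNIV :: 'a set" "UNIV :: 'a set set"
    using sigma_algebra_Pow[of "UNIV :: 'a set"] by simp
  let ?L = "lambda_system UNIV UNIV (hausdorff_outer n :: 'a set \<Rightarrow> ennreal)"
  have ms: "measure_space UNIV ?L (hausdorff_outer n)"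
    by (rule caratheodory_lemma[OF outer_measure_space_hausdorff])
  then interpret L: sigma_algebra UNIV ?L by (simp add: measure_space_def)
  have "{C. closed C} \<subseteq> ?L"
    by (auto intro!: metric_outer_measure_closed_in_lambda_system outer_measure_space_hausdorff
        hausdorff_outer_separated)
  then have "sigma_sets UNIV {C. closed C} \<subseteq> ?L" by (rule L.sigma_sets_subset)
  then have borel: "sets borel \<subseteq> ?L" by (simp add: borel_eq_closed sets_measure_of)
  have "positive (sets borel) (hausdorff_outer n :: 'a set \<Rightarrow> ennreal)"
    using ms by (simp add: measure_space_def positive_def)
  moreover have "countably_additive (sets borel) (hausdorff_outer n :: 'a set \<Rightarrow> ennreal)"
    unfolding countably_additive_def
  proof (intro allI impI)
    fix B :: "nat \<Rightarrow> 'a set" assume "range B \<subseteq> sets borel" "disjoint_family B"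
    then show "(\<Sum>i. hausdorff_outer n (B i)) = hausdorff_outer n (\<Union>i. B i)"
      using lambda_system_caratheodory[OF outer_measure_space_hausdorff, of B n] borel by blast
  qed
  moreover have "sigma_algebra (UNIV :: 'a set) (sets borel)"
    using sets.sigma_algebra_axioms[of "borel :: 'a measure"] by simp
  ultimately show ?thesis
    using assms unfolding hausdorff_measure_def hausdorff_outer_def[abs_def]
    by (intro emeasure_measure_of_sigma) auto
qed

section \<open>Boundary estimates for partial derivatives\<close>

definition sweep :: "real \<Rightarrow> 'a::real_normed_vector \<Rightarrow> 'a set \<Rightarrow> 'a set" where
  "sweep h b A = {x. \<exists>s\<in>{0..h}. x - s *\<^sub>R b \<in> A}"

lemma compact_sweep:
  assumes "compact A" shows "compact (sweep h b A)"
proof -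
  have "sweep h b A = (\<lambda>(s, y). y + s *\<^sub>R b) ` ({0..h} \<times> A)"
    by (force simp: sweep_def image_iff)
  moreover have "continuous_on ({0..h} \<times> A) (\<lambda>(s, y). y + s *\<^sub>R b)"
    by (auto simp: split_beta intro!: continuous_intros)
  ultimately show ?thesis
    using assms by (auto intro!: compact_continuous_image compact_Times)
qed

text \<open>With \<open>n = DIM('a) - 1\<close>, a set of diameter \<open>D \<le> h\<close> swept
  along \<open>b\<close> fits into a box of volume \<open>3 * h * (2 * D) ^ n\<close>. As
  \<open>(2 * D) ^ n = 4 ^ n * (D / 2) ^ n\<close>, the constant is the ratio of this volume to
  \<open>h\<close> times the Hausdorff weight.\<close>

definition sweep_const :: "'a::euclidean_space itself \<Rightarrow> real" where
  "sweep_const _ = 3 * 4 ^ (DIM('a) - 1) / unit_ball_vol (real (DIM('a) - 1))"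

lemma sweep_const_pos: "0 < sweep_const TYPE('a::euclidean_space)"
  unfolding sweep_const_def by (intro divide_pos_pos mult_pos_pos unit_ball_vol_pos) auto

lemma sweep_const_nonneg: "0 \<le> sweep_const TYPE('a::euclidean_space)"
  using sweep_const_pos[where 'a='a] by simp

lemma emeasure_sweep_small:
  fixes E :: "'a::euclidean_space set"
  assumes b: "b \<in> Basis" and h: "0 < h" and E: "bounded E" "diameter E \<le> h"
  obtains Q where "Q \<in> sets lborel" "sweep h b E \<subseteq> Q"
    "emeasure lborel Q \<le> ennreal (sweep_const TYPE('a) * h) * hausdorff_weight (DIM('a) - 1) E"
proof (cases "E = {}")
  case True
  then show ?thesis by (intro that[of "{}"]) (auto simp: sweep_def)
next
  case False
  then obtain a where a: "a \<in> E" by auto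
  define D where "D = diameter E"
  have D: "0 \<le> D" unfolding D_def using E by (intro diameter_ge_0)
  \<comment> \<open>Along \<open>b\<close> the box reaches back by \<open>h\<close> and forward by
    \<open>2 * h\<close>: points of \<open>E\<close> are within \<open>D \<le> h\<close> of
    \<open>a\<close>, and the sweep adds at most another \<open>h\<close>.\<close>
  define l u where "l = (\<Sum>i\<in>Basis. (a \<bullet> i - (if i = b then h else D)) *\<^sub>R i)"
    and "u = (\<Sum>i\<in>Basis. (a \<bullet> i + (if i = b then 2 * h else D)) *\<^sub>R i)"
  have sub: "sweep h b E \<subseteq> cbox l u"
  proof
    fix x assume "x \<in> sweep h b E"
    then obtain s where s: "0 \<le> s" "s \<le> h" "x - s *\<^sub>R b \<in> E" by (auto simp: sweep_def)
    have "norm (x - s *\<^sub>R b - a) \<le> D"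
      using diameter_bounded_bound[OF E(1) s(3) a] by (simp add: D_def dist_norm)
    then have *: "\<bar>(x - s *\<^sub>R b - a) \<bullet> i\<bar> \<le> D" if "i \<in> Basis" for i
      using Basis_le_norm[OF that, of "x - s *\<^sub>R b - a"] by linarith
    have "l \<bullet> i \<le> x \<bullet> i \<and> x \<bullet> i \<le> u \<bullet> i" if i: "i \<in> Basis" for i
    proof (cases "i = b")
      case True
      with *[OF i] s E(2) i show ?thesis
        by (auto simp: l_def u_def inner_diff_left abs_le_iff D_def)
    next
      case False
      then have "b \<bullet> i = 0" using b i by (simp add: inner_Basis)
      with False *[OF i] i show ?thesis
        by (auto simp: l_def u_def inner_diff_left abs_le_iff)
    qed
    then show "x \<in> cbox l u" by (auto simp: mem_box)
  qed
  have "emeasure lborel (cbox l u) = ennreal (\<Prod>i\<in>Basis. (u - l) \<bullet> i)"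
    using D h by (subst emeasure_lborel_cbox_eq) (auto simp: l_def u_def)
  also have "(\<Prod>i\<in>Basis. (u - l) \<bullet> i) = (\<Prod>i\<in>Basis. if i = b then 3 * h else 2 * D)"
    by (intro prod.cong) (auto simp: l_def u_def inner_diff_left)
  also have "\<dots> = 3 * h * (\<Prod>i\<in>Basis - {b}. if i = b then 3 * h else 2 * D)"
    by (subst prod.remove[OF _ b]) auto
  also have "(\<Prod>i\<in>Basis - {b}. if i = b then 3 * h else 2 * D) = (\<Prod>i\<in>Basis - {b}. 2 * D)"
    by (intro prod.cong) auto
  also have "\<dots> = (2 * D) ^ (DIM('a) - 1)"
    using b by simp
  also have "3 * h * (2 * D) ^ (DIM('a) - 1)
      = (sweep_const TYPE('a) * h) * (unit_ball_vol (real (DIM('a) - 1)) * (D / 2) ^ (DIM('a) - 1))"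
  proof -
    have "unit_ball_vol (real (DIM('a) - 1)) \<noteq> 0"
      using unit_ball_vol_pos[of "real (DIM('a) - 1)"] by linarith
    moreover have "(2 * D) ^ (DIM('a) - 1) = 4 ^ (DIM('a) - 1) * (D / 2) ^ (DIM('a) - 1)"
      by (subst power_mult_distrib[symmetric]) simp
    ultimately show ?thesis by (simp add: sweep_const_def)
  qed
  also have "ennreal \<dots> = ennreal (sweep_const TYPE('a) * h) * hausdorff_weight (DIM('a) - 1) E"
    using False h D by (subst ennreal_mult) (auto simp: hausdorff_weight_def D_def sweep_const_nonneg)
  finally show ?thesis using sub by (intro that[of "cbox l u"]) auto
qed

text \<open>The mesh of the covers is tied to the sweep length, as
  \<open>emeasure_sweep_small\<close> requires. The content at scale \<open>h\<close> is at most the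
  full measure, so the constant is uniform in \<open>h\<close>.\<close>

lemma emeasure_sweep_le:
  fixes A :: "'a::euclidean_space set"
  assumes b: "b \<in> Basis" and h: "0 < h" and A: "compact A"
  shows "emeasure lborel (sweep h b A)
    \<le> ennreal (sweep_const TYPE('a) * h) * emeasure (hausdorff_measure (DIM('a) - 1)) A"
proof -
  let ?n = "DIM('a) - 1" and ?c = "ennreal (sweep_const TYPE('a) * h)"
  have "emeasure lborel (sweep h b A) \<le> ?c * (\<Sum>i. hausdorff_weight ?n (E i))"
    if E: "E \<in> hausdorff_covers h A" for E
  proof -
    have "\<exists>Q. Q \<in> sets lborel \<and> sweep h b (E i) \<subseteq> Q \<and> emeasure lborel Q \<le> ?c * hausdorff_weight ?n (E i)" for i
    proof -
      have "bounded (E i)" "diameter (E i) \<le> h" using E by (auto simp: hausdorff_covers_def)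
      from emeasure_sweep_small[OF b h this] show ?thesis by metis
    qed
    then obtain Q where Q: "\<And>i. Q i \<in> sets lborel" "\<And>i. sweep h b (E i) \<subseteq> Q i"
      "\<And>i. emeasure lborel (Q i) \<le> ?c * hausdorff_weight ?n (E i)" by metis
    have "sweep h b A \<subseteq> (\<Union>i. Q i)"
      using E Q(2) by (fastforce simp: hausdorff_covers_def sweep_def)
    then have "emeasure lborel (sweep h b A) \<le> emeasure lborel (\<Union>i. Q i)"
      using Q(1) by (intro emeasure_mono) auto
    also have "\<dots> \<le> (\<Sum>i. emeasure lborel (Q i))"
      using Q(1) by (intro emeasure_subadditive_countably) auto
    also have "\<dots> \<le> (\<Sum>i. ?c * hausdorff_weight ?n (E i))"
      using Q(3) by (intro suminf_le) auto
    finally show ?thesis by (simp add: ennreal_suminf_cmult)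
  qed
  then have "emeasure lborel (sweep h b A) / ?c \<le> hausdorff_content ?n h A"
    unfolding hausdorff_content_eq
    using sweep_const_pos[where 'a='a] h
    by (intro INF_greatest divide_le_posI_ennreal) (auto simp: mult.commute)
  then have "?c * (emeasure lborel (sweep h b A) / ?c) \<le> ?c * hausdorff_content ?n h A"
    by (intro mult_left_mono) auto
  then have "emeasure lborel (sweep h b A) \<le> ?c * hausdorff_content ?n h A"
    using sweep_const_pos[where 'a='a] h by (simp add: ennreal_times_divide mult_divide_eq_ennreal mult.commute[of ?c])
  also have "\<dots> \<le> ?c * emeasure (hausdorff_measure ?n) A"
    using A h by (intro mult_left_mono)
      (auto simp: emeasure_hausdorff_measure borel_compact hausdorff_content_le_outer)
  finally show ?thesis .
qed

text \<open>The loss of \<open>\<epsilon>\<close> absorbs both the oscillation of \<open>F\<close> along the sweep and the rounding of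
  \<open>F\<close> to multiples of \<open>\<epsilon> / 2\<close>, so that no finiteness of the Hausdorff measure of \<open>K\<close> is needed.\<close>

lemma nn_integral_sweep_le:
  fixes F :: "'a::euclidean_space \<Rightarrow> real"
  assumes b: "b \<in> Basis" and F: "continuous_on UNIV F" and K: "compact K" and \<epsilon>: "0 < \<epsilon>"
  obtains h0 where "0 < h0" "\<And>h. 0 < h \<Longrightarrow> h < h0 \<Longrightarrow>
    (\<integral>\<^sup>+x\<in>sweep h b K. ennreal (F x - \<epsilon>) \<partial>lborel)
      \<le> ennreal (sweep_const TYPE('a) * h) * (\<integral>\<^sup>+x\<in>K. ennreal (F x) \<partial>hausdorff_measure (DIM('a) - 1))"
proof -
  let ?H = "hausdorff_measure (DIM('a) - 1) :: 'a measure"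
  define e where "e = \<epsilon> / 2"
  have e: "0 < e" using \<epsilon> by (simp add: e_def)
  \<comment> \<open>The compact set \<open>sweep 1 b K\<close> contains the sweeps of all lengths
    below 1, so \<open>d\<close> does not depend on \<open>h\<close>.\<close>
  have "uniformly_continuous_on (sweep 1 b K) F"
    by (intro compact_uniformly_continuous compact_sweep K continuous_on_subset[OF F]) auto
  then obtain d where d: "0 < d" "\<And>x y. x \<in> sweep 1 b K \<Longrightarrow> y \<in> sweep 1 b K \<Longrightarrow> dist y x < d \<Longrightarrow> dist (F y) (F x) < e"
    using e unfolding uniformly_continuous_on_def by metis
  obtain M where M: "\<And>x. x \<in> K \<Longrightarrow> F x \<le> M"
    using compact_imp_bounded[OF compact_continuous_image[OF continuous_on_subset[OF F] K]]
    by (auto simp: bounded_iff abs_le_iff)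
  obtain N :: nat where N: "M < real N * e"
    using reals_Archimedean3[OF e] by auto
  \<comment> \<open>Layer-cake decomposition with step \<open>e\<close>: on \<open>K\<close> the sum
    of \<open>e * indicator (B k)\<close> over \<open>k \<in> {1..N}\<close> lies between
    \<open>F - e\<close> and the positive part of \<open>F\<close>, since \<open>N * e\<close>
    exceeds the maximum. Each layer is compact, so \<open>emeasure_sweep_le\<close> applies to
    it.\<close>
  define B where "B k = K \<inter> {y. real k * e \<le> F y}" for k
  have Bc: "compact (B k)" for k
    unfolding B_def by (intro compact_Int_closed K closed_Collect_le F continuous_intros)
  have upper: "(\<Sum>k\<in>{1..N}. ennreal e * indicator (B k) y) \<le> ennreal (F y) * indicator K y" for y
  proof (cases "y \<in> K \<and> e \<le> F y")
    case False
    have "y \<notin> B k" if "k \<in> {1..N}" for k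
    proof
      assume "y \<in> B k"
      moreover have "1 * e \<le> real k * e" using that e by (intro mult_right_mono) auto
      ultimately show False using False by (auto simp: B_def)
    qed
    then show ?thesis by simp
  next
    case True
    define m where "m = nat \<lfloor>F y / e\<rfloor>"
    have m: "real m * e \<le> F y"
      using True e by (simp add: m_def pos_le_divide_eq[symmetric])
    have mk: "k \<le> m" if "y \<in> B k" for k
    proof -
      have "real k \<le> F y / e" using that e by (simp add: B_def pos_le_divide_eq)
      then show ?thesis unfolding m_def by (simp add: le_nat_iff le_floor_iff)
    qed
    have "(\<Sum>k\<in>{1..N}. ennreal e * indicator (B k) y) \<le> (\<Sum>k\<in>{1..N}. if k \<le> m then ennreal e else 0)"
      by (intro sum_mono) (auto split: split_indicator dest: mk)
    also have "\<dots> = (\<Sum>k\<in>{k\<in>{1..N}. k \<le> m}. ennreal e)"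
      by (rule sum.inter_filter[symmetric]) auto
    also have "\<dots> \<le> (\<Sum>k\<in>{1..m}. ennreal e)"
      by (intro sum_mono2) auto
    also have "\<dots> = ennreal (real m * e)"
      using e by (simp add: ennreal_mult'' ennreal_of_nat_eq_real_of_nat)
    also have "\<dots> \<le> ennreal (F y)" using m by (rule ennreal_leI)
    finally show ?thesis using True by simp
  qed
  have lower: "ennreal (F x - \<epsilon>) * indicator (sweep h b K) x
      \<le> (\<Sum>k\<in>{1..N}. ennreal e * indicator (sweep h b (B k)) x)" if h: "0 < h" "h < min 1 d" for h x
  proof (cases "x \<in> sweep h b K \<and> \<epsilon> < F x")
    case False
    then show ?thesis by (auto simp: ennreal_neg split: split_indicator)
  next
    case True
    then obtain s where s: "0 \<le> s" "s \<le> h" "x - s *\<^sub>R b \<in> K" by (auto simp: sweep_def)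
    let ?y = "x - s *\<^sub>R b"
    have "?y \<in> sweep 1 b K" "x \<in> sweep 1 b K"
      using s h by (auto simp: sweep_def intro: bexI[of _ 0] bexI[of _ s])
    moreover have "dist ?y x < d" using s h b by (simp add: dist_norm)
    ultimately have "dist (F ?y) (F x) < e" using d(2)[of x ?y] by simp
    then have "\<bar>F ?y - F x\<bar> < e" by (simp add: dist_real_def)
    then have Fxy: "F x - \<epsilon> \<le> F ?y - e" "e < F ?y"
      using True unfolding e_def by linarith+
    define m where "m = nat \<lfloor>F ?y / e\<rfloor>"
    have "F ?y / e \<le> real m + 1"
      unfolding m_def using Fxy e by linarith
    then have m: "F ?y - e \<le> real m * e" using e by (simp add: field_simps)
    have m': "real m * e \<le> F ?y"
      using Fxy e by (simp add: m_def pos_le_divide_eq[symmetric])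
    have "real m * e < real N * e" using m' M[OF s(3)] N by linarith
    then have "m \<le> N" using e by simp
    have memb: "x \<in> sweep h b (B k)" if "k \<in> {1..m}" for k
    proof -
      have "real k * e \<le> real m * e" using that e by simp
      then have "?y \<in> B k" using s m' by (auto simp: B_def)
      then show ?thesis using s by (auto simp: sweep_def)
    qed
    have "ennreal (F x - \<epsilon>) \<le> ennreal (real m * e)"
      using Fxy m by (intro ennreal_leI) linarith
    also have "\<dots> = (\<Sum>k\<in>{1..m}. ennreal e * indicator (sweep h b (B k)) x)"
      using e memb by (simp add: ennreal_mult'' ennreal_of_nat_eq_real_of_nat)
    also have "\<dots> \<le> (\<Sum>k\<in>{1..N}. ennreal e * indicator (sweep h b (B k)) x)"
      using \<open>m \<le> N\<close> by (intro sum_mono2) auto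
    finally show ?thesis using True by simp
  qed
  have "(\<integral>\<^sup>+x\<in>sweep h b K. ennreal (F x - \<epsilon>) \<partial>lborel)
      \<le> ennreal (sweep_const TYPE('a) * h) * (\<integral>\<^sup>+x\<in>K. ennreal (F x) \<partial>?H)"
    if h: "0 < h" "h < min 1 d" for h
  proof -
    have [measurable]: "sweep h b (B k) \<in> sets borel" for k
      by (intro borel_compact compact_sweep Bc)
    have [measurable]: "B k \<in> sets borel" for k by (intro borel_compact Bc)
    have "(\<integral>\<^sup>+x\<in>sweep h b K. ennreal (F x - \<epsilon>) \<partial>lborel)
        \<le> (\<integral>\<^sup>+x. (\<Sum>k\<in>{1..N}. ennreal e * indicator (sweep h b (B k)) x) \<partial>lborel)"
      by (intro nn_integral_mono lower h)
    also have "\<dots> = (\<Sum>k\<in>{1..N}. ennreal e * emeasure lborel (sweep h b (B k)))"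
      by (subst nn_integral_sum) (auto simp: nn_integral_cmult_indicator)
    also have "\<dots> \<le> (\<Sum>k\<in>{1..N}. ennreal e * (ennreal (sweep_const TYPE('a) * h) * emeasure ?H (B k)))"
      by (intro sum_mono mult_left_mono emeasure_sweep_le b h Bc) auto
    also have "\<dots> = ennreal (sweep_const TYPE('a) * h) * (\<Sum>k\<in>{1..N}. ennreal e * emeasure ?H (B k))"
      by (simp add: sum_distrib_left mult_ac)
    also have "\<dots> \<le> ennreal (sweep_const TYPE('a) * h) * (\<integral>\<^sup>+x\<in>K. ennreal (F x) \<partial>?H)"
    proof (rule mult_left_mono)
      have "(\<Sum>k\<in>{1..N}. ennreal e * emeasure ?H (B k)) = (\<integral>\<^sup>+y. (\<Sum>k\<in>{1..N}. ennreal e * indicator (B k) y) \<partial>?H)"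
        by (subst nn_integral_sum) (auto simp: nn_integral_cmult_indicator)
      also have "\<dots> \<le> (\<integral>\<^sup>+x\<in>K. ennreal (F x) \<partial>?H)"
        by (intro nn_integral_mono upper)
      finally show "(\<Sum>k\<in>{1..N}. ennreal e * emeasure ?H (B k)) \<le> (\<integral>\<^sup>+x\<in>K. ennreal (F x) \<partial>?H)" .
    qed simp
    finally show ?thesis .
  qed
  then show ?thesis using d(1) by (intro that[of "min 1 d"]) auto
qed

text \<open>A C^1 replacement for the positive part of \<open>s - \<epsilon>\<close>, which has a
  corner. It stays below that positive part and so fits the left side of
  \<open>nn_integral_sweep_le\<close>; its derivative lies in [0, 1] and, for each
  \<open>s > 0\<close>, tends to 1 as \<open>\<epsilon>\<close> tends to 0.\<close>

definition truncation :: "real \<Rightarrow> real \<Rightarrow> real" where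
  "truncation \<epsilon> s = (if s \<le> \<epsilon> then 0 else (s - \<epsilon>)\<^sup>2 / s)"

definition truncation' :: "real \<Rightarrow> real \<Rightarrow> real" where
  "truncation' \<epsilon> s = (if s \<le> \<epsilon> then 0 else 1 - (\<epsilon> / s)\<^sup>2)"

lemma truncation_deriv:
  assumes "0 < \<epsilon>" shows "(truncation \<epsilon> has_real_derivative truncation' \<epsilon> s) (at s)"
proof -
  consider "s < \<epsilon>" | "s = \<epsilon>" | "\<epsilon> < s" by linarith
  then show ?thesis
  proof cases
    case 1
    have "((\<lambda>_. 0) has_real_derivative truncation' \<epsilon> s) (at s)"
      using 1 by (simp add: truncation'_def)
    then show ?thesis
      by (rule has_field_derivative_transform_within_open[where S="{..<\<epsilon>}"])
        (use 1 in \<open>auto simp: truncation_def\<close>)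
  next
    case 3
    have "((\<lambda>s. (s - \<epsilon>)\<^sup>2 / s) has_real_derivative truncation' \<epsilon> s) (at s)"
      using 3 assms
      by (auto intro!: derivative_eq_intros simp: truncation'_def field_simps power2_eq_square)
    then show ?thesis
      by (rule has_field_derivative_transform_within_open[where S="{\<epsilon><..}"])
        (use 3 in \<open>auto simp: truncation_def\<close>)
  next
    case 2
    have bound: "\<bar>truncation \<epsilon> (\<epsilon> + h) / h\<bar> \<le> \<bar>h\<bar> / \<epsilon>" for h
    proof (cases "h \<le> 0")
      case True
      then show ?thesis using assms by (simp add: truncation_def divide_nonpos_pos)
    next
      case False
      then have "truncation \<epsilon> (\<epsilon> + h) / h = h / (\<epsilon> + h)"
        using assms by (simp add: truncation_def power2_eq_square)
      also have "\<dots> \<le> h / \<epsilon>" using assms False by (intro divide_left_mono) auto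
      finally show ?thesis using False assms by (simp add: truncation_def)
    qed
    have lim: "((\<lambda>h::real. \<bar>h\<bar> / \<epsilon>) \<longlongrightarrow> 0) (at 0)"
      using tendsto_divide[OF tendsto_rabs[OF tendsto_ident_at[of "0::real" UNIV]] tendsto_const[of \<epsilon>]] assms by simp
    have "((\<lambda>h. truncation \<epsilon> (\<epsilon> + h) / h) \<longlongrightarrow> 0) (at 0)"
      by (rule Lim_null_comparison[OF _ lim]) (simp only: real_norm_def bound eventually_True)
    then show ?thesis
      using 2 by (simp add: DERIV_def truncation_def truncation'_def)
  qed
qed

lemma truncation'_bounds: "0 < \<epsilon> \<Longrightarrow> \<bar>truncation' \<epsilon> s\<bar> \<le> 1"
proof -
  assume e: "0 < \<epsilon>"
  show ?thesis
  proof (cases "s \<le> \<epsilon>")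
    case True then show ?thesis by (simp add: truncation'_def)
  next
    case False
    then have "(\<epsilon> / s)\<^sup>2 \<le> 1" using e by (intro power_le_one) auto
    then show ?thesis using False by (simp add: truncation'_def)
  qed
qed

lemma truncation_nonneg: "0 < \<epsilon> \<Longrightarrow> 0 \<le> truncation \<epsilon> s"
  by (simp add: truncation_def)

lemma truncation_le: "0 < \<epsilon> \<Longrightarrow> ennreal (truncation \<epsilon> s) \<le> ennreal (s - \<epsilon>)"
proof -
  assume e: "0 < \<epsilon>"
  show ?thesis
  proof (cases "s \<le> \<epsilon>")
    case True then show ?thesis by (simp add: truncation_def)
  next
    case False
    then have "(s - \<epsilon>) * ((s - \<epsilon>) / s) \<le> (s - \<epsilon>) * 1"
      using e by (intro mult_left_mono) auto
    then show ?thesis using False by (intro ennreal_leI) (simp add: truncation_def power2_eq_square)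
  qed
qed

lemma truncation'_tendsto:
  assumes "0 < s" shows "(\<lambda>k. truncation' (1 / real (Suc k)) s) \<longlonglongrightarrow> 1"
proof -
  have lim: "(\<lambda>k. 1 / real (Suc k)) \<longlonglongrightarrow> 0"
    using LIMSEQ_inverse_real_of_nat by (simp add: inverse_eq_divide)
  have "(\<lambda>k. 1 - (1 / real (Suc k) / s)\<^sup>2) \<longlonglongrightarrow> 1 - (0 / s)\<^sup>2"
    by (intro tendsto_intros lim) (use assms in auto)
  then have "(\<lambda>k. 1 - (1 / real (Suc k) / s)\<^sup>2) \<longlonglongrightarrow> 1" by simp
  moreover have "\<forall>\<^sub>F k in sequentially. 1 - (1 / real (Suc k) / s)\<^sup>2 = truncation' (1 / real (Suc k)) s"
    using order_tendstoD(2)[OF lim assms] by eventually_elim (simp add: truncation'_def)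
  ultimately show ?thesis by (rule Lim_transform_eventually)
qed

text \<open>The segment from \<open>x\<close> to \<open>x - h *\<^sub>R b\<close> is connected and
  meets both \<open>\<Omega>\<close> and its complement, so it crosses the frontier.\<close>

lemma shifted_symmetric_difference_in_sweep:
  assumes "0 \<le> h" and "(x - h *\<^sub>R b \<in> \<Omega>) \<noteq> (x \<in> \<Omega>)"
  shows "x \<in> sweep h b (frontier \<Omega>)"
proof -
  let ?S = "(\<lambda>s. x - s *\<^sub>R b) ` {0..h}"
  have c: "connected ?S"
    by (intro connected_continuous_image continuous_intros) auto
  have "x \<in> ?S" using assms by (auto intro: image_eqI[of _ _ 0])
  moreover have "x - h *\<^sub>R b \<in> ?S" using assms by auto
  ultimately have "?S \<inter> \<Omega> \<noteq> {}" "?S - \<Omega> \<noteq> {}" using assms by auto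
  then have "?S \<inter> frontier \<Omega> \<noteq> {}" by (rule connected_Int_frontier[OF c])
  then show ?thesis by (auto simp: sweep_def)
qed

text \<open>No regularity of the boundary enters: the difference quotient of an integral over \<open>\<Omega>\<close> only
  sees the neighbourhood swept out by the frontier. Truncating \<open>F\<close> from below costs nothing in the
  limit because \<open>F'\<close> vanishes at the zeros of \<open>F\<close> in \<open>\<Omega>\<close>, which are minima.\<close>

lemma integral_partial_derivative_le_frontier:
  fixes F F' :: "'a::euclidean_space \<Rightarrow> real"
  assumes b: "b \<in> Basis" and \<Omega>: "open \<Omega>" "bounded \<Omega>"
    and F: "continuous_on UNIV F" and F': "continuous_on UNIV F'"
    and deriv: "\<And>x s. ((\<lambda>s. F (x + s *\<^sub>R b)) has_real_derivative F' (x + s *\<^sub>R b)) (at s)"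
    and nonneg: "\<And>x. x \<in> \<Omega> \<Longrightarrow> 0 \<le> F x"
  shows "ennreal \<bar>LINT x:\<Omega>|lborel. F' x\<bar> \<le> ennreal (sweep_const TYPE('a)) *
    (\<integral>\<^sup>+x\<in>frontier \<Omega>. ennreal (F x) \<partial>hausdorff_measure (DIM('a) - 1))"
    (is "_ \<le> ?R")
proof -
  let ?K = "frontier \<Omega>"
  have K: "compact ?K" using \<Omega> by (simp add: compact_frontier_bounded)
  have [measurable]: "F \<in> borel_measurable borel" "F' \<in> borel_measurable borel"
    using F F' by (auto intro: borel_measurable_continuous_onI)
  have [measurable]: "\<Omega> \<in> sets borel" using \<Omega> by simp
  have fin: "emeasure lborel \<Omega> < \<infinity>" using emeasure_bounded_finite[OF \<Omega>(2)] by simp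
  \<comment> \<open>A compact set containing all points of \<open>\<Omega>\<close> shifted by at
    most 1 along \<open>b\<close>; the bound of \<open>F'\<close> there dominates every difference
    quotient used below.\<close>
  let ?L = "sweep 1 b (closure \<Omega>)"
  have "compact ?L" using \<Omega> by (intro compact_sweep) (simp add: compact_closure)
  then obtain M where M: "\<And>x. x \<in> ?L \<Longrightarrow> \<bar>F' x\<bar> \<le> M"
    using compact_imp_bounded[OF compact_continuous_image[OF continuous_on_subset[OF F']]]
    by (auto simp: bounded_iff) blast
  have inL: "x + s *\<^sub>R b \<in> ?L" if "x \<in> \<Omega>" "0 \<le> s" "s \<le> 1" for x s
    using that subsetD[OF closure_subset, of x \<Omega>] by (auto simp: sweep_def intro!: bexI[of _ s])
  have inL0: "x \<in> ?L" if "x \<in> \<Omega>" for x using inL[OF that, of 0] by simp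
  have F_zero: "F' x = 0" if x: "x \<in> \<Omega>" "F x = 0" for x
  proof -
    obtain r where r: "0 < r" "ball x r \<subseteq> \<Omega>" using \<Omega>(1) x(1) by (auto simp: open_contains_ball)
    show ?thesis
    proof (rule DERIV_local_min[of "\<lambda>s. F (x + s *\<^sub>R b)" "F' x" 0])
      show "((\<lambda>s. F (x + s *\<^sub>R b)) has_real_derivative F' x) (at 0)"
        using deriv[of x 0] by simp
      show "\<forall>y. \<bar>0 - y\<bar> < r \<longrightarrow> F (x + 0 *\<^sub>R b) \<le> F (x + y *\<^sub>R b)"
      proof (intro allI impI)
        fix y assume "\<bar>0 - y\<bar> < r"
        then have "x + y *\<^sub>R b \<in> ball x r" using b by (simp add: dist_norm)
        then show "F (x + 0 *\<^sub>R b) \<le> F (x + y *\<^sub>R b)" using r nonneg x by auto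
      qed
    qed (rule r)
  qed
  have trunc: "ennreal \<bar>LINT x:\<Omega>|lborel. truncation' \<epsilon> (F x) * F' x\<bar> \<le> ?R" if \<epsilon>: "0 < \<epsilon>" for \<epsilon>
  proof -
    obtain h0 where h0: "0 < h0" "\<And>h. 0 < h \<Longrightarrow> h < h0 \<Longrightarrow>
      (\<integral>\<^sup>+x\<in>sweep h b ?K. ennreal (F x - \<epsilon>) \<partial>lborel)
        \<le> ennreal (sweep_const TYPE('a) * h) * (\<integral>\<^sup>+x\<in>?K. ennreal (F x) \<partial>hausdorff_measure (DIM('a) - 1))"
      by (rule nn_integral_sweep_le[OF b F K \<epsilon>]) blast
    define G where "G x = truncation \<epsilon> (F x)" for x
    define G' where "G' x = truncation' \<epsilon> (F x) * F' x" for x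
    have [measurable]: "truncation \<epsilon> \<in> borel_measurable borel" "truncation' \<epsilon> \<in> borel_measurable borel"
      unfolding truncation_def[abs_def] truncation'_def[abs_def] by measurable
    have [measurable]: "G \<in> borel_measurable borel" "G' \<in> borel_measurable borel"
      unfolding G_def[abs_def] G'_def[abs_def] by measurable
    have DG: "((\<lambda>s. G (x + s *\<^sub>R b)) has_real_derivative G' (x + s *\<^sub>R b)) (at s)" for x s
      unfolding G_def G'_def by (rule DERIV_chain2[OF truncation_deriv[OF \<epsilon>] deriv])
    have G'M: "\<bar>G' x\<bar> \<le> M" if "x \<in> ?L" for x
    proof -
      have "\<bar>truncation' \<epsilon> (F x)\<bar> * \<bar>F' x\<bar> \<le> 1 * M"
        by (intro mult_mono truncation'_bounds M \<epsilon> that) auto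
      then show ?thesis by (simp add: G'_def abs_mult)
    qed
    have quot: "\<bar>(G (x + h *\<^sub>R b) - G x) / h\<bar> \<le> M" if x: "x \<in> \<Omega>" "0 < h" "h \<le> 1" for x h
    proof -
      obtain z where z: "0 < z" "z < h" "G (x + h *\<^sub>R b) - G (x + 0 *\<^sub>R b) = (h - 0) * G' (x + z *\<^sub>R b)"
        using MVT2[of 0 h "\<lambda>s. G (x + s *\<^sub>R b)" "\<lambda>s. G' (x + s *\<^sub>R b)"] DG x by auto
      then have "(G (x + h *\<^sub>R b) - G x) / h = G' (x + z *\<^sub>R b)" using x by simp
      then show ?thesis using G'M[OF inL[OF x(1)]] z x by auto
    qed
    \<comment> \<open>The factor \<open>1 / h\<close> of the difference quotient cancels the length
      \<open>h\<close> in the sweep estimate, so the bound survives the limit in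
      \<open>h\<close>.\<close>
    have est: "ennreal \<bar>LINT x:\<Omega>|lborel. (G (x + h *\<^sub>R b) - G x) / h\<bar> \<le> ?R" if h: "0 < h" "h < min h0 1" for h
    proof -
      have shift: "integrable lborel (\<lambda>x. indicator \<Omega> x * G (x + h *\<^sub>R b))"
        "integrable lborel (\<lambda>x. indicator \<Omega> x * G x)"
      proof -
        have *: "\<exists>B. \<forall>x\<in>?L. \<bar>G x\<bar> \<le> B"
        proof -
          have "continuous_on UNIV (truncation \<epsilon>)"
            using truncation_deriv[OF \<epsilon>] by (intro DERIV_continuous_on) auto
          then have "continuous_on UNIV G" unfolding G_def[abs_def]
            by (rule continuous_on_compose2[OF _ F]) auto
          then have "bounded (G ` ?L)"
            by (intro compact_imp_bounded compact_continuous_image \<open>compact ?L\<close>)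
              (rule continuous_on_subset, auto)
          then show ?thesis by (auto simp: bounded_iff)
        qed
        then obtain B where B: "\<And>x. x \<in> ?L \<Longrightarrow> \<bar>G x\<bar> \<le> B" by blast
        have "integrable lborel (\<lambda>x. indicator \<Omega> x * B)" using fin by auto
        then show "integrable lborel (\<lambda>x. indicator \<Omega> x * G (x + h *\<^sub>R b))"
          by (rule Bochner_Integration.integrable_bound, measurable, intro AE_I2)
            (use B inL h in \<open>auto split: split_indicator intro: order_trans[OF _ abs_ge_self]\<close>)
        from \<open>integrable lborel (\<lambda>x. indicator \<Omega> x * B)\<close>
        show "integrable lborel (\<lambda>x. indicator \<Omega> x * G x)"
          by (rule Bochner_Integration.integrable_bound, measurable, intro AE_I2)
            (use B inL0 h in \<open>auto split: split_indicator intro: order_trans[OF _ abs_ge_self]\<close>)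
      qed
      have tr: "distr lborel borel ((+) (h *\<^sub>R b)) = (lborel :: 'a measure)"
        by (rule lborel_distr_plus)
      \<comment> \<open>Translation invariance moves the shift from \<open>G\<close> onto the
        indicator. What remains is an integral over the symmetric difference of
        \<open>\<Omega>\<close> and its translate.\<close>
      have "(\<integral>x. indicator \<Omega> x * G (x + h *\<^sub>R b) \<partial>lborel)
          = (\<integral>x. indicator \<Omega> (x - h *\<^sub>R b) * G x \<partial>distr lborel borel ((+) (h *\<^sub>R b)))"
        by (subst integral_distr) (auto simp: add.commute)
      then have eq: "(\<integral>x. indicator \<Omega> x * G (x + h *\<^sub>R b) \<partial>lborel) = (\<integral>x. indicator \<Omega> (x - h *\<^sub>R b) * G x \<partial>lborel)"
        unfolding tr .
      have "integrable (distr lborel borel ((+) (h *\<^sub>R b))) (\<lambda>x. indicator \<Omega> (x - h *\<^sub>R b) * G x)"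
        by (subst integrable_distr_eq) (use shift(1) in \<open>auto simp: add.commute\<close>)
      then have shift': "integrable lborel (\<lambda>x. indicator \<Omega> (x - h *\<^sub>R b) * G x)"
        unfolding tr .
      have "(LINT x:\<Omega>|lborel. (G (x + h *\<^sub>R b) - G x) / h)
          = (\<integral>x. (indicator \<Omega> x * G (x + h *\<^sub>R b) - indicator \<Omega> x * G x) / h \<partial>lborel)"
        unfolding set_lebesgue_integral_def by (intro Bochner_Integration.integral_cong) (auto simp: field_simps)
      also have "\<dots> = (\<integral>x. (indicator \<Omega> (x - h *\<^sub>R b) - indicator \<Omega> x) * G x \<partial>lborel) / h"
        using shift shift' by (simp add: eq left_diff_distrib)
      finally have "ennreal \<bar>LINT x:\<Omega>|lborel. (G (x + h *\<^sub>R b) - G x) / h\<bar>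
          = ennreal (1 / h) * ennreal \<bar>\<integral>x. (indicator \<Omega> (x - h *\<^sub>R b) - indicator \<Omega> x) * G x \<partial>lborel\<bar>"
        using h by (subst ennreal_mult[symmetric]) auto
      also have "ennreal \<bar>\<integral>x. (indicator \<Omega> (x - h *\<^sub>R b) - indicator \<Omega> x) * G x \<partial>lborel\<bar>
          \<le> (\<integral>\<^sup>+x. ennreal \<bar>(indicator \<Omega> (x - h *\<^sub>R b) - indicator \<Omega> x) * G x\<bar> \<partial>lborel)"
        using integral_norm_bound_ennreal[of lborel "\<lambda>x. (indicator \<Omega> (x - h *\<^sub>R b) - indicator \<Omega> x) * G x"]
          shift shift' by (simp add: left_diff_distrib)
      also have "\<dots> \<le> (\<integral>\<^sup>+x\<in>sweep h b ?K. ennreal (F x - \<epsilon>) \<partial>lborel)"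
      proof (intro nn_integral_mono)
        fix x
        show "ennreal \<bar>(indicator \<Omega> (x - h *\<^sub>R b) - indicator \<Omega> x) * G x\<bar>
            \<le> ennreal (F x - \<epsilon>) * indicator (sweep h b ?K) x"
        proof (cases "(x - h *\<^sub>R b \<in> \<Omega>) = (x \<in> \<Omega>)")
          case True then show ?thesis by (simp add: indicator_def)
        next
          case False
          then have "x \<in> sweep h b ?K"
            using h by (intro shifted_symmetric_difference_in_sweep) auto
          moreover have "\<bar>(indicator \<Omega> (x - h *\<^sub>R b) - indicator \<Omega> x) * G x\<bar> = G x"
            using False truncation_nonneg[OF \<epsilon>, of "F x"] by (auto simp: indicator_def G_def)
          ultimately show ?thesis using truncation_le[OF \<epsilon>, of "F x"] by (simp add: G_def)
        qed
      qed
      also have "\<dots> \<le> ennreal (sweep_const TYPE('a) * h) * (\<integral>\<^sup>+x\<in>?K. ennreal (F x) \<partial>hausdorff_measure (DIM('a) - 1))"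
        using h by (intro h0) auto
      finally have "ennreal \<bar>LINT x:\<Omega>|lborel. (G (x + h *\<^sub>R b) - G x) / h\<bar>
          \<le> ennreal (1 / h) * (ennreal (sweep_const TYPE('a) * h) * (\<integral>\<^sup>+x\<in>?K. ennreal (F x) \<partial>hausdorff_measure (DIM('a) - 1)))"
        by (simp add: mult_left_mono)
      also have "\<dots> = ?R"
        using h sweep_const_nonneg[where 'a='a] unfolding mult.assoc[symmetric]
        by (subst ennreal_mult[symmetric]) auto
      finally show ?thesis .
    qed
    define h1 where "h1 = min h0 1"
    have h1: "0 < h1" using h0(1) by (simp add: h1_def)
    define hs where "hs k = h1 / real (Suc (Suc k))" for k
    have hs: "0 < hs k" "hs k < min h0 1" for k
      using h1 unfolding h1_def[symmetric] by (auto simp: hs_def divide_less_eq)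
    have hs_lim: "filterlim hs (at 0) sequentially"
    proof -
      have "hs \<longlonglongrightarrow> 0"
        unfolding hs_def[abs_def] by real_asymp
      then show ?thesis using hs(1) by (auto simp: filterlim_at less_imp_neq[symmetric] intro!: always_eventually)
    qed
    have "(\<lambda>k. LINT x:\<Omega>|lborel. (G (x + hs k *\<^sub>R b) - G x) / hs k) \<longlonglongrightarrow> (LINT x:\<Omega>|lborel. G' x)"
      unfolding set_lebesgue_integral_def
    proof (rule integral_dominated_convergence[where w="\<lambda>x. indicator \<Omega> x * M"])
      show "integrable lborel (\<lambda>x. indicator \<Omega> x * M)" using fin by auto
      show "AE x in lborel. (\<lambda>k. indicator \<Omega> x *\<^sub>R ((G (x + hs k *\<^sub>R b) - G x) / hs k)) \<longlonglongrightarrow> indicator \<Omega> x *\<^sub>R G' x"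
      proof (intro AE_I2 tendsto_intros)
        fix x
        have "((\<lambda>h. (G (x + h *\<^sub>R b) - G x) / h) \<longlongrightarrow> G' x) (at 0)"
          using DG[of x 0] by (simp add: DERIV_def)
        then show "(\<lambda>k. (G (x + hs k *\<^sub>R b) - G x) / hs k) \<longlonglongrightarrow> G' x"
          by (rule filterlim_compose[OF _ hs_lim])
      qed
      show "AE x in lborel. norm (indicator \<Omega> x *\<^sub>R ((G (x + hs k *\<^sub>R b) - G x) / hs k)) \<le> indicator \<Omega> x * M" for k
        using quot[OF _ hs(1)] hs(2)[of k] by (intro AE_I2) (auto split: split_indicator simp del: abs_divide)
    qed measurable
    then have "(\<lambda>k. ennreal \<bar>LINT x:\<Omega>|lborel. (G (x + hs k *\<^sub>R b) - G x) / hs k\<bar>)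
        \<longlonglongrightarrow> ennreal \<bar>LINT x:\<Omega>|lborel. G' x\<bar>"
      by (intro tendsto_intros)
    then show ?thesis
      unfolding G'_def[symmetric] by (rule LIMSEQ_le_const2) (use est hs in blast)
  qed
  \<comment> \<open>Removal of the truncation: the factor tends to 1 where \<open>F\<close> is
    positive, and at zeros of \<open>F\<close> in \<open>\<Omega>\<close> both sides vanish by
    \<open>F_zero\<close>.\<close>
  have "(\<lambda>k. LINT x:\<Omega>|lborel. truncation' (1 / real (Suc k)) (F x) * F' x) \<longlonglongrightarrow> (LINT x:\<Omega>|lborel. F' x)"
    unfolding set_lebesgue_integral_def
  proof (rule integral_dominated_convergence[where w="\<lambda>x. indicator \<Omega> x * M"])
    show "integrable lborel (\<lambda>x. indicator \<Omega> x * M)" using fin by auto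
    show "AE x in lborel. (\<lambda>k. indicator \<Omega> x *\<^sub>R (truncation' (1 / real (Suc k)) (F x) * F' x)) \<longlonglongrightarrow> indicator \<Omega> x *\<^sub>R F' x"
    proof (intro AE_I2)
      fix x
      show "(\<lambda>k. indicator \<Omega> x *\<^sub>R (truncation' (1 / real (Suc k)) (F x) * F' x)) \<longlonglongrightarrow> indicator \<Omega> x *\<^sub>R F' x"
      proof (cases "x \<in> \<Omega> \<and> F x \<noteq> 0")
        case True
        then have "(\<lambda>k. truncation' (1 / real (Suc k)) (F x) * F' x) \<longlonglongrightarrow> 1 * F' x"
          using nonneg[of x] by (intro tendsto_mult truncation'_tendsto) auto
        then show ?thesis using True by simp
      next
        case False
        then show ?thesis using F_zero[of x] by (auto simp: indicator_def)
      qed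
    qed
    have [measurable]: "truncation' (1 / real (Suc k)) \<in> borel_measurable borel" for k
      unfolding truncation'_def[abs_def] by measurable
    show "(\<lambda>x. indicator \<Omega> x *\<^sub>R (truncation' (1 / real (Suc k)) (F x) * F' x)) \<in> borel_measurable lborel" for k
      by measurable
    show "AE x in lborel. norm (indicator \<Omega> x *\<^sub>R (truncation' (1 / real (Suc k)) (F x) * F' x)) \<le> indicator \<Omega> x * M" for k
    proof (intro AE_I2)
      fix x
      have "\<bar>truncation' (1 / real (Suc k)) (F x)\<bar> * \<bar>F' x\<bar> \<le> 1 * M" if "x \<in> \<Omega>"
        by (intro mult_mono truncation'_bounds M inL0 that) auto
      then show "norm (indicator \<Omega> x *\<^sub>R (truncation' (1 / real (Suc k)) (F x) * F' x)) \<le> indicator \<Omega> x * M"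
        by (auto split: split_indicator simp: abs_mult)
    qed
  qed measurable
  then have "(\<lambda>k. ennreal \<bar>LINT x:\<Omega>|lborel. truncation' (1 / real (Suc k)) (F x) * F' x\<bar>)
      \<longlonglongrightarrow> ennreal \<bar>LINT x:\<Omega>|lborel. F' x\<bar>"
    by (intro tendsto_intros)
  then show ?thesis
    by (rule LIMSEQ_le_const2) (use trunc in auto)
qed

section \<open>The fundamental lemma of the calculus of variations\<close>

lemma Ck_Suc_iff:
  "Ck (Suc k) f \<longleftrightarrow> (\<exists>D. (\<forall>x. (f has_derivative D x) (at x)) \<and> (\<forall>b\<in>Basis. Ck k (\<lambda>x. D x b)))"
proof
  assume "Ck (Suc k) f"
  then show "\<exists>D. (\<forall>x. (f has_derivative D x) (at x)) \<and> (\<forall>b\<in>Basis. Ck k (\<lambda>x. D x b))"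
    by (intro exI[of _ "\<lambda>x. frechet_derivative f (at x)"]) (auto simp: frechet_derivative_works)
next
  assume "\<exists>D. (\<forall>x. (f has_derivative D x) (at x)) \<and> (\<forall>b\<in>Basis. Ck k (\<lambda>x. D x b))"
  then obtain D where D: "\<And>x. (f has_derivative D x) (at x)" "\<forall>b\<in>Basis. Ck k (\<lambda>x. D x b)" by blast
  have "D x = frechet_derivative f (at x)" for x by (rule frechet_derivative_at[OF D(1)])
  then show "Ck (Suc k) f" using D by (auto simp: differentiable_def)
qed

text \<open>Any derivative may be exhibited in place of the choice term
  \<open>frechet_derivative\<close>; this is how \<open>Ck\<close> is established from here
  on.\<close>

lemma Ck_SucI:
  assumes "\<And>x. (f has_derivative D x) (at x)" "\<And>b. b \<in> Basis \<Longrightarrow> Ck k (\<lambda>x. D x b)"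
  shows "Ck (Suc k) f"
  unfolding Ck_Suc_iff using assms by blast

declare Ck.simps(2) [simp del]

lemma Ck_SucD: "Ck (Suc k) f \<Longrightarrow> Ck k f"
proof (induction k arbitrary: f)
  case 0
  then have "(f has_derivative frechet_derivative f (at x)) (at x)" for x
    by (simp add: Ck.simps(2) frechet_derivative_works)
  then have "continuous (at x) f" for x by (rule has_derivative_continuous)
  then show ?case by (simp add: continuous_on_eq_continuous_at)
next
  case (Suc k)
  then show ?case by (metis Ck.simps(2))
qed

lemma Ck_const [simp]: "Ck k (\<lambda>x. c)"
  by (induction k arbitrary: c) (auto intro!: Ck_SucI derivative_eq_intros)

lemma Ck_add: "Ck k f \<Longrightarrow> Ck k g \<Longrightarrow> Ck k (\<lambda>x. f x + g x)"
proof (induction k arbitrary: f g)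
  case 0 then show ?case by (auto intro: continuous_intros)
next
  case (Suc k)
  then obtain D D' where "\<And>x. (f has_derivative D x) (at x)" "\<forall>b\<in>Basis. Ck k (\<lambda>x. D x b)"
    "\<And>x. (g has_derivative D' x) (at x)" "\<forall>b\<in>Basis. Ck k (\<lambda>x. D' x b)"
    unfolding Ck_Suc_iff by blast
  with Suc.IH show ?case
    by (intro Ck_SucI[where D="\<lambda>x h. D x h + D' x h"]) (auto intro!: has_derivative_add)
qed

lemma Ck_mult: "Ck k f \<Longrightarrow> Ck k g \<Longrightarrow> Ck k (\<lambda>x. f x * g x)"
proof (induction k arbitrary: f g)
  case 0 then show ?case by (auto intro: continuous_intros)
next
  case (Suc k)
  then obtain D D' where "\<And>x. (f has_derivative D x) (at x)" "\<forall>b\<in>Basis. Ck k (\<lambda>x. D x b)"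
    "\<And>x. (g has_derivative D' x) (at x)" "\<forall>b\<in>Basis. Ck k (\<lambda>x. D' x b)"
    unfolding Ck_Suc_iff by blast
  moreover have "Ck k f" "Ck k g" using Suc.prems by (auto dest: Ck_SucD)
  ultimately show ?case
    by (intro Ck_SucI[where D="\<lambda>x h. f x * D' x h + D x h * g x"])
      (auto intro!: has_derivative_mult Ck_add Suc.IH)
qed

text \<open>A directional derivative of such a composite is a constant times a composite of the same
  form, so the induction closes without a general chain rule for \<open>Ck\<close>.\<close>

lemma Ck_compose_affine:
  fixes h :: "real \<Rightarrow> real" and v :: "'a::euclidean_space"
  assumes "Ck k h" shows "Ck k (\<lambda>x. h (x \<bullet> v + c))"
  using assms
proof (induction k arbitrary: h)
  case 0
  then show ?case by (auto intro!: continuous_on_compose2[of UNIV h] continuous_intros)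
next
  case (Suc k)
  then obtain D where D: "\<And>x. (h has_derivative D x) (at x)" "Ck k (\<lambda>x. D x 1)"
    unfolding Ck_Suc_iff by auto
  have lin: "D s t = t * D s 1" for s t
    using linear_scale[OF has_derivative_linear[OF D(1)], of s t 1] by simp
  show ?case
  proof (rule Ck_SucI)
    fix x
    show "((\<lambda>x. h (x \<bullet> v + c)) has_derivative (\<lambda>y. D (x \<bullet> v + c) (y \<bullet> v))) (at x)"
      by (rule has_derivative_compose[OF _ D(1)]) (auto intro!: derivative_eq_intros)
    show "Ck k (\<lambda>x. D (x \<bullet> v + c) (b \<bullet> v))" for b
      using Suc.IH[OF D(2)] by (subst lin) (intro Ck_mult Ck_const)
  qed
qed

text \<open>\<open>flat 0\<close> is the classical smooth function vanishing to infinite order at 0.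
  The powers of \<open>1 / s\<close> are carried along to make the family closed under linear
  combinations of derivatives, see \<open>flat_deriv\<close>; at 0 the difference quotient of
  \<open>flat j\<close> is \<open>flat (Suc j)\<close>.\<close>

definition flat :: "nat \<Rightarrow> real \<Rightarrow> real" where
  "flat j s = (if s \<le> 0 then 0 else (1 / s) ^ j * exp (- (1 / s)))"

lemma flat_tendsto: "(flat j \<longlongrightarrow> 0) (at 0)"
proof -
  have "((\<lambda>s. inverse s ^ j / exp (inverse s)) \<longlongrightarrow> (0::real)) (at_right 0)"
    by (rule filterlim_compose[OF tendsto_power_div_exp_0 filterlim_inverse_at_top_right])
  then have "(flat j \<longlongrightarrow> 0) (at_right 0)"
    by (rule Lim_transform_eventually)
      (auto simp: flat_def eventually_at_filter exp_minus inverse_eq_divide intro!: always_eventually)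
  moreover have "(flat j \<longlongrightarrow> 0) (at_left 0)"
    by (rule tendsto_eventually) (auto simp: flat_def eventually_at_filter intro!: always_eventually)
  ultimately show ?thesis by (rule filterlim_split_at_real[rotated])
qed

lemma flat_deriv: "(flat j has_real_derivative - real j * flat (Suc j) s + flat (Suc (Suc j)) s) (at s)"
proof -
  consider "s < 0" | "s = 0" | "0 < s" by linarith
  then show ?thesis
  proof cases
    case 1
    have "((\<lambda>_. 0) has_real_derivative - real j * flat (Suc j) s + flat (Suc (Suc j)) s) (at s)"
      using 1 by (simp add: flat_def)
    then show ?thesis
      by (rule has_field_derivative_transform_within_open[where S="{..<0}"])
        (use 1 in \<open>auto simp: flat_def\<close>)
  next
    case 2
    have "(\<lambda>h. (flat j (0 + h) - flat j 0) / h) = flat (Suc j)"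
      by (auto simp: flat_def)
    then show ?thesis
      using 2 flat_tendsto[of "Suc j"] by (simp add: DERIV_def flat_def)
  next
    case 3
    define x where "x = 1 / s"
    have "((\<lambda>s. 1 / s) has_real_derivative - (x ^ 2)) (at s)"
      using 3 by (auto intro!: derivative_eq_intros simp: x_def power2_eq_square)
    from DERIV_power[OF this, of j] DERIV_fun_exp[OF DERIV_minus[OF this]]
    have "((\<lambda>s. (1 / s) ^ j * exp (- (1 / s))) has_real_derivative
        real j * (- (x ^ 2) * x ^ (j - Suc 0)) * exp (- x) + exp (- x) * x ^ 2 * x ^ j) (at s)"
      using DERIV_mult[of "\<lambda>s. (1 / s) ^ j" _ s UNIV "\<lambda>s. exp (- (1 / s))"] by (fastforce simp: x_def)
    also have "real j * (- (x ^ 2) * x ^ (j - Suc 0)) * exp (- x) + exp (- x) * x ^ 2 * x ^ j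
        = - real j * flat (Suc j) s + flat (Suc (Suc j)) s"
      using 3 unfolding flat_def x_def[symmetric]
      by (cases j) (simp_all add: power2_eq_square algebra_simps)
    finally have "((\<lambda>s. (1 / s) ^ j * exp (- (1 / s))) has_real_derivative
        - real j * flat (Suc j) s + flat (Suc (Suc j)) s) (at s)" .
    then show ?thesis
      by (rule has_field_derivative_transform_within_open[where S="{0<..}"])
        (use 3 in \<open>auto simp: flat_def\<close>)
  qed
qed

lemma Ck_flat: "Ck k (flat j)"
proof (induction k arbitrary: j)
  case 0
  have "continuous_on UNIV (flat j)" by (rule DERIV_continuous_on) (rule DERIV_subset[OF flat_deriv], simp)
  then show ?case by simp
next
  case (Suc k)
  show ?case
  proof (rule Ck_SucI)
    show "(flat j has_derivative (*) (- real j * flat (Suc j) s + flat (Suc (Suc j)) s)) (at s)" for s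
      using flat_deriv unfolding has_field_derivative_def .
    show "Ck k (\<lambda>s. (- real j * flat (Suc j) s + flat (Suc (Suc j)) s) * b)" for b
      by (intro Ck_add Ck_mult Ck_const Suc.IH)
  qed
qed

lemma flat_0_bounds: "0 \<le> flat 0 s" "flat 0 s \<le> 1" "0 < flat 0 s \<longleftrightarrow> 0 < s"
  by (auto simp: flat_def)

section \<open>Smooth approximation of indicators of boxes\<close>

definition bump :: "'a::euclidean_space \<Rightarrow> 'a \<Rightarrow> 'a \<Rightarrow> real" where
  "bump a c x = (\<Prod>i\<in>Basis. flat 0 (x \<bullet> i - a \<bullet> i) * flat 0 (c \<bullet> i - x \<bullet> i))"

lemma Ck_bump: "Ck k (bump a c)"
proof -
  have "Ck k (\<lambda>x. \<Prod>i\<in>I. flat 0 (x \<bullet> i - a \<bullet> i) * flat 0 (c \<bullet> i - x \<bullet> i))" if "finite I" for I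
    using that
  proof (induction I)
    case empty then show ?case by simp
  next
    case (insert i I)
    have "Ck k (\<lambda>x. flat 0 (x \<bullet> i + - (a \<bullet> i)))" "Ck k (\<lambda>x. flat 0 (x \<bullet> (- i) + c \<bullet> i))"
      by (intro Ck_compose_affine Ck_flat)+
    then have "Ck k (\<lambda>x. flat 0 (x \<bullet> i - a \<bullet> i))" "Ck k (\<lambda>x. flat 0 (c \<bullet> i - x \<bullet> i))"
      by simp_all
    with insert show ?case by (simp add: Ck_mult)
  qed
  then show ?thesis by (simp add: bump_def[abs_def])
qed

lemma bump_bounds: "0 \<le> bump a c x" "bump a c x \<le> 1"
  unfolding bump_def by (auto intro!: prod_nonneg prod_le_1 mult_le_one flat_0_bounds mult_nonneg_nonneg)

lemma bump_pos_iff: "0 < bump a c x \<longleftrightarrow> x \<in> box a c"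
proof
  assume "x \<in> box a c"
  then show "0 < bump a c x"
    unfolding bump_def by (intro prod_pos mult_pos_pos) (auto simp: mem_box flat_0_bounds)
next
  assume pos: "0 < bump a c x"
  have ne: "flat 0 (x \<bullet> i - a \<bullet> i) * flat 0 (c \<bullet> i - x \<bullet> i) \<noteq> 0" if "i \<in> Basis" for i
  proof
    assume "flat 0 (x \<bullet> i - a \<bullet> i) * flat 0 (c \<bullet> i - x \<bullet> i) = 0"
    then have "bump a c x = 0" unfolding bump_def using that by (intro prod_zero) auto
    with pos show False by simp
  qed
  have "a \<bullet> i < x \<bullet> i \<and> x \<bullet> i < c \<bullet> i" if "i \<in> Basis" for i
    using ne[OF that] by (auto simp: flat_def split: if_splits)
  then show "x \<in> box a c" by (simp add: mem_box)
qed

text \<open>A polynomial in \<open>bump a c\<close>, hence smooth with no further work. As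
  \<open>bump a c\<close> has values in (0, 1] on the open box and is 0 elsewhere, the powers drive
  the sequence to the indicator of the box.\<close>

definition bump_seq :: "nat \<Rightarrow> 'a::euclidean_space \<Rightarrow> 'a \<Rightarrow> 'a \<Rightarrow> real" where
  "bump_seq n a c x = 1 - (1 - bump a c x) ^ n"

lemma smooth_bump_seq: "smooth (bump_seq n a c)"
proof -
  have "Ck k (\<lambda>x. (1 + (-1) * bump a c x) ^ n)" for k
  proof (induction n)
    case (Suc n)
    show ?case unfolding power_Suc by (intro Ck_mult Ck_add Ck_const Ck_bump Suc)
  qed simp
  then have "Ck k (\<lambda>x. 1 + (-1) * (1 + (-1) * bump a c x) ^ n)" for k
    by (intro Ck_add Ck_mult Ck_const)
  then show ?thesis by (simp add: smooth_def bump_seq_def[abs_def])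
qed

lemma bump_seq_bounds: "\<bar>bump_seq n a c x\<bar> \<le> indicator (box a c) x"
proof (cases "x \<in> box a c")
  case True
  have "0 \<le> (1 - bump a c x) ^ n" "(1 - bump a c x) ^ n \<le> 1"
    using bump_bounds[of a c x] by (auto intro!: power_le_one)
  then show ?thesis using True by (simp add: bump_seq_def)
next
  case False
  then have "bump a c x = 0" using bump_pos_iff[of a c x] bump_bounds[of a c x] by linarith
  then show ?thesis using False by (simp add: bump_seq_def)
qed

lemma bump_seq_tendsto: "(\<lambda>n. bump_seq n a c x) \<longlonglongrightarrow> indicator (box a c) x"
proof (cases "x \<in> box a c")
  case True
  then have "0 \<le> 1 - bump a c x" "1 - bump a c x < 1"
    using bump_pos_iff[of a c x] bump_bounds[of a c x] by auto
  then have "(\<lambda>n. (1 - bump a c x) ^ n) \<longlonglongrightarrow> 0" by (rule LIMSEQ_realpow_zero)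
  then have "(\<lambda>n. bump_seq n a c x) \<longlonglongrightarrow> 1 - 0" unfolding bump_seq_def by (intro tendsto_diff tendsto_const)
  then show ?thesis using True by simp
next
  case False
  have "bump_seq n a c x = 0" for n using bump_seq_bounds[of n a c x] False by simp
  then show ?thesis using False by simp
qed

lemma test_function_bump_seq: "cbox a c \<subseteq> U \<Longrightarrow> test_function U (bump_seq n a c)"
  unfolding test_function_def
proof (intro conjI exI[of _ "cbox a c"] smooth_bump_seq allI impI)
  fix x assume "x \<notin> cbox a c"
  then have "x \<notin> box a c" using box_subset_cbox by blast
  then show "bump_seq n a c x = 0" using bump_seq_bounds[of n a c x] by simp
qed auto

text \<open>Boxes are stable under intersection and generate the Borel sets, so a Dynkin argument
  makes the integral over every Borel part of a fixed box in \<open>U\<close> vanish. Countably many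
  closed boxes then exhaust \<open>U\<close>.\<close>

lemma AE_zero_of_box_integrals_zero:
  fixes g :: "'a::euclidean_space \<Rightarrow> real"
  assumes g: "integrable lborel g" and U: "open U"
    and zero: "\<And>a c. cbox a c \<subseteq> U \<Longrightarrow> (\<integral>x. indicator (box a c) x * g x \<partial>lborel) = 0"
  shows "AE x in lborel. x \<in> U \<longrightarrow> g x = 0"
proof -
  have cbox: "AE x in lborel. x \<in> cbox a c \<longrightarrow> g x = 0" if sub: "cbox a c \<subseteq> U" for a c
  proof -
    let ?h = "\<lambda>x. indicator (box a c) x * g x"
    have h: "integrable lborel ?h"
      using integrable_mult_indicator[OF _ g, of "box a c"] by simp
    have set_int: "(LINT x:A|lborel. ?h x) = 0" if "A \<in> sets borel" for A
    proof -
      have "Int_stable (range (\<lambda>(a, b). box a b :: 'a set))"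
        by (auto simp: Int_stable_def box_Int_box)
      moreover have "range (\<lambda>(a, b). box a b :: 'a set) \<subseteq> Pow UNIV" by simp
      moreover have "A \<in> sigma_sets UNIV (range (\<lambda>(a, b). box a b))"
        using that unfolding borel_eq_box by (simp add: sets_measure_of)
      ultimately show ?thesis
      proof (induction rule: sigma_sets_induct_disjoint)
        case (basic A)
        then obtain a' c' where A: "A = box a' c'" by auto
        \<comment> \<open>Corners of the intersection of the two boxes. The closed box with these
          corners is contained in \<open>cbox a c\<close> and therefore in \<open>U\<close>.\<close>
        let ?p = "(\<Sum>i\<in>Basis. max (a'\<bullet>i) (a\<bullet>i) *\<^sub>R i)" and ?q = "(\<Sum>i\<in>Basis. min (c'\<bullet>i) (c\<bullet>i) *\<^sub>R i)"
        have "cbox ?p ?q \<subseteq> U"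
          using sub Int_interval[of a' c' a c] by auto
        then have "(\<integral>x. indicator (box ?p ?q) x * g x \<partial>lborel) = 0" by (rule zero)
        moreover have "indicator (box ?p ?q) x * g x = indicator A x *\<^sub>R ?h x" for x
          unfolding box_Int_box[symmetric] A by (simp add: indicator_inter_arith)
        ultimately show ?case by (simp add: set_lebesgue_integral_def)
      next
        case empty then show ?case by (simp add: set_lebesgue_integral_def)
      next
        case (compl A)
        have A: "A \<in> sets borel" using compl unfolding borel_eq_box by (simp add: sets_measure_of)
        have "set_integrable lborel A ?h"
          unfolding set_integrable_def using A h by (intro integrable_mult_indicator) auto
        then have "(\<integral>x. ?h x - indicator A x *\<^sub>R ?h x \<partial>lborel) = (\<integral>x. ?h x \<partial>lborel) - (LINT x:A|lborel. ?h x)"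
          unfolding set_lebesgue_integral_def set_integrable_def
          using h by (intro Bochner_Integration.integral_diff)
        moreover have "(\<lambda>x. ?h x - indicator A x *\<^sub>R ?h x) = (\<lambda>x. indicator (UNIV - A) x *\<^sub>R ?h x)"
          by (auto simp: fun_eq_iff split: split_indicator)
        ultimately have "(LINT x:UNIV - A|lborel. ?h x) = (\<integral>x. ?h x \<partial>lborel) - (LINT x:A|lborel. ?h x)"
          by (simp add: set_lebesgue_integral_def)
        then show ?case using compl zero[OF sub] by simp
      next
        case (union A)
        have A: "A i \<in> sets borel" for i using union(1,2) unfolding borel_eq_box by (auto simp: sets_measure_of)
        have "(LINT x:(\<Union>i. A i)|lborel. ?h x) = (\<Sum>i. LINT x:A i|lborel. ?h x)"
        proof (rule lebesgue_integral_countable_add)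
          show "set_integrable lborel (\<Union>i. A i) ?h"
            unfolding set_integrable_def using A h by (intro integrable_mult_indicator) auto
        qed (use A union in \<open>auto simp: disjoint_family_on_def\<close>)
        then show ?case using union by simp
      qed
    qed
    have "AE x in lborel. ?h x = 0"
      by (rule density_unique_real) (use h set_int in \<open>auto simp: set_lebesgue_integral_def\<close>)
    \<comment> \<open>The integrals are over open boxes, but the countable exhaustion of
      \<open>U\<close> uses closed ones; the difference is a null set.\<close>
    moreover have "AE x in lborel. x \<notin> cbox a c - box a c"
      using negligible_frontier_interval[of a c]
      by (intro AE_not_in) (simp add: negligible_iff_null_sets null_sets_completion_iff)
    ultimately show ?thesis by eventually_elim auto
  qed
  obtain \<D> where D: "countable \<D>" "\<D> \<subseteq> Pow U" "\<And>X. X \<in> \<D> \<Longrightarrow> \<exists>a c. X = cbox a c" "\<Union>\<D> = U"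
    by (rule open_countable_Union_open_cbox[OF U]) blast
  have "AE x in lborel. x \<in> X \<longrightarrow> g x = 0" if X: "X \<in> \<D>" for X
  proof -
    obtain a c where "X = cbox a c" using D(3)[OF X] by blast
    with X D(2) show ?thesis by (auto intro!: cbox)
  qed
  then have "AE x in lborel. \<forall>X\<in>\<D>. x \<in> X \<longrightarrow> g x = 0"
    by (intro AE_ball_countable[OF D(1), THEN iffD2] ballI)
  then show ?thesis using D(4) by (auto elim!: eventually_mono)
qed

text \<open>Testing with \<open>bump_seq\<close> and dominated convergence give zero integrals over
  boxes. As \<open>f\<close> is only Lebesgue measurable, a Borel function \<open>g\<close> that
  agrees almost everywhere with its extension by 0 carries the argument over to
  \<open>lborel\<close>.\<close>

lemma fundamental_lemma_of_calculus_of_variations: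
  fixes f :: "'a::euclidean_space \<Rightarrow> real"
  assumes U: "open U" and f: "integrable (lebesgue_on U) f"
    and test: "\<And>\<phi>. test_function U \<phi> \<Longrightarrow> (\<integral>x. f x * \<phi> x \<partial>lebesgue_on U) = 0"
  shows "AE x in lebesgue_on U. f x = 0"
proof -
  have Um: "U \<in> sets lebesgue" using borel_open[OF U] by simp
  have f': "integrable lebesgue (\<lambda>x. indicator U x * f x)"
    using f Um by (simp add: integrable_restrict_space)
  then obtain g where g: "g \<in> borel_measurable lborel" "AE x in lborel. indicator U x * f x = g x"
    using completion_ex_borel_measurable_real[of "\<lambda>x. indicator U x * f x" lborel] by auto
  have AEg: "AE x in lebesgue. indicator U x * f x = g x" using g(2) by (rule AE_completion)
  have g_leb: "g \<in> borel_measurable lebesgue" using g(1) by (rule measurable_completion)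
  have "integrable lebesgue g"
    using f' integrable_cong_AE[OF borel_measurable_integrable[OF f'] g_leb AEg] by simp
  then have g_int: "integrable lborel g" using g(1) by (simp add: integrable_completion)
  have box0: "(\<integral>x. indicator (box a c) x * g x \<partial>lborel) = 0" if sub: "cbox a c \<subseteq> U" for a c
  proof -
    have bm: "bump_seq n a c \<in> borel_measurable borel" for n
    proof -
      have "Ck 0 (bump_seq n a c)" using smooth_bump_seq unfolding smooth_def by blast
      then show ?thesis by (simp add: borel_measurable_continuous_onI)
    qed
    note [measurable] = bm g(1)
    have "(\<lambda>n. \<integral>x. bump_seq n a c x * g x \<partial>lborel) \<longlonglongrightarrow> (\<integral>x. indicator (box a c) x * g x \<partial>lborel)"
    proof (rule integral_dominated_convergence[where w="\<lambda>x. \<bar>g x\<bar>"])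
      show "AE x in lborel. (\<lambda>n. bump_seq n a c x * g x) \<longlonglongrightarrow> indicator (box a c) x * g x"
        by (intro AE_I2 tendsto_mult bump_seq_tendsto tendsto_const)
      show "AE x in lborel. norm (bump_seq n a c x * g x) \<le> \<bar>g x\<bar>" for n
      proof (intro AE_I2)
        fix x
        have "\<bar>bump_seq n a c x\<bar> \<le> 1"
          using bump_seq_bounds[of n a c x] by (auto split: split_indicator_asm)
        then show "norm (bump_seq n a c x * g x) \<le> \<bar>g x\<bar>"
          by (simp add: abs_mult mult_left_le_one_le)
      qed
    qed (use g_int in auto)
    moreover have "(\<integral>x. bump_seq n a c x * g x \<partial>lborel) = 0" for n
    proof -
      have "(\<integral>x. bump_seq n a c x * g x \<partial>lborel) = (\<integral>x. bump_seq n a c x * g x \<partial>lebesgue)"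
        by (rule integral_completion[symmetric]) measurable
      also have "\<dots> = (\<integral>x. indicator U x *\<^sub>R (f x * bump_seq n a c x) \<partial>lebesgue)"
      proof (rule integral_cong_AE)
        show "(\<lambda>x. bump_seq n a c x * g x) \<in> borel_measurable lebesgue"
          by (intro borel_measurable_times g_leb measurable_completion) (simp add: bm)
        show "(\<lambda>x. indicator U x *\<^sub>R (f x * bump_seq n a c x)) \<in> borel_measurable lebesgue"
          using borel_measurable_times[OF borel_measurable_integrable[OF f'] measurable_completion[of "bump_seq n a c" lborel borel]]
          bm by (simp add: mult.assoc)
        show "AE x in lebesgue. bump_seq n a c x * g x = indicator U x *\<^sub>R (f x * bump_seq n a c x)"
          using AEg by eventually_elim (simp add: mult_ac)
      qed
      also have "\<dots> = (\<integral>x. f x * bump_seq n a c x \<partial>lebesgue_on U)"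
        using Um by (simp add: integral_restrict_space)
      finally show ?thesis using test[OF test_function_bump_seq[OF sub]] by simp
    qed
    ultimately show ?thesis by (simp add: LIMSEQ_const_iff)
  qed
  have "AE x in lborel. x \<in> U \<longrightarrow> g x = 0"
    by (rule AE_zero_of_box_integrals_zero[OF g_int U box0])
  with g(2) have "AE x in lborel. x \<in> U \<longrightarrow> f x = 0"
    by eventually_elim auto
  then have "AE x in lebesgue. x \<in> U \<longrightarrow> f x = 0" by (rule AE_completion)
  then show ?thesis using Um by (simp add: AE_restrict_space_iff)
qed

section \<open>Square-integrable functions\<close>

lemma L2_norm_nonneg: "0 \<le> L2_norm M f"
  by (simp add: L2_norm_def)

lemma L2_norm_power2: "(L2_norm M f)\<^sup>2 = (\<integral>x. (norm (f x))\<^sup>2 \<partial>M)"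
  by (simp add: L2_norm_def)

lemma nn_integral_L2: "L2 M f \<Longrightarrow> (\<integral>\<^sup>+x. ennreal ((norm (f x))\<^sup>2) \<partial>M) = ennreal ((L2_norm M f)\<^sup>2)"
  unfolding L2_norm_power2 L2_def by (intro nn_integral_eq_integral) auto

lemma L2_iff_nn_integral:
  "L2 M f \<longleftrightarrow> f \<in> borel_measurable M \<and> (\<integral>\<^sup>+x. ennreal ((norm (f x))\<^sup>2) \<partial>M) < \<infinity>"
  unfolding L2_def by (auto simp: integrable_iff_bounded)

lemma L2_mono:
  assumes g: "L2 M g" and f: "f \<in> borel_measurable M" and "0 \<le> c"
    and le: "AE x in M. norm (f x) \<le> c * norm (g x)"
  shows "L2 M f" "L2_norm M f \<le> c * L2_norm M g"
proof -
  have sq: "AE x in M. (norm (f x))\<^sup>2 \<le> c\<^sup>2 * (norm (g x))\<^sup>2"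
    using le by eventually_elim (simp add: power_mult_distrib[symmetric] power_mono)
  have int: "integrable M (\<lambda>x. c\<^sup>2 * (norm (g x))\<^sup>2)" using g by (simp add: L2_def)
  have f': "integrable M (\<lambda>x. (norm (f x))\<^sup>2)"
    by (rule Bochner_Integration.integrable_bound[OF int]) (use sq f in auto)
  then show "L2 M f" using f by (simp add: L2_def)
  have "(L2_norm M f)\<^sup>2 \<le> (c * L2_norm M g)\<^sup>2"
    unfolding power_mult_distrib L2_norm_power2 integral_mult_right_zero[symmetric]
    by (rule integral_mono_AE[OF f' int sq])
  then show "L2_norm M f \<le> c * L2_norm M g"
    by (rule power2_le_imp_le) (simp add: L2_norm_nonneg \<open>0 \<le> c\<close>)
qed

lemma L2_cauchy_schwarz:
  assumes f: "L2 M f" and g: "L2 M g"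
  shows "integrable M (\<lambda>x. norm (f x) * norm (g x))"
    and "(\<integral>x. norm (f x) * norm (g x) \<partial>M) \<le> L2_norm M f * L2_norm M g"
proof -
  have [measurable]: "f \<in> borel_measurable M" "g \<in> borel_measurable M" using f g by (auto simp: L2_def)
  have "(\<integral>\<^sup>+x. ennreal (norm (f x)) * ennreal (norm (g x)) \<partial>M)\<^sup>2
      \<le> (\<integral>\<^sup>+x. (ennreal (norm (f x)))\<^sup>2 \<partial>M) * (\<integral>\<^sup>+x. (ennreal (norm (g x)))\<^sup>2 \<partial>M)"
    by (intro Cauchy_Schwarz_nn_integral) measurable
  also have "\<dots> = ennreal ((L2_norm M f * L2_norm M g)\<^sup>2)"
    using nn_integral_L2[OF f] nn_integral_L2[OF g]
    by (simp add: ennreal_power ennreal_mult' power_mult_distrib)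
  finally have sq: "(\<integral>\<^sup>+x. ennreal (norm (f x) * norm (g x)) \<partial>M)\<^sup>2 \<le> ennreal ((L2_norm M f * L2_norm M g)\<^sup>2)"
    by (simp add: ennreal_mult')
  have le: "(\<integral>\<^sup>+x. ennreal (norm (f x) * norm (g x)) \<partial>M) \<le> ennreal (L2_norm M f * L2_norm M g)"
  proof (cases "\<integral>\<^sup>+x. ennreal (norm (f x) * norm (g x)) \<partial>M" rule: ennreal_cases)
    case (real r)
    have "ennreal (r\<^sup>2) \<le> ennreal ((L2_norm M f * L2_norm M g)\<^sup>2)"
      using sq unfolding real using real(1) by (simp add: ennreal_power)
    then have "r\<^sup>2 \<le> (L2_norm M f * L2_norm M g)\<^sup>2" by (subst (asm) ennreal_le_iff) auto
    then have "r \<le> L2_norm M f * L2_norm M g"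
      by (rule power2_le_imp_le) (simp add: L2_norm_nonneg)
    then show ?thesis unfolding real by (rule ennreal_leI)
  next
    case top
    with sq show ?thesis by (simp add: top_unique)
  qed
  show int: "integrable M (\<lambda>x. norm (f x) * norm (g x))"
    using le by (auto simp: integrable_iff_bounded abs_mult intro: le_less_trans)
  have "ennreal (\<integral>x. norm (f x) * norm (g x) \<partial>M) \<le> ennreal (L2_norm M f * L2_norm M g)"
    using le int by (subst (asm) nn_integral_eq_integral) auto
  then show "(\<integral>x. norm (f x) * norm (g x) \<partial>M) \<le> L2_norm M f * L2_norm M g"
    by (subst (asm) ennreal_le_iff) (auto simp: L2_norm_nonneg)
qed

lemma L2_add_triangle:
  assumes f: "L2 M f" and g: "L2 M g"
  shows "L2 M (\<lambda>x. f x + g x)" "L2_norm M (\<lambda>x. f x + g x) \<le> L2_norm M f + L2_norm M g"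
proof -
  have [measurable]: "f \<in> borel_measurable M" "g \<in> borel_measurable M" using f g by (auto simp: L2_def)
  let ?r = "\<lambda>x. (norm (f x))\<^sup>2 + 2 * (norm (f x) * norm (g x)) + (norm (g x))\<^sup>2"
  have int: "integrable M ?r"
    using f g L2_cauchy_schwarz(1)[OF f g] by (auto simp: L2_def)
  have le: "(norm (f x + g x))\<^sup>2 \<le> ?r x" for x
    using power_mono[OF norm_triangle_ineq[of "f x" "g x"], of 2] by (simp add: power2_sum algebra_simps)
  have fg: "integrable M (\<lambda>x. (norm (f x + g x))\<^sup>2)"
    by (rule Bochner_Integration.integrable_bound[OF int]) (use le in auto)
  then show "L2 M (\<lambda>x. f x + g x)" by (simp add: L2_def)
  have "(L2_norm M (\<lambda>x. f x + g x))\<^sup>2 \<le> (\<integral>x. ?r x \<partial>M)"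
    unfolding L2_norm_power2 by (rule integral_mono[OF fg int le])
  also have "\<dots> = (L2_norm M f)\<^sup>2 + 2 * (\<integral>x. norm (f x) * norm (g x) \<partial>M) + (L2_norm M g)\<^sup>2"
    using f g L2_cauchy_schwarz(1)[OF f g] unfolding L2_norm_power2 by (simp add: L2_def)
  also have "\<dots> \<le> (L2_norm M f + L2_norm M g)\<^sup>2"
    using L2_cauchy_schwarz(2)[OF f g] by (simp add: power2_sum)
  finally show "L2_norm M (\<lambda>x. f x + g x) \<le> L2_norm M f + L2_norm M g"
    by (rule power2_le_imp_le) (simp add: L2_norm_nonneg)
qed

lemma L2_uminus: "L2 M f \<Longrightarrow> L2 M (\<lambda>x. - f x)" "L2_norm M (\<lambda>x. - f x) = L2_norm M f"
  by (auto simp: L2_def L2_norm_def)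

lemma L2_diff: "L2 M f \<Longrightarrow> L2 M g \<Longrightarrow> L2 M (\<lambda>x. f x - g x)"
  using L2_add_triangle(1)[of M f "\<lambda>x. - g x"] L2_uminus[of M g] by simp

lemma L2_norm_minus_commute: "L2_norm M (\<lambda>x. f x - g x) = L2_norm M (\<lambda>x. g x - f x)"
  by (simp add: L2_norm_def norm_minus_commute)

lemma L2_norm_triangle_sub:
  assumes "L2 M f" "L2 M g" shows "L2_norm M f \<le> L2_norm M g + L2_norm M (\<lambda>x. f x - g x)"
  using L2_add_triangle(2)[OF assms(2) L2_diff[OF assms]] by simp

lemma L2_norm_diff_triangle:
  assumes "L2 M f" "L2 M g" "L2 M h"
  shows "L2_norm M (\<lambda>x. f x - h x) \<le> L2_norm M (\<lambda>x. f x - g x) + L2_norm M (\<lambda>x. g x - h x)"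
  using L2_add_triangle(2)[OF L2_diff[OF assms(1,2)] L2_diff[OF assms(2,3)]] by simp

lemma L2_tendsto_norm:
  assumes "L2_tendsto M F f" shows "(\<lambda>n. L2_norm M (F n)) \<longlonglongrightarrow> L2_norm M f"
proof (rule Lim_transform2)
  show "(\<lambda>n. L2_norm M f) \<longlonglongrightarrow> L2_norm M f" by simp
  have "\<bar>L2_norm M f - L2_norm M (F n)\<bar> \<le> L2_norm M (\<lambda>x. F n x - f x)" for n
    using L2_norm_triangle_sub[of M f "F n"] L2_norm_triangle_sub[of M "F n" f] assms
      L2_norm_minus_commute[of M f "F n"] by (auto simp: L2_tendsto_def abs_le_iff)
  then have "\<forall>\<^sub>F n in sequentially. norm (L2_norm M f - L2_norm M (F n)) \<le> L2_norm M (\<lambda>x. F n x - f x)"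
    by simp
  then show "(\<lambda>n. L2_norm M f - L2_norm M (F n)) \<longlonglongrightarrow> 0"
    by (rule Lim_null_comparison) (use assms in \<open>simp add: L2_tendsto_def\<close>)
qed

text \<open>Riesz-Fischer theorem, which supplies the function \<open>w\<close> for the existence of
  time traces.\<close>

lemma L2_complete:
  fixes F :: "nat \<Rightarrow> 'm \<Rightarrow> real"
  assumes F: "\<And>n. L2 M (F n)"
    and cauchy: "\<And>e. 0 < e \<Longrightarrow> \<exists>N. \<forall>m\<ge>N. \<forall>n\<ge>N. L2_norm M (\<lambda>x. F m x - F n x) < e"
  obtains w where "L2_tendsto M F w"
proof -
  have [measurable]: "F n \<in> borel_measurable M" for n using F by (simp add: L2_def)
  have "\<forall>k. \<exists>N. \<forall>m\<ge>N. \<forall>n\<ge>N. L2_norm M (\<lambda>x. F m x - F n x) < (1/2) ^ k"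
    using cauchy by simp
  then obtain N where N: "\<And>k m n. N k \<le> m \<Longrightarrow> N k \<le> n \<Longrightarrow> L2_norm M (\<lambda>x. F m x - F n x) < (1/2) ^ k"
    by metis
  \<comment> \<open>Summing the thresholds gives \<open>N k \<le> r l\<close> for all
    \<open>k \<le> l\<close> although \<open>N\<close> need not be monotone.\<close>
  define r where "r k = (\<Sum>i\<le>k. N i) + k" for k
  have rN: "N k \<le> r l" if "k \<le> l" for k l
    using that member_le_sum[of k "{..l}" N] by (simp add: r_def)
  define d where "d k x = F (r (Suc k)) x - F (r k) x" for k x
  have dL2: "L2 M (d k)" for k unfolding d_def by (intro L2_diff F)
  have [measurable]: "d k \<in> borel_measurable M" for k using dL2 by (simp add: L2_def)
  have d: "L2_norm M (d k) \<le> (1/2) ^ k" for k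
    using N[of k "r (Suc k)" "r k"] rN[of k "Suc k"] rN[of k k] by (simp add: d_def[abs_def])
  \<comment> \<open>The weight \<open>2 ^ k\<close> still leaves a convergent series, as
    \<open>2 ^ k * ((1/2) ^ k)\<^sup>2 = (1/2) ^ k\<close>. It yields absolute summability of the
    differences: either \<open>\<bar>d k x\<bar> \<le> (1/2) ^ k\<close>, or
    \<open>\<bar>d k x\<bar>\<close> is at most its weighted square.\<close>
  have "(\<integral>\<^sup>+x. (\<Sum>k. ennreal (2 ^ k * (d k x)\<^sup>2)) \<partial>M) = (\<Sum>k. \<integral>\<^sup>+x. ennreal (2 ^ k * (d k x)\<^sup>2) \<partial>M)"
    by (rule nn_integral_suminf) measurable
  also have "\<dots> \<le> (\<Sum>k. ennreal ((1/2) ^ k))"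
  proof (intro suminf_le allI)
    fix k
    have "(\<integral>\<^sup>+x. ennreal (2 ^ k * (d k x)\<^sup>2) \<partial>M) = ennreal (2 ^ k * (L2_norm M (d k))\<^sup>2)"
      using nn_integral_L2[OF dL2[of k]] by (simp add: ennreal_mult' nn_integral_cmult)
    also have "\<dots> \<le> ennreal (2 ^ k * ((1/2) ^ k)\<^sup>2)"
      by (intro ennreal_leI mult_left_mono power_mono d L2_norm_nonneg) auto
    also have "(2::real) ^ k * ((1/2) ^ k)\<^sup>2 = (1/2) ^ k"
      by (simp add: power2_eq_square power_divide)
    finally show "(\<integral>\<^sup>+x. ennreal (2 ^ k * (d k x)\<^sup>2) \<partial>M) \<le> ennreal ((1/2) ^ k)" .
  qed auto
  also have "\<dots> = ennreal (\<Sum>k. (1/2) ^ k)" by (intro suminf_ennreal2 summable_geometric) auto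
  also have "\<dots> < \<infinity>" by simp
  finally have "(\<integral>\<^sup>+x. (\<Sum>k. ennreal (2 ^ k * (d k x)\<^sup>2)) \<partial>M) \<noteq> \<infinity>" by simp
  then have "AE x in M. (\<Sum>k. ennreal (2 ^ k * (d k x)\<^sup>2)) \<noteq> \<infinity>"
    by (intro nn_integral_PInf_AE) measurable
  then have conv: "AE x in M. convergent (\<lambda>k. F (r k) x)"
  proof eventually_elim
    case (elim x)
    then have "summable (\<lambda>k. 2 ^ k * (d k x)\<^sup>2)"
      by (intro summable_suminf_not_top) auto
    then have "summable (\<lambda>k. (1/2) ^ k + 2 ^ k * (d k x)\<^sup>2)"
      by (intro summable_add summable_geometric) auto
    moreover have "norm (d k x) \<le> (1/2) ^ k + 2 ^ k * (d k x)\<^sup>2" for k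
    proof (cases "\<bar>d k x\<bar> \<le> (1/2) ^ k")
      case True then show ?thesis by (simp add: add_increasing2)
    next
      case False
      then have "1 \<le> 2 ^ k * \<bar>d k x\<bar>" by (simp add: power_divide field_simps)
      then have "1 * \<bar>d k x\<bar> \<le> (2 ^ k * \<bar>d k x\<bar>) * \<bar>d k x\<bar>" by (rule mult_right_mono) simp
      then have "\<bar>d k x\<bar> \<le> 2 ^ k * (d k x)\<^sup>2" by (simp add: power2_eq_square)
      moreover have "(0::real) \<le> (1/2) ^ k" by simp
      ultimately show ?thesis unfolding real_norm_def by linarith
    qed
    ultimately have "summable (\<lambda>k. d k x)" by (rule summable_comparison_test'[where N=0])
    then have "convergent (\<lambda>n. \<Sum>k<n. d k x)" by (simp add: summable_iff_convergent)
    moreover have "(\<Sum>k<n. d k x) = F (r n) x - F (r 0) x" for n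
      unfolding d_def by (rule sum_lessThan_telescope)
    ultimately have "convergent (\<lambda>n. F (r n) x - F (r 0) x)" by simp
    then show ?case using convergent_diff_const_right_iff[of "\<lambda>n. F (r n) x" "F (r 0) x"] by simp
  qed
  define w where "w x = lim (\<lambda>k. F (r k) x)" for x
  have w_meas [measurable]: "w \<in> borel_measurable M"
    unfolding w_def[abs_def] by (rule borel_measurable_lim_metric) measurable
  have lim: "AE x in M. (\<lambda>k. F (r k) x) \<longlonglongrightarrow> w x"
    using conv by eventually_elim (simp add: w_def convergent_LIMSEQ_iff)
  \<comment> \<open>Fatou's lemma along the subsequence turns the pointwise limit into a norm bound
    for every \<open>n \<ge> N k\<close>, so the whole sequence converges.\<close>
  have fatou: "(\<integral>\<^sup>+x. ennreal ((norm (F n x - w x))\<^sup>2) \<partial>M) \<le> ennreal (((1/2) ^ k)\<^sup>2)" if n: "N k \<le> n" for n k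
  proof -
    have "(\<integral>\<^sup>+x. ennreal ((norm (F n x - w x))\<^sup>2) \<partial>M)
        = (\<integral>\<^sup>+x. liminf (\<lambda>j. ennreal ((norm (F n x - F (r j) x))\<^sup>2)) \<partial>M)"
      using lim
      by (intro nn_integral_cong_AE) (auto elim!: eventually_mono intro!: lim_imp_Liminf[symmetric] tendsto_intros)
    also have "\<dots> \<le> liminf (\<lambda>j. \<integral>\<^sup>+x. ennreal ((norm (F n x - F (r j) x))\<^sup>2) \<partial>M)"
      by (rule nn_integral_liminf) measurable
    also have "\<dots> \<le> ennreal (((1/2) ^ k)\<^sup>2)"
    proof (rule Liminf_le)
      have "(\<integral>\<^sup>+x. ennreal ((norm (F n x - F (r j) x))\<^sup>2) \<partial>M) \<le> ennreal (((1/2) ^ k)\<^sup>2)" if "k \<le> j" for j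
        unfolding nn_integral_L2[OF L2_diff[OF F F]]
        using N[of k n "r j"] n rN[OF that] by (intro ennreal_leI power_mono L2_norm_nonneg) auto
      then show "\<forall>\<^sub>F j in sequentially. (\<integral>\<^sup>+x. ennreal ((norm (F n x - F (r j) x))\<^sup>2) \<partial>M) \<le> ennreal (((1/2) ^ k)\<^sup>2)"
        by (auto simp: eventually_sequentially)
    qed simp
    finally show ?thesis .
  qed
  have diffL2: "L2 M (\<lambda>x. F n x - w x)" if n: "N k \<le> n" for n k
    unfolding L2_iff_nn_integral using fatou[OF n] by (auto intro: le_less_trans)
  have diffle: "L2_norm M (\<lambda>x. F n x - w x) \<le> (1/2) ^ k" if n: "N k \<le> n" for n k
  proof -
    have "(L2_norm M (\<lambda>x. F n x - w x))\<^sup>2 \<le> ((1/2) ^ k)\<^sup>2"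
      using fatou[OF n] unfolding nn_integral_L2[OF diffL2[OF n]] by (subst (asm) ennreal_le_iff) auto
    then show ?thesis by (rule power2_le_imp_le) simp
  qed
  have "L2 M (\<lambda>x. F (N 0) x - (F (N 0) x - w x))"
    by (intro L2_diff F diffL2[of 0]) simp
  then have wL2: "L2 M w" by simp
  have "(\<lambda>n. L2_norm M (\<lambda>x. F n x - w x)) \<longlonglongrightarrow> 0"
  proof (rule LIMSEQ_I)
    fix e :: real assume "0 < e"
    then obtain k where "(1/2) ^ k < e" using real_arch_pow_inv[of e "1/2"] by auto
    then have "norm (L2_norm M (\<lambda>x. F n x - w x) - 0) < e" if "N k \<le> n" for n
      using diffle[OF that] L2_norm_nonneg[of M "\<lambda>x. F n x - w x"] by simp
    then show "\<exists>no. \<forall>n\<ge>no. norm (L2_norm M (\<lambda>x. F n x - w x) - 0) < e" by blast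
  qed
  then show ?thesis using F wL2 by (intro that) (simp add: L2_tendsto_def)
qed

section \<open>Energy estimates in the cylinder\<close>

lemma C1_facts:
  fixes v :: "'a::euclidean_space \<Rightarrow> real"
  assumes "Ck (Suc 0) v"
  shows "(v has_derivative (\<lambda>h. gradient v z \<bullet> h)) (at z)"
    and "continuous_on UNIV (gradient v)" and "continuous_on UNIV v"
proof -
  have d: "(v has_derivative frechet_derivative v (at z)) (at z)" for z
    using assms by (simp add: Ck.simps(2) frechet_derivative_works)
  have "frechet_derivative v (at z) h = gradient v z \<bullet> h" for z h
  proof -
    have "frechet_derivative v (at z) h = frechet_derivative v (at z) (\<Sum>b\<in>Basis. (h \<bullet> b) *\<^sub>R b)"
      by (simp add: euclidean_representation)
    also have "\<dots> = (\<Sum>b\<in>Basis. (h \<bullet> b) * frechet_derivative v (at z) b)"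
      using has_derivative_linear[OF d] by (simp add: linear_sum linear_scale)
    finally show ?thesis by (simp add: gradient_def inner_sum_left inner_commute[of h] mult.commute)
  qed
  then have "frechet_derivative v (at z) = (\<lambda>h. gradient v z \<bullet> h)" by blast
  with d[of z] show "(v has_derivative (\<lambda>h. gradient v z \<bullet> h)) (at z)" by simp
  show "continuous_on UNIV (gradient v)"
    unfolding gradient_def[abs_def] using assms by (auto simp: Ck.simps(2) intro!: continuous_intros)
  show "continuous_on UNIV v" using Ck_SucD[OF assms] by simp
qed

lemma gradient_diff:
  assumes "Ck (Suc 0) v" "Ck (Suc 0) w"
  shows "Ck (Suc 0) (\<lambda>z. v z - w z)" "gradient (\<lambda>z. v z - w z) z = gradient v z - gradient w z"
proof -
  have "Ck (Suc 0) (\<lambda>z. v z + (-1) * w z)" using assms by (intro Ck_add Ck_mult Ck_const)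
  then show *: "Ck (Suc 0) (\<lambda>z. v z - w z)" by simp
  have "((\<lambda>z. v z - w z) has_derivative (\<lambda>h. gradient v z \<bullet> h - gradient w z \<bullet> h)) (at z)"
    by (intro has_derivative_diff C1_facts assms)
  then have "(\<lambda>h. gradient v z \<bullet> h - gradient w z \<bullet> h) = (\<lambda>h. gradient (\<lambda>z. v z - w z) z \<bullet> h)"
    using C1_facts(1)[OF *, of z] by (rule has_derivative_unique)
  then have "(gradient v z - gradient w z) \<bullet> h = gradient (\<lambda>z. v z - w z) z \<bullet> h" for h
    by (metis inner_diff_left)
  then show "gradient (\<lambda>z. v z - w z) z = gradient v z - gradient w z"
    by (metis vector_eq_rdot)
qed

lemma C1_line_derivatives:
  fixes v :: "'a::euclidean_space \<times> real \<Rightarrow> real"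
  assumes "Ck (Suc 0) v"
  shows "((\<lambda>s. v (x, s)) has_real_derivative snd (gradient v (x, s))) (at s)"
    and "((\<lambda>s. v (x + s *\<^sub>R b, t)) has_real_derivative fst (gradient v (x + s *\<^sub>R b, t)) \<bullet> b) (at s)"
proof -
  have "((\<lambda>s. v (x, s)) has_derivative (\<lambda>h. gradient v (x, s) \<bullet> (0, h))) (at s)"
    by (rule has_derivative_compose[OF _ C1_facts(1)[OF assms]]) (auto intro!: derivative_eq_intros)
  then show "((\<lambda>s. v (x, s)) has_real_derivative snd (gradient v (x, s))) (at s)"
    unfolding has_field_derivative_def by (simp add: inner_prod_def)
  have "((\<lambda>s. v (x + s *\<^sub>R b, t)) has_derivative (\<lambda>h. gradient v (x + s *\<^sub>R b, t) \<bullet> (h *\<^sub>R b, 0))) (at s)"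
    by (rule has_derivative_compose[OF _ C1_facts(1)[OF assms]]) (auto intro!: derivative_eq_intros)
  moreover have "(\<lambda>h. gradient v (x + s *\<^sub>R b, t) \<bullet> (h *\<^sub>R b, 0)) = (*) (fst (gradient v (x + s *\<^sub>R b, t)) \<bullet> b)"
    by (simp add: inner_prod_def fun_eq_iff mult.commute)
  ultimately show "((\<lambda>s. v (x + s *\<^sub>R b, t)) has_real_derivative fst (gradient v (x + s *\<^sub>R b, t)) \<bullet> b) (at s)"
    unfolding has_field_derivative_def by simp
qed

lemma continuous_on_slice:
  assumes "continuous_on UNIV f"
  shows "continuous_on UNIV (\<lambda>x. f (x, t))" "continuous_on UNIV (\<lambda>t. f (x, t))"
  by (rule continuous_on_compose2[OF assms], auto intro!: continuous_intros)+

lemma set_integrable_continuous_bounded: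
  fixes f :: "'a::euclidean_space \<Rightarrow> real"
  assumes "continuous_on UNIV f" "bounded A" "A \<in> sets borel"
  shows "set_integrable lborel A f"
proof -
  have "set_integrable lborel (closure A) f"
    unfolding set_integrable_def using assms
    by (intro borel_integrable_compact continuous_on_subset[OF assms(1)]) (auto simp: compact_closure)
  then show ?thesis
    by (rule set_integrable_subset) (use assms closure_subset in auto)
qed

lemma product_integral_continuous:
  fixes f :: "'a::euclidean_space \<times> real \<Rightarrow> real"
  assumes f: "continuous_on UNIV f" and A: "bounded A" "A \<in> sets borel" and I: "bounded I" "I \<in> sets borel"
  shows "set_integrable lborel (A \<times> I) f"
    and "set_integrable lborel I (\<lambda>t. LINT x:A|lborel. f (x, t))"
    and "(LINT t:I|lborel. LINT x:A|lborel. f (x, t)) = (LINT z:A \<times> I|lborel. f z)"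
    and "(LINT x:A|lborel. LINT t:I|lborel. f (x, t)) = (LINT z:A \<times> I|lborel. f z)"
proof -
  have AI: "A \<times> I \<in> sets borel" using A I by (simp add: borel_Times)
  show int: "set_integrable lborel (A \<times> I) f"
    by (intro set_integrable_continuous_bounded f bounded_Times A I AI)
  let ?g = "\<lambda>x t. indicator A x * (indicator I t * f (x, t))"
  have eq: "(\<lambda>(x, t). ?g x t) = (\<lambda>z. indicator (A \<times> I) z *\<^sub>R f z)"
    by (auto simp: fun_eq_iff split: split_indicator)
  have g: "integrable (lborel \<Otimes>\<^sub>M lborel) (\<lambda>(x, t). ?g x t)"
    unfolding eq lborel_prod using int by (simp add: set_integrable_def)
  have inner: "(\<integral>x. ?g x t \<partial>lborel) = indicator I t *\<^sub>R (LINT x:A|lborel. f (x, t))" for t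
    unfolding set_lebesgue_integral_def integral_scaleR_right[symmetric]
    by (intro Bochner_Integration.integral_cong) (auto split: split_indicator)
  have inner': "(\<integral>t. ?g x t \<partial>lborel) = indicator A x *\<^sub>R (LINT t:I|lborel. f (x, t))" for x
    unfolding set_lebesgue_integral_def integral_scaleR_right[symmetric]
    by (intro Bochner_Integration.integral_cong) (auto split: split_indicator)
  show "set_integrable lborel I (\<lambda>t. LINT x:A|lborel. f (x, t))"
    using lborel_pair.integrable_snd[OF g] unfolding inner set_integrable_def .
  show "(LINT t:I|lborel. LINT x:A|lborel. f (x, t)) = (LINT z:A \<times> I|lborel. f z)"
    using lborel_pair.integral_snd[OF g] unfolding inner eq lborel_prod
    by (simp add: set_lebesgue_integral_def)
  show "(LINT x:A|lborel. LINT t:I|lborel. f (x, t)) = (LINT z:A \<times> I|lborel. f z)"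
    using lborel_pair.integral_fst[OF g] unfolding inner' eq lborel_prod
    by (simp add: set_lebesgue_integral_def)
qed

lemma time_derivative_integral:
  fixes q q' :: "'a::euclidean_space \<times> real \<Rightarrow> real"
  assumes q: "continuous_on UNIV q" and q': "continuous_on UNIV q'"
    and deriv: "\<And>x t. ((\<lambda>t. q (x, t)) has_real_derivative q' (x, t)) (at t)"
    and A: "bounded A" "A \<in> sets borel" and ab: "a \<le> b"
  shows "(LINT x:A|lborel. q (x, b)) - (LINT x:A|lborel. q (x, a)) = (LINT z:A \<times> {a..b}|lborel. q' z)"
proof -
  have ftc: "(LINT t:{a..b}|lborel. q' (x, t)) = q (x, b) - q (x, a)" for x
    unfolding set_lebesgue_integral_def
    by (rule integral_FTC_Icc[OF ab])
      (auto intro: has_vector_derivative_at_within continuous_on_subset[OF continuous_on_slice(2)[OF q']]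
        simp: has_real_derivative_iff_has_vector_derivative[symmetric] intro!: has_field_derivative_at_within deriv)
  have "(LINT x:A|lborel. q (x, b)) - (LINT x:A|lborel. q (x, a)) = (LINT x:A|lborel. q (x, b) - q (x, a))"
    by (intro set_integral_diff(2)[symmetric] set_integrable_continuous_bounded continuous_on_slice q A)
  also have "\<dots> = (LINT x:A|lborel. LINT t:{a..b}|lborel. q' (x, t))"
    unfolding ftc ..
  also have "\<dots> = (LINT z:A \<times> {a..b}|lborel. q' z)"
    by (intro product_integral_continuous q' A) auto
  finally show ?thesis .
qed

lemma integral_lebesgue_on_eq_lborel:
  fixes f :: "'a::euclidean_space \<Rightarrow> real"
  assumes "f \<in> borel_measurable borel" "A \<in> sets borel"
  shows "(\<integral>x. f x \<partial>lebesgue_on A) = (LINT x:A|lborel. f x)"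
proof -
  note [measurable] = assms
  have "(\<integral>x. f x \<partial>lebesgue_on A) = (\<integral>x. indicator A x *\<^sub>R f x \<partial>lebesgue)"
    using assms by (intro integral_restrict_space) simp
  also have "\<dots> = (\<integral>x. indicator A x *\<^sub>R f x \<partial>lborel)"
    using assms by (intro integral_completion) measurable
  finally show ?thesis by (simp add: set_lebesgue_integral_def)
qed

lemma L2_continuous_bounded:
  fixes f :: "'a::euclidean_space \<Rightarrow> 'b::euclidean_space"
  assumes f: "continuous_on UNIV f" and A: "bounded A" "A \<in> sets borel"
  shows "L2 (lebesgue_on A) f" "(L2_norm (lebesgue_on A) f)\<^sup>2 = (LINT x:A|lborel. (norm (f x))\<^sup>2)"
proof -
  have fb [measurable]: "f \<in> borel_measurable borel" using f by (rule borel_measurable_continuous_onI)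
  have "set_integrable lborel A (\<lambda>x. (norm (f x))\<^sup>2)"
    by (intro set_integrable_continuous_bounded A continuous_intros f)
  then have "integrable lborel (\<lambda>x. indicator A x *\<^sub>R (norm (f x))\<^sup>2)" by (simp add: set_integrable_def)
  then have "integrable lebesgue (\<lambda>x. indicator A x *\<^sub>R (norm (f x))\<^sup>2)"
    using A by (subst integrable_completion) (auto simp: borel_measurable_integrable)
  then have "integrable (lebesgue_on A) (\<lambda>x. (norm (f x))\<^sup>2)"
    using A by (subst integrable_restrict_space) auto
  moreover have "f \<in> borel_measurable (lebesgue_on A)"
    by (intro measurable_restrict_space1 measurable_completion) simp
  ultimately show "L2 (lebesgue_on A) f" by (simp add: L2_def)
  show "(L2_norm (lebesgue_on A) f)\<^sup>2 = (LINT x:A|lborel. (norm (f x))\<^sup>2)"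
    unfolding L2_norm_power2 using A
    by (simp add: integral_lebesgue_on_eq_lborel)
qed

text \<open>Tonelli's theorem for a first factor that need not be sigma-finite: weighting it with the
  inner integral \<open>\<phi>\<close> turns it into a finite measure.\<close>

lemma nn_integral_swap_le:
  fixes f :: "'a \<times> 'b \<Rightarrow> ennreal"
  assumes P: "sigma_finite_measure P" and f: "f \<in> borel_measurable (N \<Otimes>\<^sub>M P)"
    and fin: "(\<integral>\<^sup>+z. f z \<partial>(N \<Otimes>\<^sub>M P)) < \<infinity>"
    and zero: "\<And>x t. x \<in> space N \<Longrightarrow> t \<in> space P \<Longrightarrow> (\<integral>\<^sup>+t. f (x, t) \<partial>P) = 0 \<Longrightarrow> f (x, t) = 0"
  shows "(\<integral>\<^sup>+t. \<integral>\<^sup>+x. f (x, t) \<partial>N \<partial>P) \<le> (\<integral>\<^sup>+z. f z \<partial>(N \<Otimes>\<^sub>M P))"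
proof -
  interpret P: sigma_finite_measure P by fact
  define \<phi> where "\<phi> x = (\<integral>\<^sup>+t. f (x, t) \<partial>P)" for x
  have \<phi> [measurable]: "\<phi> \<in> borel_measurable N"
    unfolding \<phi>_def[abs_def] by (rule P.borel_measurable_nn_integral_fst[OF f])
  have int: "(\<integral>\<^sup>+x. \<phi> x \<partial>N) = (\<integral>\<^sup>+z. f z \<partial>(N \<Otimes>\<^sub>M P))"
    unfolding \<phi>_def by (rule P.nn_integral_fst[OF f])
  let ?D = "density N \<phi>"
  have "emeasure ?D (space ?D) < \<infinity>"
    using fin unfolding int[symmetric] by (simp add: emeasure_density cong: nn_integral_cong)
  then interpret D: finite_measure ?D by (intro finite_measureI) simp
  interpret PD: pair_sigma_finite ?D P ..
  have AEfin: "AE x in N. \<phi> x \<noteq> \<infinity>"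
    using fin unfolding int[symmetric] by (intro nn_integral_PInf_AE) auto
  have f' [measurable]: "(\<lambda>x. f (x, t)) \<in> borel_measurable N" if "t \<in> space P" for t
    using f that by simp
  have "(\<integral>\<^sup>+x. f (x, t) \<partial>N) = (\<integral>\<^sup>+x. f (x, t) / \<phi> x \<partial>?D)" if t: "t \<in> space P" for t
  proof -
    have "(\<integral>\<^sup>+x. f (x, t) / \<phi> x \<partial>?D) = (\<integral>\<^sup>+x. \<phi> x * (f (x, t) / \<phi> x) \<partial>N)"
      using f'[OF t] by (subst nn_integral_density) auto
    also have "\<dots> = (\<integral>\<^sup>+x. f (x, t) \<partial>N)"
    proof (rule nn_integral_cong_AE)
      \<comment> \<open>The cancellation could fail where \<open>\<phi>\<close> is 0 or infinite:
        the first case is covered by \<open>zero\<close>, the second occurs only on a null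
        set.\<close>
      show "AE x in N. \<phi> x * (f (x, t) / \<phi> x) = f (x, t)"
        using AEfin AE_space
      proof eventually_elim
        case (elim x)
        show ?case
        proof (cases "\<phi> x = 0")
          case True
          then have "f (x, t) = 0" using zero[OF elim(2) t] by (simp add: \<phi>_def)
          then show ?thesis by simp
        next
          case False
          then show ?thesis
            using elim(1) by (simp add: ennreal_times_divide mult_divide_eq_ennreal mult.commute[of "\<phi> x"])
        qed
      qed
    qed
    finally show ?thesis by simp
  qed
  then have "(\<integral>\<^sup>+t. \<integral>\<^sup>+x. f (x, t) \<partial>N \<partial>P) = (\<integral>\<^sup>+t. \<integral>\<^sup>+x. f (x, t) / \<phi> x \<partial>?D \<partial>P)"
    by (rule nn_integral_cong)
  also have "\<dots> = (\<integral>\<^sup>+x. \<integral>\<^sup>+t. f (x, t) / \<phi> x \<partial>P \<partial>?D)"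
  proof -
    have "sets (?D \<Otimes>\<^sub>M P) = sets (N \<Otimes>\<^sub>M P)" by (intro sets_pair_measure_cong) auto
    then have "f \<in> borel_measurable (?D \<Otimes>\<^sub>M P)" using f by (simp cong: measurable_cong_sets)
    then have "(\<lambda>z. f z / \<phi> (fst z)) \<in> borel_measurable (?D \<Otimes>\<^sub>M P)" by measurable
    from PD.Fubini[OF this] show ?thesis by simp
  qed
  also have "\<dots> = (\<integral>\<^sup>+x. \<phi> x / \<phi> x \<partial>?D)"
  proof (rule nn_integral_cong)
    fix x assume x: "x \<in> space ?D"
    then have "(\<lambda>t. f (x, t)) \<in> borel_measurable P" using f by simp
    then show "(\<integral>\<^sup>+t. f (x, t) / \<phi> x \<partial>P) = \<phi> x / \<phi> x"
      unfolding divide_ennreal_def \<phi>_def[of x] by (rule nn_integral_multc)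
  qed
  also have "\<dots> \<le> (\<integral>\<^sup>+x. 1 \<partial>?D)"
  proof (rule nn_integral_mono)
    \<comment> \<open>Only an inequality: in \<open>ennreal\<close> this quotient is 0 when
      \<open>\<phi> x\<close> is 0 or infinite.\<close>
    show "\<phi> x / \<phi> x \<le> 1" for x
      by (cases "\<phi> x" rule: ennreal_cases; cases "\<phi> x = 0")
        (auto simp: divide_ennreal ennreal_top_divide)
  qed
  also have "\<dots> = (\<integral>\<^sup>+x. \<phi> x \<partial>N)"
    by (subst nn_integral_density) auto
  finally show ?thesis unfolding int .
qed

text \<open>Puts the frontier integral inside, where the boundary estimate at a fixed time can use
  it. The condition \<open>zero\<close> of \<open>nn_integral_swap_le\<close> holds because the
  times at which \<open>v (x, t)\<close> is nonzero form an open set, and an open null set is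
  empty.\<close>

lemma nn_integral_lateral_swap:
  fixes v :: "'a::euclidean_space \<times> real \<Rightarrow> real"
  assumes v: "continuous_on UNIV v" and L2: "L2 (lateral_measure \<Omega> T) v"
  shows "(\<integral>\<^sup>+t\<in>{0<..<T}. (\<integral>\<^sup>+x\<in>frontier \<Omega>. ennreal ((v (x, t))\<^sup>2) \<partial>hausdorff_measure (DIM('a) - 1)) \<partial>lborel)
    \<le> ennreal ((L2_norm (lateral_measure \<Omega> T) v)\<^sup>2)"
proof -
  let ?N = "surface_measure \<Omega>" and ?P = "restrict_space lborel {0<..<T}"
  have P: "sigma_finite_measure ?P"
    by (intro sigma_finite_measure_restrict_space sigma_finite_lborel) auto
  have spP: "space ?P = {0<..<T}" by (simp add: space_restrict_space)
  have id: "(\<lambda>x. x) \<in> measurable ?N borel" "(\<lambda>x. x) \<in> measurable ?P borel"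
    unfolding surface_measure_def
    by (rule measurable_restrict_space1, rule measurable_ident_sets, simp)+
  have "(\<lambda>z. (fst z, snd z)) \<in> measurable (?N \<Otimes>\<^sub>M ?P) (borel \<Otimes>\<^sub>M borel)"
    by (intro measurable_Pair measurable_compose[OF measurable_fst id(1)] measurable_compose[OF measurable_snd id(2)])
  then have "v \<in> borel_measurable (?N \<Otimes>\<^sub>M ?P)"
    using measurable_compose[OF _ borel_measurable_continuous_onI[OF v], of "\<lambda>z. (fst z, snd z)"]
    by (simp add: borel_prod)
  then have f: "(\<lambda>z. ennreal ((v z)\<^sup>2)) \<in> borel_measurable (?N \<Otimes>\<^sub>M ?P)" by measurable
  have eq: "(\<integral>\<^sup>+z. ennreal ((v z)\<^sup>2) \<partial>(?N \<Otimes>\<^sub>M ?P)) = ennreal ((L2_norm (lateral_measure \<Omega> T) v)\<^sup>2)"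
    using nn_integral_L2[OF L2] by (simp add: lateral_measure_def nn_integral_completion)
  have "(\<integral>\<^sup>+t. \<integral>\<^sup>+x. ennreal ((v (x, t))\<^sup>2) \<partial>?N \<partial>?P) \<le> (\<integral>\<^sup>+z. ennreal ((v z)\<^sup>2) \<partial>(?N \<Otimes>\<^sub>M ?P))"
  proof (rule nn_integral_swap_le[OF P f])
    show "(\<integral>\<^sup>+z. ennreal ((v z)\<^sup>2) \<partial>(?N \<Otimes>\<^sub>M ?P)) < \<infinity>" unfolding eq by simp
    fix x t assume t: "t \<in> space ?P" and 0: "(\<integral>\<^sup>+t. ennreal ((v (x, t))\<^sup>2) \<partial>?P) = 0"
    have c: "continuous_on UNIV (\<lambda>t. v (x, t))"
      by (rule continuous_on_compose2[OF v]) (auto intro!: continuous_intros)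
    then have [measurable]: "(\<lambda>t. v (x, t)) \<in> borel_measurable borel" by (rule borel_measurable_continuous_onI)
    have "(\<integral>\<^sup>+t. ennreal ((v (x, t))\<^sup>2) * indicator {0<..<T} t \<partial>lborel) = 0"
      using 0 by (subst (asm) nn_integral_restrict_space) auto
    then have "AE t in lborel. ennreal ((v (x, t))\<^sup>2) * indicator {0<..<T} t = 0"
      by (subst (asm) nn_integral_0_iff_AE) auto
    then have AE: "AE t in lborel. t \<notin> {0<..<T} \<inter> {t. v (x, t) \<noteq> 0}"
      by eventually_elim (auto split: split_indicator_asm)
    have op: "open ({0<..<T} \<inter> {t. v (x, t) \<noteq> 0})"
      by (intro open_Int open_Collect_neq c) auto
    then have "{0<..<T} \<inter> {t. v (x, t) \<noteq> 0} \<in> null_sets lborel"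
      using AE by (subst AE_iff_null_sets) auto
    then have "negligible ({0<..<T} \<inter> {t. v (x, t) \<noteq> 0})"
      by (simp add: negligible_iff_null_sets null_sets_completionI)
    with op have "{0<..<T} \<inter> {t. v (x, t) \<noteq> 0} = {}"
      using open_not_negligible by blast
    then show "ennreal ((v (x, t))\<^sup>2) = 0" using t spP by auto
  qed
  moreover have "(\<integral>\<^sup>+x. ennreal ((v (x, t))\<^sup>2) \<partial>?N)
      = (\<integral>\<^sup>+x\<in>frontier \<Omega>. ennreal ((v (x, t))\<^sup>2) \<partial>hausdorff_measure (DIM('a) - 1))" for t
    unfolding surface_measure_def by (subst nn_integral_restrict_space) auto
  ultimately show ?thesis
    unfolding eq by (subst (asm) nn_integral_restrict_space[of _ lborel]) auto
qed

lemma set_integral_Ioo_eq_Icc: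
  fixes f :: "real \<Rightarrow> real"
  assumes "set_integrable lborel {a..b} f"
  shows "(LINT t:{a<..<b}|lborel. f t) = (LINT t:{a..b}|lborel. f t)"
proof -
  have m: "(\<lambda>t. indicator {a..b} t *\<^sub>R f t) \<in> borel_measurable lborel"
    using assms by (simp add: set_integrable_def borel_measurable_integrable)
  have "(\<lambda>t. indicator {a<..<b} t *\<^sub>R (indicator {a..b} t *\<^sub>R f t)) \<in> borel_measurable lborel"
    by (intro borel_measurable_scaleR m) auto
  moreover have "indicator {a<..<b} t *\<^sub>R (indicator {a..b} t *\<^sub>R f t) = indicator {a<..<b} t *\<^sub>R f t" for t
    by (auto split: split_indicator)
  ultimately have m': "(\<lambda>t. indicator {a<..<b} t *\<^sub>R f t) \<in> borel_measurable lborel" by (simp only:)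
  have "AE t in lborel. indicator {a<..<b} t *\<^sub>R f t = indicator {a..b} t *\<^sub>R f t"
    using AE_lborel_singleton[of a] AE_lborel_singleton[of b]
    by eventually_elim (auto split: split_indicator)
  then show ?thesis
    unfolding set_lebesgue_integral_def by (intro integral_cong_AE m m')
qed

lemma set_integral_mono_set:
  fixes f :: "'a \<Rightarrow> real"
  assumes "set_integrable M B f" "A \<subseteq> B" "A \<in> sets M" "\<And>x. 0 \<le> f x"
  shows "(LINT x:A|M. f x) \<le> (LINT x:B|M. f x)"
proof -
  have "set_integrable M A f" by (rule set_integrable_subset) (use assms in auto)
  then show ?thesis
    using assms unfolding set_lebesgue_integral_def set_integrable_def
    by (intro integral_mono) (auto split: split_indicator)
qed

text \<open>The slab may reach the times 0 and \<open>T\<close>, which the open cylinder omits;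
  therefore the time integral is restricted to the open interval before the domain is
  enlarged.\<close>

lemma cylinder_cauchy_schwarz:
  fixes \<Omega> :: "'a::euclidean_space set" and v f :: "'a \<times> real \<Rightarrow> real"
  assumes \<Omega>: "open \<Omega>" "bounded \<Omega>" and v: "continuous_on UNIV v" and f: "continuous_on UNIV f"
    and ab: "0 \<le> a" "a \<le> b" "b \<le> T"
  shows "(LINT z:\<Omega> \<times> {a..b}|lborel. \<bar>v z\<bar> * \<bar>f z\<bar>)
    \<le> L2_norm (lebesgue_on (cylinder \<Omega> T)) v * L2_norm (lebesgue_on (cylinder \<Omega> T)) f"
proof -
  let ?C = "\<Omega> \<times> {0<..<T}" and ?h = "\<lambda>z. \<bar>v z\<bar> * \<bar>f z\<bar>"
  have ch: "continuous_on UNIV ?h" by (intro continuous_intros v f)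
  have Om: "\<Omega> \<in> sets borel" using \<Omega> by simp
  have C: "bounded ?C" "?C \<in> sets borel" using \<Omega> Om by (auto simp: bounded_Times borel_Times)
  have "(LINT z:\<Omega> \<times> {a..b}|lborel. ?h z) = (LINT t:{a..b}|lborel. LINT x:\<Omega>|lborel. ?h (x, t))"
    using product_integral_continuous(3)[OF ch, of \<Omega> "{a..b}"] \<Omega> Om by simp
  also have "\<dots> = (LINT t:{a<..<b}|lborel. LINT x:\<Omega>|lborel. ?h (x, t))"
    using product_integral_continuous(2)[OF ch, of \<Omega> "{a..b}"] \<Omega> Om
    by (intro set_integral_Ioo_eq_Icc[symmetric]) simp
  also have "\<dots> \<le> (LINT t:{0<..<T}|lborel. LINT x:\<Omega>|lborel. ?h (x, t))"
    using product_integral_continuous(2)[OF ch, of \<Omega> "{0<..<T}"] \<Omega> Om ab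
    by (intro set_integral_mono_set) (auto simp: set_lebesgue_integral_def intro!: integral_nonneg)
  also have "\<dots> = (LINT z:?C|lborel. ?h z)"
    using product_integral_continuous(3)[OF ch, of \<Omega> "{0<..<T}"] \<Omega> Om by simp
  also have "\<dots> = (\<integral>z. ?h z \<partial>lebesgue_on ?C)"
    using C by (intro integral_lebesgue_on_eq_lborel[symmetric] borel_measurable_continuous_onI ch)
  also have "\<dots> \<le> L2_norm (lebesgue_on ?C) v * L2_norm (lebesgue_on ?C) f"
    using L2_cauchy_schwarz(2)[OF L2_continuous_bounded(1)[OF v C] L2_continuous_bounded(1)[OF f C]]
    by simp
  finally show ?thesis by (simp add: cylinder_def)
qed

text \<open>With \<open>w\<close> the affine weight and \<open>f\<close> the residual, inserting
  \<open>\<partial>\<^sub>t v = f - H \<bullet> \<nabla> v\<close> leaves a source term, the term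
  \<open>(H t \<bullet> p) * (v (x, t))\<^sup>2\<close>, and partial derivatives of
  \<open>w * v\<^sup>2\<close> with coefficients \<open>H t \<bullet> i\<close>. These depend on
  time only and leave the space integral, so \<open>integral_partial_derivative_le_frontier\<close>
  applies at each time.\<close>

lemma energy_inequality:
  fixes \<Omega> :: "'a::euclidean_space set" and v :: "'a \<times> real \<Rightarrow> real" and H :: "real \<Rightarrow> 'a"
  assumes \<Omega>: "open \<Omega>" "bounded \<Omega>" and v: "Ck (Suc 0) v"
    and H: "continuous_on UNIV H" and Hm: "\<And>t. norm (H t) \<le> Hm"
    and ab: "0 \<le> a" "a \<le> b" "b \<le> T" and K: "0 \<le> K"
    and \<phi>: "\<And>x. x \<in> \<Omega> \<Longrightarrow> 0 \<le> x \<bullet> p + c" "\<And>x. x \<in> \<Omega> \<Longrightarrow> x \<bullet> p + c \<le> K"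
    and L2: "L2 (lateral_measure \<Omega> T) v"
  shows "\<bar>(LINT x:\<Omega>|lborel. (x \<bullet> p + c) * (v (x, b))\<^sup>2) - (LINT x:\<Omega>|lborel. (x \<bullet> p + c) * (v (x, a))\<^sup>2)
      - (LINT t:{a..b}|lborel. (H t \<bullet> p) * (LINT x:\<Omega>|lborel. (v (x, t))\<^sup>2))\<bar>
    \<le> 2 * K * (L2_norm (lebesgue_on (cylinder \<Omega> T)) v
        * L2_norm (lebesgue_on (cylinder \<Omega> T)) (\<lambda>z. snd (gradient v z) + H (snd z) \<bullet> fst (gradient v z)))
      + real DIM('a) * (Hm * (sweep_const TYPE('a) * K * (L2_norm (lateral_measure \<Omega> T) v)\<^sup>2))"
proof -
  let ?G = "gradient v" and ?Q = "\<Omega> \<times> {a..b}"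
  define f where "f z = snd (?G z) + H (snd z) \<bullet> fst (?G z)" for z
  define w where "w z = fst z \<bullet> p + c" for z :: "'a \<times> real"
  \<comment> \<open>\<open>P i\<close> is the spatial partial derivative of
    \<open>w * v\<^sup>2\<close> in direction \<open>i\<close>; \<open>p \<bullet> i\<close> is that
    of \<open>w\<close>.\<close>
  define P where "P i z = (p \<bullet> i) * (v z)\<^sup>2 + w z * (2 * v z * (fst (?G z) \<bullet> i))" for i z
  define J where "J i t = (LINT x:\<Omega>|lborel. P i (x, t))" for i t
  note cv = C1_facts(3)[OF v] and cG = C1_facts(2)[OF v]
  have cH: "continuous_on UNIV (\<lambda>z. H (snd z))"
    by (rule continuous_on_compose2[OF H]) (auto intro!: continuous_intros)
  have cw: "continuous_on UNIV w" unfolding w_def[abs_def] by (intro continuous_intros)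
  have cf: "continuous_on UNIV f" unfolding f_def[abs_def] by (intro continuous_intros cG cH)
  have cP: "continuous_on UNIV (P i)" for i unfolding P_def[abs_def] by (intro continuous_intros cG cv cw)
  have Om: "\<Omega> \<in> sets borel" using \<Omega> by simp
  have Q: "bounded ?Q" "?Q \<in> sets borel"
    using \<Omega> Om by (auto simp: bounded_Times borel_Times)
  note si = set_integrable_continuous_bounded
  have split: "w z * (2 * v z * snd (?G z))
      = 2 * w z * v z * f z - (\<Sum>i\<in>Basis. (H (snd z) \<bullet> i) * P i z) + (H (snd z) \<bullet> p) * (v z)\<^sup>2" for z
  proof -
    have "(\<Sum>i\<in>Basis. (H (snd z) \<bullet> i) * P i z)
        = (\<Sum>i\<in>Basis. (H (snd z) \<bullet> i) * (p \<bullet> i)) * (v z)\<^sup>2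
          + w z * (2 * v z) * (\<Sum>i\<in>Basis. (H (snd z) \<bullet> i) * (fst (?G z) \<bullet> i))"
      unfolding P_def by (simp add: sum_distrib_left sum_distrib_right sum.distrib[symmetric] algebra_simps)
    also have "\<dots> = (H (snd z) \<bullet> p) * (v z)\<^sup>2 + w z * (2 * v z) * (H (snd z) \<bullet> fst (?G z))"
      unfolding euclidean_inner[symmetric] ..
    finally show ?thesis by (simp add: f_def algebra_simps)
  qed
  have "(LINT x:\<Omega>|lborel. w (x, b) * (v (x, b))\<^sup>2) - (LINT x:\<Omega>|lborel. w (x, a) * (v (x, a))\<^sup>2)
      = (LINT z:?Q|lborel. w z * (2 * v z * snd (?G z)))"
  proof (rule time_derivative_integral)
    show "((\<lambda>t. w (x, t) * (v (x, t))\<^sup>2) has_real_derivative w (x, t) * (2 * v (x, t) * snd (?G (x, t)))) (at t)" for x t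
      unfolding w_def by (auto intro!: derivative_eq_intros C1_line_derivatives(1)[OF v])
  qed (use \<Omega> Om ab in \<open>auto intro!: continuous_intros cv cG cw\<close>)
  also have "\<dots> = (LINT z:?Q|lborel. 2 * w z * v z * f z - (\<Sum>i\<in>Basis. (H (snd z) \<bullet> i) * P i z) + (H (snd z) \<bullet> p) * (v z)\<^sup>2)"
    unfolding split ..
  also have "\<dots> = (LINT z:?Q|lborel. 2 * w z * v z * f z) - (LINT z:?Q|lborel. (\<Sum>i\<in>Basis. (H (snd z) \<bullet> i) * P i z))
      + (LINT z:?Q|lborel. (H (snd z) \<bullet> p) * (v z)\<^sup>2)"
    by ((subst set_integral_add(2) set_integral_diff(2);
        (intro si Q set_integral_diff(1) continuous_intros cv cG cw cf cP cH)?)+, rule refl)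
  also have "(LINT z:?Q|lborel. (\<Sum>i\<in>Basis. (H (snd z) \<bullet> i) * P i z)) = (\<Sum>i\<in>Basis. LINT z:?Q|lborel. (H (snd z) \<bullet> i) * P i z)"
  proof -
    have "integrable lborel (\<lambda>z. indicator ?Q z *\<^sub>R ((H (snd z) \<bullet> i) * P i z))" for i
      unfolding set_integrable_def[symmetric] by (intro si Q continuous_intros cP cH)
    then show ?thesis
      unfolding set_lebesgue_integral_def scaleR_sum_right by (intro Bochner_Integration.integral_sum)
  qed
  also have "(LINT z:?Q|lborel. (H (snd z) \<bullet> p) * (v z)\<^sup>2) = (LINT t:{a..b}|lborel. (H t \<bullet> p) * (LINT x:\<Omega>|lborel. (v (x, t))\<^sup>2))"
  proof -
    have "continuous_on UNIV (\<lambda>z. (H (snd z) \<bullet> p) * (v z)\<^sup>2)" by (intro continuous_intros cH cv)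
    from product_integral_continuous(3)[OF this, of \<Omega> "{a..b}"] show ?thesis
      using \<Omega> Om by simp
  qed
  finally have id: "(LINT x:\<Omega>|lborel. w (x, b) * (v (x, b))\<^sup>2) - (LINT x:\<Omega>|lborel. w (x, a) * (v (x, a))\<^sup>2)
      - (LINT t:{a..b}|lborel. (H t \<bullet> p) * (LINT x:\<Omega>|lborel. (v (x, t))\<^sup>2))
      = (LINT z:?Q|lborel. 2 * w z * v z * f z) - (\<Sum>i\<in>Basis. LINT z:?Q|lborel. (H (snd z) \<bullet> i) * P i z)"
    by simp
  have A1: "\<bar>LINT z:?Q|lborel. 2 * w z * v z * f z\<bar>
      \<le> 2 * K * (L2_norm (lebesgue_on (cylinder \<Omega> T)) v * L2_norm (lebesgue_on (cylinder \<Omega> T)) f)"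
  proof -
    let ?h = "\<lambda>z. \<bar>v z\<bar> * \<bar>f z\<bar>"
    have "set_integrable lborel ?Q (\<lambda>z. 2 * w z * v z * f z)"
      by (intro si Q continuous_intros cv cw cf)
    from set_integral_norm_bound[OF this]
    have "\<bar>LINT z:?Q|lborel. 2 * w z * v z * f z\<bar> \<le> (LINT z:?Q|lborel. \<bar>2 * w z * v z * f z\<bar>)"
      by simp
    also have "\<dots> \<le> (LINT z:?Q|lborel. 2 * K * ?h z)"
    proof (rule set_integral_mono)
      fix z assume "z \<in> ?Q"
      then have "\<bar>w z\<bar> \<le> K" using \<phi>[of "fst z"] by (auto simp: w_def)
      then have "2 * \<bar>w z\<bar> * ?h z \<le> 2 * K * ?h z" by (intro mult_right_mono) auto
      then show "\<bar>2 * w z * v z * f z\<bar> \<le> 2 * K * ?h z" by (simp add: abs_mult mult.assoc)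
    qed (auto intro!: si Q continuous_intros cv cw cf)
    also have "\<dots> = 2 * K * (LINT z:?Q|lborel. ?h z)" by simp
    also have "\<dots> \<le> 2 * K * (L2_norm (lebesgue_on (cylinder \<Omega> T)) v * L2_norm (lebesgue_on (cylinder \<Omega> T)) f)"
      using K by (intro mult_left_mono cylinder_cauchy_schwarz \<Omega> cv cf ab) auto
    finally show ?thesis .
  qed
  let ?B = "\<lambda>t. \<integral>\<^sup>+x\<in>frontier \<Omega>. ennreal ((v (x, t))\<^sup>2) \<partial>hausdorff_measure (DIM('a) - 1)"
  let ?S = "sweep_const TYPE('a) * K"
  have S: "0 \<le> ?S" using sweep_const_nonneg[where 'a='a] K by simp
  have Jle: "ennreal \<bar>J i t\<bar> \<le> ennreal ?S * ?B t" if i: "i \<in> Basis" for i t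
  proof -
    have "ennreal \<bar>J i t\<bar> \<le> ennreal (sweep_const TYPE('a)) *
        (\<integral>\<^sup>+x\<in>frontier \<Omega>. ennreal (w (x, t) * (v (x, t))\<^sup>2) \<partial>hausdorff_measure (DIM('a) - 1))"
      unfolding J_def
    proof (rule integral_partial_derivative_le_frontier[OF i \<Omega>])
      show "continuous_on UNIV (\<lambda>x. w (x, t) * (v (x, t))\<^sup>2)" "continuous_on UNIV (\<lambda>x. P i (x, t))"
        by (intro continuous_intros continuous_on_slice cw cv cP)+
      show "((\<lambda>s. w (x + s *\<^sub>R i, t) * (v (x + s *\<^sub>R i, t))\<^sup>2) has_real_derivative P i (x + s *\<^sub>R i, t)) (at s)" for x s
      proof -
        have "((\<lambda>s. w (x + s *\<^sub>R i, t)) has_real_derivative p \<bullet> i) (at s)"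
          unfolding w_def inner_commute[of p]
          by (auto intro!: derivative_eq_intros simp: inner_add_left)
        then show ?thesis
          unfolding P_def by (auto intro!: derivative_eq_intros C1_line_derivatives(2)[OF v])
      qed
      show "0 \<le> w (x, t) * (v (x, t))\<^sup>2" if "x \<in> \<Omega>" for x
        using \<phi>(1)[OF that] by (simp add: w_def)
    qed
    also have "\<dots> \<le> ennreal (sweep_const TYPE('a)) * (\<integral>\<^sup>+x. ennreal K * (ennreal ((v (x, t))\<^sup>2) * indicator (frontier \<Omega>) x)
        \<partial>hausdorff_measure (DIM('a) - 1))"
    proof (intro mult_left_mono nn_integral_mono)
      fix x
      \<comment> \<open>The upper bound of the weight is assumed on \<open>\<Omega>\<close> only and
        passes to the frontier by closedness.\<close>
      have "closed {x. x \<bullet> p + c \<le> K}" by (intro closed_Collect_le continuous_intros)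
      then have "closure \<Omega> \<subseteq> {x. x \<bullet> p + c \<le> K}" using \<phi>(2) by (intro closure_minimal) auto
      then have "w (x, t) \<le> K" if "x \<in> frontier \<Omega>"
        using that by (auto simp: w_def frontier_def)
      then have "ennreal (w (x, t) * (v (x, t))\<^sup>2) \<le> ennreal (K * (v (x, t))\<^sup>2)" if "x \<in> frontier \<Omega>"
        using that by (intro ennreal_leI mult_right_mono) auto
      then show "ennreal (w (x, t) * (v (x, t))\<^sup>2) * indicator (frontier \<Omega>) x
          \<le> ennreal K * (ennreal ((v (x, t))\<^sup>2) * indicator (frontier \<Omega>) x)"
        using K by (auto split: split_indicator simp: ennreal_mult)
    qed simp
    also have "\<dots> = ennreal ?S * ?B t"
    proof -
      have [measurable]: "(\<lambda>x. v (x, t)) \<in> borel_measurable borel"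
        by (intro borel_measurable_continuous_onI continuous_on_slice cv)
      have [measurable]: "frontier \<Omega> \<in> sets borel" by simp
      have "(\<lambda>x. ennreal ((v (x, t))\<^sup>2) * indicator (frontier \<Omega>) x)
          \<in> borel_measurable (hausdorff_measure (DIM('a) - 1))" by measurable
      then show ?thesis
        using K by (subst nn_integral_cmult) (auto simp: ennreal_mult sweep_const_nonneg mult.assoc)
    qed
    finally show ?thesis .
  qed
  have A2: "\<bar>LINT z:?Q|lborel. (H (snd z) \<bullet> i) * P i z\<bar> \<le> Hm * (?S * (L2_norm (lateral_measure \<Omega> T) v)\<^sup>2)"
    if i: "i \<in> Basis" for i
  proof -
    have Jint: "set_integrable lborel {a..b} (J i)"
      unfolding J_def using \<Omega> Om by (intro product_integral_continuous(2) cP) auto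
    then have Jabs: "set_integrable lborel {a..b} (\<lambda>t. \<bar>J i t\<bar>)" by (rule set_integrable_abs)
    have cHP: "continuous_on UNIV (\<lambda>z. (H (snd z) \<bullet> i) * P i z)" by (intro continuous_intros cH cP)
    have HJ: "(LINT z:?Q|lborel. (H (snd z) \<bullet> i) * P i z) = (LINT t:{a..b}|lborel. (H t \<bullet> i) * J i t)"
      using product_integral_continuous(3)[OF cHP, of \<Omega> "{a..b}"] \<Omega> Om by (simp add: J_def)
    have HJint: "set_integrable lborel {a..b} (\<lambda>t. (H t \<bullet> i) * J i t)"
      using product_integral_continuous(2)[OF cHP, of \<Omega> "{a..b}"] \<Omega> Om by (simp add: J_def)
    have Hi: "\<bar>H t \<bullet> i\<bar> \<le> Hm" for t
      using Basis_le_norm[OF i, of "H t"] Hm[of t] by linarith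
    have "\<bar>LINT t:{a..b}|lborel. (H t \<bullet> i) * J i t\<bar> \<le> (LINT t:{a..b}|lborel. \<bar>(H t \<bullet> i) * J i t\<bar>)"
      using set_integral_norm_bound[OF HJint] by simp
    also have "\<dots> \<le> (LINT t:{a..b}|lborel. Hm * \<bar>J i t\<bar>)"
    proof (rule set_integral_mono)
      show "set_integrable lborel {a..b} (\<lambda>t. \<bar>(H t \<bullet> i) * J i t\<bar>)" by (rule set_integrable_abs[OF HJint])
      show "set_integrable lborel {a..b} (\<lambda>t. Hm * \<bar>J i t\<bar>)" using Jabs by simp
      show "\<bar>(H t \<bullet> i) * J i t\<bar> \<le> Hm * \<bar>J i t\<bar>" for t
        unfolding abs_mult by (intro mult_right_mono Hi) auto
    qed
    also have "\<dots> = Hm * (LINT t:{a<..<b}|lborel. \<bar>J i t\<bar>)"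
      using set_integral_Ioo_eq_Icc[OF Jabs] by simp
    finally have le1: "\<bar>LINT z:?Q|lborel. (H (snd z) \<bullet> i) * P i z\<bar> \<le> Hm * (LINT t:{a<..<b}|lborel. \<bar>J i t\<bar>)"
      unfolding HJ .
    have Jabs': "set_integrable lborel {a<..<b} (\<lambda>t. \<bar>J i t\<bar>)"
      by (rule set_integrable_subset[OF Jabs]) auto
    have "(LINT t:{a<..<b}|lborel. \<bar>J i t\<bar>) \<le> ?S * (L2_norm (lateral_measure \<Omega> T) v)\<^sup>2"
    \<comment> \<open>\<open>?S\<close> vanishes only for \<open>K = 0\<close>. Otherwise it is
      moved to the left side, since \<open>?B\<close> is not known to be measurable in
      \<open>t\<close> and the factor could not be pulled out of its integral.\<close>
    proof (cases "?S = 0")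
      case True
      have "J i t = 0" for t using Jle[OF i, of t] unfolding True by (simp add: ennreal_eq_0_iff)
      then show ?thesis unfolding True by (simp add: set_lebesgue_integral_def)
    next
      case False
      then have S': "0 < ?S" using S by linarith
      have JS: "ennreal (\<bar>J i t\<bar> / ?S) \<le> ?B t" for t
      proof -
        have "ennreal \<bar>J i t\<bar> / ennreal ?S \<le> ?B t"
          using S' by (intro divide_le_posI_ennreal Jle[OF i]) auto
        then show ?thesis using S' by (simp add: divide_ennreal)
      qed
      have "ennreal (LINT t:{a<..<b}|lborel. \<bar>J i t\<bar> / ?S) = (\<integral>\<^sup>+t. ennreal (indicator {a<..<b} t *\<^sub>R (\<bar>J i t\<bar> / ?S)) \<partial>lborel)"
        unfolding set_lebesgue_integral_def
      proof (rule nn_integral_eq_integral[symmetric])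
        show "integrable lborel (\<lambda>t. indicator {a<..<b} t *\<^sub>R (\<bar>J i t\<bar> / ?S))"
          using set_integrable_divide[OF Jabs', of ?S] by (simp add: set_integrable_def)
      qed (use S' in auto)
      also have "\<dots> \<le> (\<integral>\<^sup>+t\<in>{0<..<T}. ?B t \<partial>lborel)"
      proof (rule nn_integral_mono)
        fix t
        show "ennreal (indicator {a<..<b} t *\<^sub>R (\<bar>J i t\<bar> / ?S)) \<le> ?B t * indicator {0<..<T} t"
          using JS[of t] ab by (cases "t \<in> {a<..<b}") auto
      qed
      also have "\<dots> \<le> ennreal ((L2_norm (lateral_measure \<Omega> T) v)\<^sup>2)"
        by (rule nn_integral_lateral_swap[OF cv L2])
      finally have "(LINT t:{a<..<b}|lborel. \<bar>J i t\<bar> / ?S) \<le> (L2_norm (lateral_measure \<Omega> T) v)\<^sup>2"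
        by (subst (asm) ennreal_le_iff) auto
      then show ?thesis using S' by (simp add: pos_divide_le_eq mult.commute)
    qed
    then have "Hm * (LINT t:{a<..<b}|lborel. \<bar>J i t\<bar>) \<le> Hm * (?S * (L2_norm (lateral_measure \<Omega> T) v)\<^sup>2)"
      using Hm[of 0] norm_ge_zero[of "H 0"] by (intro mult_left_mono) linarith+
    with le1 show ?thesis by linarith
  qed
  have "\<bar>\<Sum>i\<in>Basis. LINT z:?Q|lborel. (H (snd z) \<bullet> i) * P i z\<bar> \<le> (\<Sum>i\<in>Basis. \<bar>LINT z:?Q|lborel. (H (snd z) \<bullet> i) * P i z\<bar>)"
    by (rule sum_abs)
  also have "\<dots> \<le> real DIM('a) * (Hm * (?S * (L2_norm (lateral_measure \<Omega> T) v)\<^sup>2))"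
    by (rule sum_bounded_above) (rule A2)
  finally show ?thesis
    using A1 unfolding f_def[abs_def, symmetric]
    by (simp add: id[unfolded w_def fst_conv] w_def)
qed

text \<open>Trace inequality in time: the energies at two times differ by at most twice the product
  of the norms of \<open>v\<close> and its time derivative, and averaging over the second time
  brings in the cylinder norm. The norm of \<open>v\<close> stays in front as a factor, so slices
  become small when \<open>v\<close> does and its gradient is merely bounded.\<close>

lemma time_slice_estimate:
  fixes \<Omega> :: "'a::euclidean_space set" and v :: "'a \<times> real \<Rightarrow> real"
  assumes \<Omega>: "open \<Omega>" "bounded \<Omega>" and v: "Ck (Suc 0) v" and t: "0 \<le> t" "t \<le> T" and T: "0 < T"
  shows "T * (LINT x:\<Omega>|lborel. (v (x, t))\<^sup>2)
    \<le> L2_norm (lebesgue_on (cylinder \<Omega> T)) v * (L2_norm (lebesgue_on (cylinder \<Omega> T)) v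
      + 2 * T * L2_norm (lebesgue_on (cylinder \<Omega> T)) (gradient v))"
proof -
  note cv = C1_facts(3)[OF v] and cG = C1_facts(2)[OF v]
  let ?C = "\<Omega> \<times> {0<..<T}"
  define E where "E s = (LINT x:\<Omega>|lborel. (v (x, s))\<^sup>2)" for s
  define D where "D = L2_norm (lebesgue_on ?C) v * L2_norm (lebesgue_on ?C) (\<lambda>z. snd (gradient v z))"
  have Om: "\<Omega> \<in> sets borel" using \<Omega> by simp
  have C: "bounded ?C" "?C \<in> sets borel" using \<Omega> Om by (auto simp: bounded_Times borel_Times)
  have ct: "continuous_on UNIV (\<lambda>z. snd (gradient v z))" by (intro continuous_intros cG)
  have diff: "\<bar>E b - E a\<bar> \<le> 2 * D" if ab: "0 \<le> a" "a \<le> b" "b \<le> T" for a b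
  proof -
    let ?Q = "\<Omega> \<times> {a..b}"
    have Q: "bounded ?Q" "?Q \<in> sets borel" using \<Omega> Om by (auto simp: bounded_Times borel_Times)
    have "E b - E a = (LINT z:?Q|lborel. 2 * v z * snd (gradient v z))"
      unfolding E_def
    proof (rule time_derivative_integral)
      show "((\<lambda>t. (v (x, t))\<^sup>2) has_real_derivative 2 * v (x, t) * snd (gradient v (x, t))) (at t)" for x t
        by (auto intro!: derivative_eq_intros C1_line_derivatives(1)[OF v])
    qed (use \<Omega> Om ab in \<open>auto intro!: continuous_intros cv cG\<close>)
    also have "\<bar>\<dots>\<bar> \<le> (LINT z:?Q|lborel. \<bar>2 * v z * snd (gradient v z)\<bar>)"
    proof -
      have "set_integrable lborel ?Q (\<lambda>z. 2 * v z * snd (gradient v z))"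
        by (intro set_integrable_continuous_bounded Q continuous_intros cv ct)
      from set_integral_norm_bound[OF this] show ?thesis by simp
    qed
    also have "\<dots> = 2 * (LINT z:?Q|lborel. \<bar>v z\<bar> * \<bar>snd (gradient v z)\<bar>)"
      by (simp add: abs_mult mult.assoc)
    also have "\<dots> \<le> 2 * D"
      unfolding D_def using cylinder_cauchy_schwarz[OF \<Omega> cv ct ab] by (simp add: cylinder_def)
    finally show ?thesis .
  qed
  have c2: "continuous_on UNIV (\<lambda>z. (v z)\<^sup>2)" by (intro continuous_intros cv)
  have Eint: "set_integrable lborel {0<..<T} E"
    using product_integral_continuous(2)[OF c2, of \<Omega> "{0<..<T}"] \<Omega> Om by (simp add: E_def[abs_def])
  have const: "set_integrable lborel {0<..<T} (\<lambda>_. k)" for k :: real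
    by (intro set_integrable_continuous_bounded continuous_intros) auto
  have const_int: "(LINT s:{0<..<T}|lborel. k) = T * k" for k :: real
    using T by (simp add: set_lebesgue_integral_def)
  have "T * E t = (LINT s:{0<..<T}|lborel. E t)" by (rule const_int[symmetric])
  also have "\<dots> \<le> (LINT s:{0<..<T}|lborel. E s + 2 * D)"
  proof (rule set_integral_mono)
    fix s assume "s \<in> {0<..<T}"
    then show "E t \<le> E s + 2 * D"
      using diff[of s t] diff[of t s] t by (cases "s \<le> t") auto
  qed (auto intro!: const set_integral_add Eint)
  also have "\<dots> = (LINT s:{0<..<T}|lborel. E s) + T * (2 * D)"
    by (subst set_integral_add(2)[OF Eint const]) (simp add: const_int)
  also have "(LINT s:{0<..<T}|lborel. E s) = (L2_norm (lebesgue_on ?C) v)\<^sup>2"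
    using product_integral_continuous(3)[OF c2, of \<Omega> "{0<..<T}"] \<Omega> Om L2_continuous_bounded(2)[OF cv C]
    by (simp add: E_def)
  also have "T * (2 * D) \<le> T * (2 * (L2_norm (lebesgue_on ?C) v * L2_norm (lebesgue_on ?C) (gradient v)))"
  proof -
    have "L2_norm (lebesgue_on ?C) (\<lambda>z. snd (gradient v z)) \<le> 1 * L2_norm (lebesgue_on ?C) (gradient v)"
    proof (rule L2_mono(2)[OF L2_continuous_bounded(1)[OF cG C]])
      show "(\<lambda>z. snd (gradient v z)) \<in> borel_measurable (lebesgue_on ?C)"
        using L2_continuous_bounded(1)[OF ct C] by (simp add: L2_def)
      show "AE z in lebesgue_on ?C. norm (snd (gradient v z)) \<le> 1 * norm (gradient v z)"
        by (rule AE_I2) (metis norm_snd_le mult_1 prod.collapse)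
    qed simp
    then show ?thesis
      unfolding D_def using T by (intro mult_left_mono) (auto simp: L2_norm_nonneg)
  qed
  finally show ?thesis
    unfolding E_def cylinder_def by (simp add: algebra_simps power2_eq_square)
qed

text \<open>The first moment of the energy along \<open>\<eta>\<close> is at most the diameter times
  the energy, yet transport raises it at a rate of at least \<open>\<sigma>\<close> times the
  energy. After time \<open>b - a\<close> this is possible only if the energy is controlled by the
  source and boundary errors.\<close>

lemma smooth_observability:
  fixes \<Omega> :: "'a::euclidean_space set" and H :: "real \<Rightarrow> 'a"
  assumes \<Omega>: "open \<Omega>" "bounded \<Omega>" "\<Omega> \<noteq> {}"
    and H: "continuous_on UNIV H" and Hm: "\<And>t. norm (H t) \<le> Hm"
    and ab: "0 \<le> a" "a < b" "b \<le> T" and \<eta>: "norm \<eta> = 1" and \<sigma>: "0 < \<sigma>"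
    and dir: "\<And>t. t \<in> {a..b} \<Longrightarrow> \<sigma> \<le> H t \<bullet> \<eta>"
    and long: "diameter (closure \<Omega>) < \<sigma> * (b - a)"
  shows "\<exists>C>0. \<forall>v t. Ck (Suc 0) v \<longrightarrow> L2 (lateral_measure \<Omega> T) v \<longrightarrow> t \<in> {0..T} \<longrightarrow>
    (LINT x:\<Omega>|lborel. (v (x, t))\<^sup>2) \<le> C * (L2_norm (lebesgue_on (cylinder \<Omega> T)) v
      * L2_norm (lebesgue_on (cylinder \<Omega> T)) (\<lambda>z. snd (gradient v z) + H (snd z) \<bullet> fst (gradient v z))
      + (L2_norm (lateral_measure \<Omega> T) v)\<^sup>2)"
proof -
  define \<delta> where "\<delta> = diameter (closure \<Omega>)"
  define A where "A = real DIM('a) * (Hm * sweep_const TYPE('a))"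
  \<comment> \<open>With \<open>E\<close> the energy and \<open>D\<close> the error below, the
    argument ends in \<open>E t * (\<sigma> * (b - a) - \<delta>) \<le> (\<sigma> * (b - a) + 2 *
    \<delta>) * D\<close>, where \<open>D = 2 * V + A * B \<le> (2 + A) * (V + B)\<close>.\<close>
  define C where "C = (\<sigma> * (b - a) + 2 * \<delta>) / (\<sigma> * (b - a) - \<delta>) * (2 + A)"
  have cl: "compact (closure \<Omega>)" "closure \<Omega> \<noteq> {}" using \<Omega> by (auto simp: compact_closure)
  have \<delta>: "0 \<le> \<delta>" unfolding \<delta>_def using cl by (intro diameter_ge_0 compact_imp_bounded)
  have gap: "0 < \<sigma> * (b - a) - \<delta>" using long by (simp add: \<delta>_def)
  have Hm0: "0 \<le> Hm" using Hm[of 0] norm_ge_zero[of "H 0"] by linarith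
  have A: "0 \<le> A" unfolding A_def using Hm0 sweep_const_nonneg[where 'a='a] by simp
  have Cpos: "0 < C"
    unfolding C_def using gap \<delta> A by (intro mult_pos_pos divide_pos_pos) linarith+
  have "continuous_on (closure \<Omega>) (\<lambda>x. x \<bullet> \<eta>)" by (intro continuous_intros)
  \<comment> \<open>Taking \<open>x0\<close> as a minimiser over the closure makes the weight
    nonnegative; it is at most the diameter because \<open>x0\<close> is itself a point of the
    closure.\<close>
  from continuous_attains_inf[OF cl this]
  obtain x0 where x0: "x0 \<in> closure \<Omega>" "\<And>x. x \<in> closure \<Omega> \<Longrightarrow> x0 \<bullet> \<eta> \<le> x \<bullet> \<eta>"
    by blast
  have weight: "0 \<le> x \<bullet> \<eta> + - (x0 \<bullet> \<eta>)" "x \<bullet> \<eta> + - (x0 \<bullet> \<eta>) \<le> \<delta>" if "x \<in> \<Omega>" for x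
  proof -
    have x: "x \<in> closure \<Omega>" using that closure_subset by blast
    then show "0 \<le> x \<bullet> \<eta> + - (x0 \<bullet> \<eta>)" using x0(2) by simp
    have "x \<bullet> \<eta> - x0 \<bullet> \<eta> \<le> norm (x - x0)"
      using norm_cauchy_schwarz[of "x - x0" \<eta>] \<eta> by (simp add: inner_diff_left)
    also have "\<dots> \<le> \<delta>"
      unfolding \<delta>_def using diameter_bounded_bound[OF compact_imp_bounded[OF cl(1)] x x0(1)]
      by (simp add: dist_norm)
    finally show "x \<bullet> \<eta> + - (x0 \<bullet> \<eta>) \<le> \<delta>" by simp
  qed
  have "(LINT x:\<Omega>|lborel. (v (x, t))\<^sup>2) \<le> C * (L2_norm (lebesgue_on (cylinder \<Omega> T)) v
      * L2_norm (lebesgue_on (cylinder \<Omega> T)) (\<lambda>z. snd (gradient v z) + H (snd z) \<bullet> fst (gradient v z))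
      + (L2_norm (lateral_measure \<Omega> T) v)\<^sup>2)"
    if v: "Ck (Suc 0) v" and L2: "L2 (lateral_measure \<Omega> T) v" and t: "t \<in> {0..T}" for v t
  proof -
    note cv = C1_facts(3)[OF v]
    define E where "E s = (LINT x:\<Omega>|lborel. (v (x, s))\<^sup>2)" for s
    define V where "V = L2_norm (lebesgue_on (cylinder \<Omega> T)) v
      * L2_norm (lebesgue_on (cylinder \<Omega> T)) (\<lambda>z. snd (gradient v z) + H (snd z) \<bullet> fst (gradient v z))"
    define B where "B = (L2_norm (lateral_measure \<Omega> T) v)\<^sup>2"
    define D where "D = 2 * V + A * B"
    have V: "0 \<le> V" and B: "0 \<le> B" by (auto simp: V_def B_def L2_norm_nonneg)
    have Om: "\<Omega> \<in> sets borel" using \<Omega> by simp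
    have c2: "continuous_on UNIV (\<lambda>z. (v z)\<^sup>2)" by (intro continuous_intros cv)
    note energy = energy_inequality[OF \<Omega>(1,2) v H Hm _ _ _ _ _ _ L2]
    have ordered: "\<bar>E r - E s\<bar> \<le> D" if "0 \<le> s" "s \<le> r" "r \<le> T" for r s
      \<comment> \<open>\<open>K = 1\<close>, \<open>p = 0\<close>, \<open>c = 1\<close>: the
        constant weight, for which the drift term disappears.\<close>
      using energy[OF that, of 1 0 1]
      by (simp add: E_def D_def V_def B_def A_def set_lebesgue_integral_def mult.assoc)
    have close: "\<bar>E r - E s\<bar> \<le> D" if "r \<in> {0..T}" "s \<in> {0..T}" for r s
      using ordered[of r s] ordered[of s r] that by (cases "r \<le> s") (auto simp: abs_minus_commute)
    define \<Phi> where "\<Phi> s = (LINT x:\<Omega>|lborel. (x \<bullet> \<eta> + - (x0 \<bullet> \<eta>)) * (v (x, s))\<^sup>2)" for s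
    have "\<bar>\<Phi> b - \<Phi> a - (LINT t:{a..b}|lborel. (H t \<bullet> \<eta>) * E t)\<bar> \<le> \<delta> * D"
      using energy[OF ab(1) less_imp_le[OF ab(2)] ab(3) \<delta> weight]
      by (simp add: E_def D_def V_def B_def A_def \<Phi>_def algebra_simps)
    then have flux: "(LINT t:{a..b}|lborel. (H t \<bullet> \<eta>) * E t) \<le> \<Phi> b - \<Phi> a + \<delta> * D" by linarith
    have "0 \<le> \<Phi> a"
      unfolding \<Phi>_def set_lebesgue_integral_def using weight(1)
      by (intro Bochner_Integration.integral_nonneg) (auto split: split_indicator)
    moreover have "\<Phi> b \<le> (LINT x:\<Omega>|lborel. \<delta> * (v (x, b))\<^sup>2)"
      unfolding \<Phi>_def using weight(2) \<Omega> Om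
      by (intro set_integral_mono set_integrable_continuous_bounded continuous_intros
          continuous_on_slice cv mult_right_mono) auto
    then have "\<Phi> b \<le> \<delta> * E b" by (simp add: E_def)
    moreover have "(b - a) * (\<sigma> * (E t - D)) \<le> (LINT t:{a..b}|lborel. (H t \<bullet> \<eta>) * E t)"
    proof -
      have "(b - a) * (\<sigma> * (E t - D)) = (LINT s:{a..b}|lborel. \<sigma> * (E t - D))"
        using ab by (simp add: set_lebesgue_integral_def)
      also have "\<dots> \<le> (LINT s:{a..b}|lborel. (H s \<bullet> \<eta>) * E s)"
      proof (rule set_integral_mono)
        show "set_integrable lborel {a..b} (\<lambda>s. \<sigma> * (E t - D))"
          by (intro set_integrable_continuous_bounded continuous_intros) auto
        have "continuous_on UNIV (\<lambda>z. (H (snd z) \<bullet> \<eta>) * (v z)\<^sup>2)"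
          by (intro continuous_intros cv continuous_on_compose2[OF H]) auto
        from product_integral_continuous(2)[OF this, of \<Omega> "{a..b}"]
        show "set_integrable lborel {a..b} (\<lambda>s. (H s \<bullet> \<eta>) * E s)"
          using \<Omega> Om by (simp add: E_def)
        fix s assume s: "s \<in> {a..b}"
        have E0: "0 \<le> E s" by (auto simp: E_def set_lebesgue_integral_def intro!: Bochner_Integration.integral_nonneg)
        have "E t - D \<le> E s" using close[of t s] t s ab by auto
        then have "\<sigma> * (E t - D) \<le> \<sigma> * E s" using \<sigma> by simp
        also have "\<dots> \<le> (H s \<bullet> \<eta>) * E s" by (intro mult_right_mono dir s E0)
        finally show "\<sigma> * (E t - D) \<le> (H s \<bullet> \<eta>) * E s" .
      qed
      finally show ?thesis .
    qed
    moreover have "\<delta> * E b \<le> \<delta> * (E t + D)"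
      using close[of b t] t ab \<delta> by (intro mult_left_mono) auto
    ultimately have "(b - a) * (\<sigma> * (E t - D)) \<le> \<delta> * (E t + D) + \<delta> * D"
      using flux by linarith
    then have "E t * (\<sigma> * (b - a) - \<delta>) \<le> (\<sigma> * (b - a) + 2 * \<delta>) * D"
      by (simp add: algebra_simps)
    then have "E t \<le> (\<sigma> * (b - a) + 2 * \<delta>) * D / (\<sigma> * (b - a) - \<delta>)"
      using gap by (simp add: pos_le_divide_eq)
    also have "\<dots> = (\<sigma> * (b - a) + 2 * \<delta>) / (\<sigma> * (b - a) - \<delta>) * D" by simp
    also have "\<dots> \<le> (\<sigma> * (b - a) + 2 * \<delta>) / (\<sigma> * (b - a) - \<delta>) * ((2 + A) * (V + B))"
    proof (rule mult_left_mono)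
      have "0 \<le> A * V" using A V by simp
      then show "D \<le> (2 + A) * (V + B)" using B by (simp add: D_def algebra_simps)
      show "0 \<le> (\<sigma> * (b - a) + 2 * \<delta>) / (\<sigma> * (b - a) - \<delta>)"
        using gap \<delta> by (intro divide_nonneg_pos) linarith+
    qed
    also have "\<dots> = C * (V + B)" by (simp add: C_def)
    finally show ?thesis by (simp add: E_def V_def B_def)
  qed
  with Cpos show ?thesis by blast
qed

section \<open>Traces and the main theorem\<close>

text \<open>Needed because the equation is stated for one weak gradient of \<open>u\<close> while
  the smooth approximations converge to a possibly different one.\<close>

lemma H1_gradient_unique:
  fixes G1 G2 :: "'a::euclidean_space \<Rightarrow> 'a"
  assumes U: "open U" "bounded U" and G1: "has_H1_gradient U u G1" and G2: "has_H1_gradient U u G2"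
  shows "AE z in lebesgue_on U. G1 z = G2 z"
proof -
  have Um: "U \<in> sets borel" using U by simp
  have L2: "L2 (lebesgue_on U) G1" "L2 (lebesgue_on U) G2" using G1 G2 by (auto simp: has_H1_gradient_def)
  have comp: "AE z in lebesgue_on U. (G1 z - G2 z) \<bullet> b = 0" if b: "b \<in> Basis" for b
  proof (rule fundamental_lemma_of_calculus_of_variations[OF U(1)])
    have prod_int: "integrable (lebesgue_on U) (\<lambda>z. (G z \<bullet> b) * \<phi> z)"
      if G: "L2 (lebesgue_on U) G" and \<phi>: "continuous_on UNIV \<phi>" for G and \<phi> :: "'a \<Rightarrow> real"
    proof -
      have Gb: "L2 (lebesgue_on U) (\<lambda>z. G z \<bullet> b)"
        by (rule L2_mono(1)[OF G, of _ 1]) (use G b in \<open>auto simp: L2_def Basis_le_norm\<close>)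
      note \<phi>2 = L2_continuous_bounded(1)[OF \<phi> U(2) Um]
      have "integrable (lebesgue_on U) (\<lambda>z. norm ((G z \<bullet> b) * \<phi> z))"
        using L2_cauchy_schwarz(1)[OF Gb \<phi>2] by (simp add: abs_mult)
      moreover have "(\<lambda>z. (G z \<bullet> b) * \<phi> z) \<in> borel_measurable (lebesgue_on U)"
        using Gb \<phi>2 by (intro borel_measurable_times) (auto simp: L2_def)
      ultimately show ?thesis by (rule Bochner_Integration.integrable_norm_cancel)
    qed
    \<comment> \<open>With the factor 1 this is the inclusion of L2 in L1 on a bounded set.\<close>
    show "integrable (lebesgue_on U) (\<lambda>z. (G1 z - G2 z) \<bullet> b)"
      using prod_int[OF L2_diff[OF L2], of "\<lambda>_. 1"] by simp
    fix \<phi> assume \<phi>: "test_function U \<phi>"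
    then have "Ck 0 \<phi>" unfolding test_function_def smooth_def by blast
    then have c: "continuous_on UNIV \<phi>" by simp
    have "(\<integral>z. (G1 z \<bullet> b) * \<phi> z \<partial>lebesgue_on U) = (\<integral>z. (G2 z \<bullet> b) * \<phi> z \<partial>lebesgue_on U)"
      using G1 G2 \<phi> b unfolding has_H1_gradient_def weak_gradient_def by fastforce
    then show "(\<integral>z. (G1 z - G2 z) \<bullet> b * \<phi> z \<partial>lebesgue_on U) = 0"
      using prod_int[OF L2(1) c] prod_int[OF L2(2) c] by (simp add: inner_diff_left left_diff_distrib)
  qed
  then have "AE z in lebesgue_on U. \<forall>b\<in>Basis. (G1 z - G2 z) \<bullet> b = 0"
    by (intro AE_finite_allI) auto
  then show ?thesis
    by eventually_elim (metis euclidean_all_zero_iff right_minus_eq)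
qed

lemma smooth_imp_C1: "smooth f \<Longrightarrow> Ck (Suc 0) f"
  unfolding smooth_def by blast

text \<open>With \<open>\<Psi> = \<Phi>\<close> this is the Cauchy property behind the existence of
  the time trace; with two sequences it makes the trace independent of the approximation. The
  difference of the sequences tends to 0 in L2 with bounded gradients, which suffices for
  \<open>time_slice_estimate\<close>.\<close>

lemma time_slices_approach:
  fixes \<Omega> :: "'a::euclidean_space set"
  assumes \<Omega>: "open \<Omega>" "bounded \<Omega>" and T: "0 < T" and t: "t \<in> {0..T}" and e: "0 < e"
    and \<Phi>: "smooth_H1_tendsto (cylinder \<Omega> T) \<Phi> u" and \<Psi>: "smooth_H1_tendsto (cylinder \<Omega> T) \<Psi> u"
  shows "\<exists>N. \<forall>m\<ge>N. \<forall>n\<ge>N. L2_norm (lebesgue_on \<Omega>) (\<lambda>x. \<Phi> m (x, t) - \<Psi> n (x, t)) < e"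
proof -
  let ?M = "lebesgue_on (cylinder \<Omega> T)"
  have Om: "\<Omega> \<in> sets borel" using \<Omega> by simp
  have C: "bounded (cylinder \<Omega> T)" "cylinder \<Omega> T \<in> sets borel"
    using \<Omega> Om by (auto simp: cylinder_def bounded_Times borel_Times)
  obtain G where \<Phi>': "\<And>n. Ck (Suc 0) (\<Phi> n)" "L2_tendsto ?M \<Phi> u" "L2_tendsto ?M (\<lambda>n. gradient (\<Phi> n)) G"
    using \<Phi> smooth_imp_C1 unfolding smooth_H1_tendsto_def by blast
  obtain G' where \<Psi>': "\<And>n. Ck (Suc 0) (\<Psi> n)" "L2_tendsto ?M \<Psi> u" "L2_tendsto ?M (\<lambda>n. gradient (\<Psi> n)) G'"
    using \<Psi> smooth_imp_C1 unfolding smooth_H1_tendsto_def by blast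
  obtain B1 where B1: "\<And>n. L2_norm ?M (gradient (\<Phi> n)) \<le> B1"
    using convergent_imp_Bseq[OF convergentI[OF L2_tendsto_norm[OF \<Phi>'(3)]]]
    by (auto simp: Bseq_def L2_norm_nonneg)
  obtain B2 where B2: "\<And>n. L2_norm ?M (gradient (\<Psi> n)) \<le> B2"
    using convergent_imp_Bseq[OF convergentI[OF L2_tendsto_norm[OF \<Psi>'(3)]]]
    by (auto simp: Bseq_def L2_norm_nonneg)
  define B where "B = B1 + B2"
  have B: "0 \<le> B" using B1[of 0] B2[of 0] L2_norm_nonneg[of ?M "gradient (\<Phi> 0)"]
      L2_norm_nonneg[of ?M "gradient (\<Psi> 0)"] unfolding B_def by linarith
  \<comment> \<open>The minimum with 1 bounds the inner \<open>X\<close> of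
    \<open>X * (X + 2 * T * B)\<close> by 1; the second entry then makes the product smaller than
    \<open>T * e\<^sup>2\<close>.\<close>
  define \<rho> where "\<rho> = min 1 (T * e\<^sup>2 / (1 + 2 * T * B))"
  have den: "0 < 1 + 2 * T * B" using T B by (simp add: add_pos_nonneg)
  have \<rho>: "0 < \<rho>" unfolding \<rho>_def using T e den by simp
  have "\<forall>\<^sub>F n in sequentially. L2_norm ?M (\<lambda>z. \<Phi> n z - u z) < \<rho> / 2"
    using \<Phi>'(2) \<rho> unfolding L2_tendsto_def by (intro order_tendstoD(2)) auto
  moreover have "\<forall>\<^sub>F n in sequentially. L2_norm ?M (\<lambda>z. \<Psi> n z - u z) < \<rho> / 2"
    using \<Psi>'(2) \<rho> unfolding L2_tendsto_def by (intro order_tendstoD(2)) auto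
  ultimately have "\<forall>\<^sub>F n in sequentially. L2_norm ?M (\<lambda>z. \<Phi> n z - u z) < \<rho> / 2 \<and> L2_norm ?M (\<lambda>z. \<Psi> n z - u z) < \<rho> / 2"
    by (rule eventually_conj)
  then obtain N where N: "\<And>n. N \<le> n \<Longrightarrow> L2_norm ?M (\<lambda>z. \<Phi> n z - u z) < \<rho> / 2"
    "\<And>n. N \<le> n \<Longrightarrow> L2_norm ?M (\<lambda>z. \<Psi> n z - u z) < \<rho> / 2"
    unfolding eventually_sequentially by blast
  have "L2_norm (lebesgue_on \<Omega>) (\<lambda>x. \<Phi> m (x, t) - \<Psi> n (x, t)) < e" if mn: "N \<le> m" "N \<le> n" for m n
  proof -
    let ?d = "\<lambda>z. \<Phi> m z - \<Psi> n z"
    note d = gradient_diff[OF \<Phi>'(1)[of m] \<Psi>'(1)[of n]]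
    have L2s: "L2 ?M (\<Phi> m)" "L2 ?M (\<Psi> n)" "L2 ?M u" "L2 ?M (gradient (\<Phi> m))" "L2 ?M (gradient (\<Psi> n))"
      using \<Phi>'(2,3) \<Psi>'(2,3) by (auto simp: L2_tendsto_def)
    define X where "X = L2_norm ?M ?d"
    have X0: "0 \<le> X" by (simp add: X_def L2_norm_nonneg)
    have "X \<le> L2_norm ?M (\<lambda>z. \<Phi> m z - u z) + L2_norm ?M (\<lambda>z. u z - \<Psi> n z)"
      unfolding X_def by (intro L2_norm_diff_triangle L2s)
    then have X: "X < \<rho>" using N(1)[OF mn(1)] N(2)[OF mn(2)] L2_norm_minus_commute[of ?M u "\<Psi> n"] by linarith
    have "L2_norm ?M (gradient ?d) = L2_norm ?M (\<lambda>z. gradient (\<Phi> m) z + - gradient (\<Psi> n) z)"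
      by (intro arg_cong[of _ _ "L2_norm ?M"] ext) (simp add: d(2))
    also have "\<dots> \<le> L2_norm ?M (gradient (\<Phi> m)) + L2_norm ?M (\<lambda>z. - gradient (\<Psi> n) z)"
      by (intro L2_add_triangle(2) L2_uminus(1) L2s)
    also have "\<dots> \<le> B" using B1[of m] B2[of n] by (simp add: L2_uminus(2) B_def)
    finally have Y: "L2_norm ?M (gradient ?d) \<le> B" .
    have "T * (L2_norm (lebesgue_on \<Omega>) (\<lambda>x. ?d (x, t)))\<^sup>2 = T * (LINT x:\<Omega>|lborel. (?d (x, t))\<^sup>2)"
      using L2_continuous_bounded(2)[OF continuous_on_slice(1)[OF C1_facts(3)[OF d(1)]] \<Omega>(2) Om] by simp
    also have "\<dots> \<le> X * (X + 2 * T * L2_norm ?M (gradient ?d))"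
      unfolding X_def using t by (intro time_slice_estimate \<Omega> d(1) T) auto
    also have "\<dots> \<le> X * (1 + 2 * T * B)"
      using X X0 Y T unfolding \<rho>_def by (intro mult_left_mono add_mono) auto
    also have "\<dots> < \<rho> * (1 + 2 * T * B)" using X den by simp
    also have "\<dots> \<le> T * e\<^sup>2 / (1 + 2 * T * B) * (1 + 2 * T * B)"
      using den by (intro mult_right_mono) (auto simp: \<rho>_def)
    also have "\<dots> = T * e\<^sup>2" using den by simp
    finally have "(L2_norm (lebesgue_on \<Omega>) (\<lambda>x. ?d (x, t)))\<^sup>2 < e\<^sup>2" using T by simp
    then show ?thesis using e by (simp add: power2_less_imp_less)
  qed
  then show ?thesis by blast
qed

lemma partition_mono:
  assumes "is_partition T m \<tau>" "i \<le> j" "j \<le> m" shows "\<tau> i \<le> \<tau> j"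
  using assms(2,3)
proof (induction j rule: dec_induct)
  case (step k)
  then have "\<tau> k < \<tau> (Suc k)" using assms(1) by (simp add: is_partition_def)
  with step show ?case by simp
qed simp

text \<open>The point 0 of the closure lies at distance exactly \<open>radius S r \<Omega> j\<close>
  from the source point, which puts this radius between \<open>min_dist\<close> and
  \<open>max_dist\<close>. The radius is at least the diameter because
  \<open>(1 + S) / (1 - S) \<ge> 1\<close>.\<close>

lemma long_transport_interval:
  fixes \<Omega> :: "'a::euclidean_space set"
  assumes \<Omega>: "bounded \<Omega>" and zero: "0 \<in> closure \<Omega>"
    and S: "1 / sqrt 2 < S" "S < 1" and r: "0 < r" and speed: "0 < min_speed T H"
    and norm_eta: "norm (eta H \<tau> j) = 1" and step: "\<tau> j < \<tau> (Suc j)"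
    and big: "1 / (min_speed T H * (2 * S\<^sup>2 - 1)) < (\<tau> (Suc j) - \<tau> j) * min_dist \<Omega> (source_point S r \<Omega> H \<tau> j)
                  / (max_dist \<Omega> (source_point S r \<Omega> H \<tau> j))\<^sup>2"
  shows "diameter (closure \<Omega>) < S * min_speed T H * (\<tau> (Suc j) - \<tau> j)"
proof -
  let ?p = "source_point S r \<Omega> H \<tau> j" and ?\<delta> = "diameter (closure \<Omega>)" and ?\<Delta> = "\<tau> (Suc j) - \<tau> j"
  have cl: "compact (closure \<Omega>)" using \<Omega> by (simp add: compact_closure)
  have \<delta>: "0 \<le> ?\<delta>" using cl by (intro diameter_ge_0 compact_imp_bounded)
  have "0 < 1 / sqrt 2" by simp
  then have S0: "0 < S" using S(1) by linarith
  have "(1 / sqrt 2)\<^sup>2 < S\<^sup>2" using S(1) by (intro power_strict_mono) auto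
  then have \<kappa>: "0 < 2 * S\<^sup>2 - 1" by (simp add: power_divide)
  \<comment> \<open>The product expands to \<open>S - (2 * S\<^sup>2 - 1)\<close>; it serves to
    replace the factor in the threshold by the cosine bound \<open>S\<close>.\<close>
  have "0 < (1 - S) * (1 + 2 * S)" using S(2) S0 by simp
  then have \<kappa>S: "2 * S\<^sup>2 - 1 < S" by (simp add: algebra_simps power2_eq_square)
  have "1 \<le> (1 + S) / (1 - S)" using S(2) S0 by (simp add: pos_le_divide_eq)
  then have R0: "?\<delta> \<le> (1 + S) / (1 - S) * ?\<delta>" using mult_right_mono[OF _ \<delta>] by fastforce
  have "1 * ?\<delta> + 0 \<le> radius S r \<Omega> j"
    unfolding radius_def
  proof (intro add_mono mult_nonneg_nonneg)
    show "1 * ?\<delta> \<le> 2 ^ j * ((1 + S) / (1 - S) * ?\<delta>)" using R0 \<delta> by (intro mult_mono) auto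
  qed (use \<delta> r in auto)
  then have R: "?\<delta> \<le> radius S r \<Omega> j" by simp
  have np: "norm (0 - ?p) = radius S r \<Omega> j"
    using R \<delta> norm_eta by (simp add: source_point_def)
  have d: "min_dist \<Omega> ?p \<le> radius S r \<Omega> j"
    unfolding min_dist_def np[symmetric] by (rule cINF_lower[OF _ zero]) (auto intro!: bdd_belowI2[of _ 0])
  have "bdd_above ((\<lambda>x. norm (x - ?p)) ` closure \<Omega>)"
    by (intro bounded_imp_bdd_above compact_imp_bounded compact_continuous_image cl continuous_intros)
  then have M: "radius S r \<Omega> j \<le> max_dist \<Omega> ?p"
    unfolding max_dist_def np[symmetric] by (rule cSUP_upper[OF zero])
  let ?M = "max_dist \<Omega> ?p"
  have bound_pos: "0 < 1 / (min_speed T H * (2 * S\<^sup>2 - 1))" using speed \<kappa> by simp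
  \<comment> \<open>For \<open>?M = 0\<close> the quotient in \<open>big\<close> would be 0 by the
    convention on division, contrary to its positive lower bound.\<close>
  have Mpos: "0 < ?M"
  proof (rule ccontr)
    assume "\<not> 0 < ?M"
    then have "?M = 0" using M R \<delta> by linarith
    with big bound_pos show False by simp
  qed
  have "?\<Delta> * min_dist \<Omega> ?p / ?M\<^sup>2 \<le> ?\<Delta> * ?M / ?M\<^sup>2"
    using d M step by (intro divide_right_mono mult_left_mono) auto
  also have "\<dots> = ?\<Delta> / ?M" using Mpos by (simp add: power2_eq_square)
  finally have "1 / (min_speed T H * (2 * S\<^sup>2 - 1)) < ?\<Delta> / ?M" using big by linarith
  then have "?M < ?\<Delta> * (min_speed T H * (2 * S\<^sup>2 - 1))"
    using Mpos speed \<kappa> by (simp add: pos_divide_less_eq pos_less_divide_eq mult.commute)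
  also have "\<dots> \<le> ?\<Delta> * (min_speed T H * S)"
    using step speed \<kappa>S by (intro mult_left_mono) auto
  finally show ?thesis using R M by (simp add: mult_ac)
qed

theorem theorem1p6:
  fixes \<Omega> :: "(real ^ 'd) set"
    and T S r :: real
    and H :: "real \<Rightarrow> real ^ 'd"
    and m :: nat
    and \<tau> :: "nat \<Rightarrow> real"
  assumes "0 < T"
    and "bounded_smooth_domain \<Omega>"
    and "0 \<in> closure \<Omega>"
    and "1 / sqrt 2 < S" and "S < 1"
    and "0 < r"
    and "C1_on_interval T H"
    and "0 < min_speed T H"
    and "is_partition T m \<tau>"
    and "\<forall>j<m. \<forall>t\<in>{\<tau> j..\<tau> (Suc j)}. (H t /\<^sub>R norm (H t)) \<bullet> eta H \<tau> j \<ge> S"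
    and "Max ((\<lambda>j. (\<tau> (Suc j) - \<tau> j) * min_dist \<Omega> (source_point S r \<Omega> H \<tau> j)
                  / (max_dist \<Omega> (source_point S r \<Omega> H \<tau> j))\<^sup>2) ` {0..m - 1})
         > 1 / (min_speed T H * (2 * S\<^sup>2 - 1))"
  shows "\<exists>C>0. \<forall>g u.
           L2 (lateral_measure \<Omega> T) g \<longrightarrow> H1 (cylinder \<Omega> T) u \<longrightarrow>
           transport_solution \<Omega> T H u \<longrightarrow> has_lateral_trace \<Omega> T u g \<longrightarrow>
           (\<forall>t\<in>{0..T}. (\<exists>w. has_time_trace \<Omega> T u t w) \<and>
              (\<forall>w. has_time_trace \<Omega> T u t w \<longrightarrow>
                 L2_norm (lebesgue_on \<Omega>) w \<le> C * L2_norm (lateral_measure \<Omega> T) g))"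
proof -
  let ?C = "cylinder \<Omega> T" and ?L = "lateral_measure \<Omega> T"
  let ?q = "\<lambda>j. (\<tau> (Suc j) - \<tau> j) * min_dist \<Omega> (source_point S r \<Omega> H \<tau> j)
                  / (max_dist \<Omega> (source_point S r \<Omega> H \<tau> j))\<^sup>2"
  have \<Omega>: "open \<Omega>" "bounded \<Omega>" "\<Omega> \<noteq> {}"
    using assms(2) by (auto simp: bounded_smooth_domain_def)
  have Om: "\<Omega> \<in> sets borel" using \<Omega> by simp
  have Co: "open ?C" "bounded ?C" "?C \<in> sets borel"
    using \<Omega> Om by (auto simp: cylinder_def open_Times bounded_Times borel_Times)
  have cH: "continuous_on {0..T} H"
    using assms(7) unfolding C1_on_interval_def continuous_on_eq_continuous_within
    by (auto dest: has_vector_derivative_continuous)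
  have speed: "min_speed T H \<le> norm (H t)" if "t \<in> {0..T}" for t
    unfolding min_speed_def by (rule cINF_lower[OF _ that]) (auto intro!: bdd_belowI2[of _ 0])
  \<comment> \<open>Constant extension of \<open>H\<close> beyond the time interval, so that
    continuity and the norm bound hold on the whole line as \<open>energy_inequality\<close>
    demands.\<close>
  define HH where "HH t = H (max 0 (min T t))" for t
  have HH: "HH t = H t" if "t \<in> {0..T}" for t using that by (simp add: HH_def)
  have cHH: "continuous_on UNIV HH"
    unfolding HH_def[abs_def]
    by (rule continuous_on_compose2[OF cH]) (use assms(1) in \<open>auto intro!: continuous_intros\<close>)
  obtain Hm where Hm: "\<And>t. t \<in> {0..T} \<Longrightarrow> norm (H t) \<le> Hm"
    using compact_imp_bounded[OF compact_continuous_image[OF cH compact_Icc]]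
    unfolding bounded_iff by blast
  have HHm: "norm (HH t) \<le> Hm" for t
    unfolding HH_def using assms(1) by (intro Hm) auto
  have Hm0: "0 \<le> Hm" using HHm[of 0] norm_ge_zero[of "HH 0"] by linarith
  obtain j where j: "j \<in> {0..m - 1}" "1 / (min_speed T H * (2 * S\<^sup>2 - 1)) < ?q j"
  proof -
    have "Max (?q ` {0..m - 1}) \<in> ?q ` {0..m - 1}" by (intro Max_in) auto
    then obtain k where k: "k \<in> {0..m - 1}" "Max (?q ` {0..m - 1}) = ?q k" by blast
    from assms(11) have "1 / (min_speed T H * (2 * S\<^sup>2 - 1)) < ?q k" unfolding k(2) .
    with k(1) show ?thesis by (rule that)
  qed
  have part: "1 \<le> m" "\<tau> 0 = 0" "\<tau> m = T" "\<And>j. j < m \<Longrightarrow> \<tau> j < \<tau> (Suc j)"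
    using assms(9) unfolding is_partition_def by blast+
  \<comment> \<open>Uses \<open>1 \<le> m\<close>: the subtraction in \<open>{0..m - 1}\<close> is
    truncated.\<close>
  have jm: "j < m" using j(1) part(1) by auto
  have step: "\<tau> j < \<tau> (Suc j)" by (rule part(4)[OF jm])
  have range: "0 \<le> \<tau> j" "\<tau> (Suc j) \<le> T"
    using partition_mono[OF assms(9), of 0 j] partition_mono[OF assms(9), of "Suc j" m] jm part(2,3)
    by simp_all
  have Hnz: "0 < norm (H t)" if "t \<in> {0..T}" for t using speed[OF that] assms(8) by linarith
  have eta: "norm (eta H \<tau> j) = 1"
    using Hnz[of "\<tau> j"] range step by (simp add: eta_def)
  have "0 < 1 / sqrt 2" by simp
  then have S0: "0 < S" using assms(4) by linarith
  have dir: "S * min_speed T H \<le> HH t \<bullet> eta H \<tau> j" if t: "t \<in> {\<tau> j..\<tau> (Suc j)}" for t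
  proof -
    have t': "t \<in> {0..T}" using t range by auto
    have "S \<le> (H t /\<^sub>R norm (H t)) \<bullet> eta H \<tau> j" using assms(10) jm t by blast
    then have "S * norm (H t) \<le> H t \<bullet> eta H \<tau> j"
      using Hnz[OF t'] by (simp add: pos_le_divide_eq inverse_eq_divide)
    moreover have "S * min_speed T H \<le> S * norm (H t)" using speed[OF t'] S0 by simp
    ultimately show ?thesis using HH[OF t'] by simp
  qed
  have long: "diameter (closure \<Omega>) < S * min_speed T H * (\<tau> (Suc j) - \<tau> j)"
    by (rule long_transport_interval[OF \<Omega>(2) assms(3-6,8) eta step j(2)])
  have \<sigma>: "0 < S * min_speed T H" using S0 assms(8) by simp
  obtain C where C: "0 < C" "\<And>v t. Ck (Suc 0) v \<Longrightarrow> L2 ?L v \<Longrightarrow> t \<in> {0..T} \<Longrightarrow>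
    (LINT x:\<Omega>|lborel. (v (x, t))\<^sup>2) \<le> C * (L2_norm (lebesgue_on ?C) v
      * L2_norm (lebesgue_on ?C) (\<lambda>z. snd (gradient v z) + HH (snd z) \<bullet> fst (gradient v z))
      + (L2_norm ?L v)\<^sup>2)"
    using smooth_observability[OF \<Omega> cHH HHm range(1) step range(2) eta \<sigma> dir long] by blast
  have main: "(\<exists>w. has_time_trace \<Omega> T u t w) \<and> (\<forall>w. has_time_trace \<Omega> T u t w \<longrightarrow>
      L2_norm (lebesgue_on \<Omega>) w \<le> sqrt C * L2_norm ?L g)"
    if tr: "transport_solution \<Omega> T H u" and lat: "has_lateral_trace \<Omega> T u g" and t: "t \<in> {0..T}" for g u t
  proof -
    obtain \<Phi> where \<Phi>: "smooth_H1_tendsto ?C \<Phi> u" and \<Phi>g: "L2_tendsto ?L \<Phi> g"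
      using lat unfolding has_lateral_trace_def by blast
    obtain G where G: "has_H1_gradient ?C u G" and \<Phi>': "\<And>n. Ck (Suc 0) (\<Phi> n)"
      "L2_tendsto (lebesgue_on ?C) \<Phi> u" "L2_tendsto (lebesgue_on ?C) (\<lambda>n. gradient (\<Phi> n)) G"
      using \<Phi> smooth_imp_C1 unfolding smooth_H1_tendsto_def by blast
    obtain G' where G': "has_H1_gradient ?C u G'"
      "AE z in lebesgue_on ?C. snd (G' z) + H (snd z) \<bullet> fst (G' z) = 0"
      using tr unfolding transport_solution_def by blast
    \<comment> \<open>Transfers the equation from its own gradient \<open>G'\<close> to the limit
      \<open>G\<close> of the smooth gradients, and from \<open>H\<close> to \<open>HH\<close>,
      which agree at the times of the cylinder.\<close>
    have eqG: "AE z in lebesgue_on ?C. snd (G z) + HH (snd z) \<bullet> fst (G z) = 0"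
      using H1_gradient_unique[OF Co(1,2) G G'(1)] G'(2) AE_space
    proof eventually_elim
      case (elim z)
      then have "HH (snd z) = H (snd z)" by (intro HH) (auto simp: cylinder_def space_restrict_space)
      with elim show ?case by simp
    qed
    define f where "f n z = snd (gradient (\<Phi> n) z) + HH (snd z) \<bullet> fst (gradient (\<Phi> n) z)" for n z
    have cf: "continuous_on UNIV (f n)" for n
      unfolding f_def[abs_def]
      by (intro continuous_intros C1_facts(2)[OF \<Phi>'(1)] continuous_on_compose2[OF cHH]) auto
    \<comment> \<open>Subtracting the equation for \<open>G\<close> writes \<open>f n\<close> as a
      linear expression in \<open>gradient (\<Phi> n) - G\<close>, with operator norm at most
      \<open>1 + Hm\<close>.\<close>
    have "L2_norm (lebesgue_on ?C) (f n) \<le> (1 + Hm) * L2_norm (lebesgue_on ?C) (\<lambda>z. gradient (\<Phi> n) z - G z)" for n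
    proof (rule L2_mono(2))
      show "L2 (lebesgue_on ?C) (\<lambda>z. gradient (\<Phi> n) z - G z)"
        using \<Phi>'(3) by (intro L2_diff) (auto simp: L2_tendsto_def)
      show "f n \<in> borel_measurable (lebesgue_on ?C)"
        using L2_continuous_bounded(1)[OF cf Co(2,3)] by (simp add: L2_def)
      show "AE z in lebesgue_on ?C. norm (f n z) \<le> (1 + Hm) * norm (gradient (\<Phi> n) z - G z)"
        using eqG
      proof eventually_elim
        case (elim z)
        let ?D = "gradient (\<Phi> n) z - G z"
        have "f n z = snd ?D + HH (snd z) \<bullet> fst ?D"
          using elim by (simp add: f_def inner_diff_right)
        then have "norm (f n z) \<le> norm (snd ?D) + norm (HH (snd z)) * norm (fst ?D)"
          using norm_triangle_ineq[of "snd ?D" "HH (snd z) \<bullet> fst ?D"] Cauchy_Schwarz_ineq2[of "HH (snd z)" "fst ?D"]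
          by simp
        also have "\<dots> \<le> norm ?D + Hm * norm ?D"
        proof (intro add_mono mult_mono HHm Hm0)
          show "norm (snd ?D) \<le> norm ?D" "norm (fst ?D) \<le> norm ?D"
            using norm_snd_le[of "snd ?D" "fst ?D"] norm_fst_le[of "fst ?D" "snd ?D"]
            unfolding prod.collapse by simp_all
        qed simp
        finally show ?case by (simp add: algebra_simps)
      qed
    qed (use Hm0 in simp)
    then have f_le: "\<forall>\<^sub>F n in sequentially. L2_norm (lebesgue_on ?C) (f n)
        \<le> (1 + Hm) * L2_norm (lebesgue_on ?C) (\<lambda>z. gradient (\<Phi> n) z - G z)"
      by simp
    have f_lim: "(\<lambda>n. L2_norm (lebesgue_on ?C) (f n)) \<longlonglongrightarrow> 0"
    proof (rule tendsto_sandwich[OF _ f_le tendsto_const])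
      have "(\<lambda>n. L2_norm (lebesgue_on ?C) (\<lambda>z. gradient (\<Phi> n) z - G z)) \<longlonglongrightarrow> 0"
        using \<Phi>'(3) by (simp add: L2_tendsto_def)
      from tendsto_mult_left[OF this, of "1 + Hm"]
      show "(\<lambda>n. (1 + Hm) * L2_norm (lebesgue_on ?C) (\<lambda>z. gradient (\<Phi> n) z - G z)) \<longlonglongrightarrow> 0" by simp
    qed (simp add: L2_norm_nonneg)
    have slice: "continuous_on UNIV (\<lambda>x. \<Phi> n (x, t))" for n
      by (intro continuous_on_slice C1_facts(3) \<Phi>'(1))
    have est: "(L2_norm (lebesgue_on \<Omega>) (\<lambda>x. \<Phi> n (x, t)))\<^sup>2
        \<le> C * (L2_norm (lebesgue_on ?C) (\<Phi> n) * L2_norm (lebesgue_on ?C) (f n) + (L2_norm ?L (\<Phi> n))\<^sup>2)" for n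
    proof -
      have "L2 ?L (\<Phi> n)" using \<Phi>g by (simp add: L2_tendsto_def)
      from C(2)[OF \<Phi>'(1) this t] show ?thesis
        using L2_continuous_bounded(2)[OF slice[of n] \<Omega>(2) Om] by (simp add: f_def[abs_def])
    qed
    \<comment> \<open>The source term disappears in the limit because the norms of
      \<open>\<Phi> n\<close> converge while those of \<open>f n\<close> tend to 0; only the
      boundary term remains.\<close>
    have bound_lim: "(\<lambda>n. C * (L2_norm (lebesgue_on ?C) (\<Phi> n) * L2_norm (lebesgue_on ?C) (f n) + (L2_norm ?L (\<Phi> n))\<^sup>2))
        \<longlonglongrightarrow> C * (L2_norm (lebesgue_on ?C) u * 0 + (L2_norm ?L g)\<^sup>2)"
      by (intro tendsto_intros L2_tendsto_norm \<Phi>'(2) \<Phi>g f_lim)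
    have slice_norm: "L2_norm (lebesgue_on \<Omega>) w \<le> sqrt C * L2_norm ?L g"
      if w: "L2_tendsto (lebesgue_on \<Omega>) (\<lambda>n x. \<Phi> n (x, t)) w" for w
    proof -
      have "(\<lambda>n. (L2_norm (lebesgue_on \<Omega>) (\<lambda>x. \<Phi> n (x, t)))\<^sup>2) \<longlonglongrightarrow> (L2_norm (lebesgue_on \<Omega>) w)\<^sup>2"
        by (intro tendsto_intros L2_tendsto_norm w)
      then have "(L2_norm (lebesgue_on \<Omega>) w)\<^sup>2 \<le> C * (L2_norm (lebesgue_on ?C) u * 0 + (L2_norm ?L g)\<^sup>2)"
        by (rule LIMSEQ_le[OF _ bound_lim]) (use est in blast)
      also have "\<dots> = (sqrt C * L2_norm ?L g)\<^sup>2" using C(1) by (simp add: power_mult_distrib)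
      finally show ?thesis
        by (rule power2_le_imp_le) (use C(1) in \<open>simp add: L2_norm_nonneg\<close>)
    qed
    have slice_L2: "L2 (lebesgue_on \<Omega>) (\<lambda>x. \<Phi> n (x, t))" for n
      by (rule L2_continuous_bounded(1)[OF slice \<Omega>(2) Om])
    obtain w0 where w0: "L2_tendsto (lebesgue_on \<Omega>) (\<lambda>n x. \<Phi> n (x, t)) w0"
      by (rule L2_complete[of "lebesgue_on \<Omega>" "\<lambda>n x. \<Phi> n (x, t)"])
        (use slice_L2 time_slices_approach[OF \<Omega>(1,2) assms(1) t _ \<Phi> \<Phi>] in blast)+
    have "has_time_trace \<Omega> T u t w0"
      unfolding has_time_trace_def using \<Phi> w0 by blast
    moreover have "L2_norm (lebesgue_on \<Omega>) w \<le> sqrt C * L2_norm ?L g" if w: "has_time_trace \<Omega> T u t w" for w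
    proof -
      obtain \<Psi> where \<Psi>: "smooth_H1_tendsto ?C \<Psi> u" "L2_tendsto (lebesgue_on \<Omega>) (\<lambda>n x. \<Psi> n (x, t)) w"
        using w unfolding has_time_trace_def by blast
      have "L2_tendsto (lebesgue_on \<Omega>) (\<lambda>n x. \<Phi> n (x, t)) w"
        unfolding L2_tendsto_def
      proof (intro conjI allI slice_L2 LIMSEQ_I)
        show wL2: "L2 (lebesgue_on \<Omega>) w" using \<Psi>(2) by (simp add: L2_tendsto_def)
        fix e :: real assume e: "0 < e"
        obtain N where N: "\<And>m n. N \<le> m \<Longrightarrow> N \<le> n \<Longrightarrow> L2_norm (lebesgue_on \<Omega>) (\<lambda>x. \<Phi> m (x, t) - \<Psi> n (x, t)) < e / 2"
          using time_slices_approach[OF \<Omega>(1,2) assms(1) t half_gt_zero[OF e] \<Phi> \<Psi>(1)] by blast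
        have "\<forall>\<^sub>F n in sequentially. L2_norm (lebesgue_on \<Omega>) (\<lambda>x. \<Psi> n (x, t) - w x) < e / 2"
          using \<Psi>(2) e unfolding L2_tendsto_def by (intro order_tendstoD(2)) auto
        then obtain N' where N': "\<And>n. N' \<le> n \<Longrightarrow> L2_norm (lebesgue_on \<Omega>) (\<lambda>x. \<Psi> n (x, t) - w x) < e / 2"
          unfolding eventually_sequentially by blast
        have "norm (L2_norm (lebesgue_on \<Omega>) (\<lambda>x. \<Phi> n (x, t) - w x) - 0) < e" if n: "N \<le> n" for n
        proof -
          let ?k = "max N N'"
          have "L2 (lebesgue_on \<Omega>) (\<lambda>x. \<Psi> ?k (x, t))" using \<Psi>(2) by (simp add: L2_tendsto_def)
          from L2_norm_diff_triangle[OF slice_L2 this wL2, of n] N[OF n, of ?k] N'[of ?k]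
          show ?thesis by (simp add: L2_norm_nonneg)
        qed
        then show "\<exists>no. \<forall>n\<ge>no. norm (L2_norm (lebesgue_on \<Omega>) (\<lambda>x. \<Phi> n (x, t) - w x) - 0) < e" by blast
      qed
      then show ?thesis by (rule slice_norm)
    qed
    ultimately show ?thesis by blast
  qed
  have "0 < sqrt C" using C(1) by simp
  with main show ?thesis by blast
qed

end
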